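(* Let $G$ be the quaternion group and let $M:=R_9\oplus Q_3(G)$. Then $M$ is representable over some skew partial field, but $M$ is not representable over any skew field.
   Context: A skew partial field is a pair $\mathbb{P}=(R,G')$ with $R$ a (not necessarily commutative) ring with identity and $G'$ a subgroup of the units $R^*$ with $-1\in G'$. An $R$-chain group on a finite set $E$ is a subset of $R^E$ containing $0$ and closed under componentwise addition and left scalar multiplication. A chain $c$ is elementary in $C$ if $c\ne0$ and no nonzero chain of $C$ has support strictly contained in $\|c\|=\{e:c_e\ne0\}$; $c$ is $G'$-primitive if its entries lie in $G'\cup\{0\}$. A $\mathbb{P}$-chain group is an $R$-chain group in which every elementary chain equals $rc'$ with $r\in R$, $c'$ a $G'$-primitive chain of the group; $M(C)$ is the matroid whose cocircuits are supports of elementary chains. $M$ is representable over $\mathbb{P}$ if $M=M(C)$ for some $\mathbb{P}$-chain group $C$; $M$ is representable over a skew field $\mathbb{F}$ if it is representable over $(\mathbb{F},\mathbb{F}\setminus\{0\})$. The quaternion group $G=\{\pm1,\pm i,\pm j,\pm k\}$ has $i^2=j^2=k^2=ijk=-1$. Let $g_1,\dots,g_8$ be $1,-1,i,-i,j,-j,k,-k$. $Q_3(G)$ is the matroid on $\{e_1,e_2,e_3,a_1,\dots,a_8,b_1,\dots,b_8,c_1,\dots,c_8\}$ represented over the quaternions $\mathbb{H}$ by the $3\times27$ matrix whose column $e_t$ is the $t$-th unit vector, column $a_m$ is $(-1,g_m,0)^T$, column $b_m$ is $(0,-1,g_m)^T$, column $c_m$ is $(g_m,0,-1)^T$. $R_9$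 is the matroid on $\{1,\dots,9\}$ represented over $\mathrm{GF}(3)$ by the matrix with rows $(1,0,0,1,1,1,0,0,1)$, $(0,1,0,1,1,2,1,1,0)$, $(0,0,1,1,0,0,1,2,1)$. $\oplus$ denotes the direct sum of matroids. *)

theory Defs
  imports
    "HOL-Algebra.Ring"
    "HOL-Number_Theory.Residues"
    "HOL-Library.FuncSet"
    "HOL-Library.Product_Plus"
begin

section \<open>Matroids\<close>

record 'e matroid =
  ground :: "'e set"
  indeps :: "'e set set"

definition is_matroid :: "'e matroid \<Rightarrow> bool" where
  "is_matroid M \<longleftrightarrow>
     finite (ground M) \<and>
     indeps M \<subseteq> Pow (ground M) \<and>
     {} \<in> indeps M \<and>
     (\<forall>X\<in>indeps M. \<forall>Y. Y \<subseteq> X \<longrightarrow> Y \<in> indeps M) \<and>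
     (\<forall>X\<in>indeps M. \<forall>Y\<in>indeps M. card X < card Y \<longrightarrow> (\<exists>y\<in>Y - X. insert y X \<in> indeps M))"

definition bases :: "'e matroid \<Rightarrow> 'e set set" where
  "bases M = {B \<in> indeps M. \<forall>X\<in>indeps M. B \<subseteq> X \<longrightarrow> X = B}"

definition dual :: "'e matroid \<Rightarrow> 'e matroid" where
  "dual M = \<lparr>ground = ground M,
             indeps = {X. \<exists>B\<in>bases M. X \<subseteq> ground M - B}\<rparr>"

definition circuits :: "'e matroid \<Rightarrow> 'e set set" where
  "circuits M = {X. X \<subseteq> ground M \<and> X \<notin> indeps M \<and> (\<forall>Y. Y \<subset> X \<longrightarrow> Y \<in> indeps M)}"

definition cocircuits :: "'e matroid \<Rightarrow> 'e set set" where
  "cocircuits M = circuits (dual M)"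

definition direct_sum :: "'d matroid \<Rightarrow> 'e matroid \<Rightarrow> ('d + 'e) matroid" (infixr \<open>\<oplus>\<^sub>M\<close> 65) where
  "M \<oplus>\<^sub>M N = \<lparr>ground = ground M <+> ground N,
              indeps = {X <+> Y |X Y. X \<in> indeps M \<and> Y \<in> indeps N}\<rparr>"

text \<open>
  The matroid represented by a matrix \<open>A\<close> (rows \<open>T\<close>, columns \<open>E\<close>) over a skew field. Chain
  groups below are closed under left multiplication, so the associated chain group is the left
  row space of \<open>A\<close>; accordingly columns are vectors of a right vector space, and the
  coefficients of a linear relation between columns stand on the right.
\<close>
definition matrix_matroid ::
    "('r, 'm) ring_scheme \<Rightarrow> 't set \<Rightarrow> 'e set \<Rightarrow> ('t \<Rightarrow> 'e \<Rightarrow> 'r) \<Rightarrow> 'e matroid" where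
  "matrix_matroid F T E A = \<lparr>ground = E,
     indeps = {X. X \<subseteq> E \<and>
       (\<forall>x. x \<in> X \<rightarrow> carrier F \<longrightarrow>
            (\<forall>t\<in>T. (\<Oplus>\<^bsub>F\<^esub>e\<in>X. A t e \<otimes>\<^bsub>F\<^esub> x e) = \<zero>\<^bsub>F\<^esub>) \<longrightarrow>
            (\<forall>e\<in>X. x e = \<zero>\<^bsub>F\<^esub>))}\<rparr>"


section \<open>Skew partial fields and chain groups\<close>

definition skew_partial_field :: "('r, 'm) ring_scheme \<Rightarrow> 'r set \<Rightarrow> bool" where
  "skew_partial_field R G \<longleftrightarrow>
     ring R \<and> subgroup G (units_of R) \<and> \<ominus>\<^bsub>R\<^esub> \<one>\<^bsub>R\<^esub> \<in> G"

definition skew_field :: "('r, 'm) ring_scheme \<Rightarrow> bool" where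
  "skew_field F \<longleftrightarrow> ring F \<and> Units F = carrier F - {\<zero>\<^bsub>F\<^esub>}"

definition zero_chain :: "('r, 'm) ring_scheme \<Rightarrow> 'e set \<Rightarrow> 'e \<Rightarrow> 'r" where
  "zero_chain R E = (\<lambda>e\<in>E. \<zero>\<^bsub>R\<^esub>)"

definition chain_group :: "('r, 'm) ring_scheme \<Rightarrow> 'e set \<Rightarrow> ('e \<Rightarrow> 'r) set \<Rightarrow> bool" where
  "chain_group R E C \<longleftrightarrow>
     finite E \<and> C \<subseteq> (E \<rightarrow>\<^sub>E carrier R) \<and>
     zero_chain R E \<in> C \<and>
     (\<forall>c\<in>C. \<forall>d\<in>C. (\<lambda>e\<in>E. c e \<oplus>\<^bsub>R\<^esub> d e) \<in> C) \<and>
     (\<forall>r\<in>carrier R. \<forall>c\<in>C. (\<lambda>e\<in>E. r \<otimes>\<^bsub>R\<^esub> c e) \<in> C)"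

definition chain_support :: "('r, 'm) ring_scheme \<Rightarrow> 'e set \<Rightarrow> ('e \<Rightarrow> 'r) \<Rightarrow> 'e set" where
  "chain_support R E c = {e \<in> E. c e \<noteq> \<zero>\<^bsub>R\<^esub>}"

definition elementary ::
    "('r, 'm) ring_scheme \<Rightarrow> 'e set \<Rightarrow> ('e \<Rightarrow> 'r) set \<Rightarrow> ('e \<Rightarrow> 'r) \<Rightarrow> bool" where
  "elementary R E C c \<longleftrightarrow>
     c \<in> C \<and> c \<noteq> zero_chain R E \<and>
     \<not> (\<exists>d\<in>C. d \<noteq> zero_chain R E \<and> chain_support R E d \<subset> chain_support R E c)"

definition primitive ::
    "('r, 'm) ring_scheme \<Rightarrow> 'r set \<Rightarrow> 'e set \<Rightarrow> ('e \<Rightarrow> 'r) \<Rightarrow> bool" where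
  "primitive R G E c \<longleftrightarrow> (\<forall>e\<in>E. c e \<in> G \<union> {\<zero>\<^bsub>R\<^esub>})"

definition partial_field_chain_group ::
    "('r, 'm) ring_scheme \<Rightarrow> 'r set \<Rightarrow> 'e set \<Rightarrow> ('e \<Rightarrow> 'r) set \<Rightarrow> bool" where
  "partial_field_chain_group R G E C \<longleftrightarrow>
     chain_group R E C \<and>
     (\<forall>c. elementary R E C c \<longrightarrow>
        (\<exists>r\<in>carrier R. \<exists>d\<in>C. primitive R G E d \<and> c = (\<lambda>e\<in>E. r \<otimes>\<^bsub>R\<^esub> d e)))"

text \<open>
  The assertion \<open>M = M(C)\<close>; a matroid is determined by its ground set and its cocircuits.
\<close>
definition is_matroid_of_chain_group ::
    "('r, 'm) ring_scheme \<Rightarrow> 'e set \<Rightarrow> ('e \<Rightarrow> 'r) set \<Rightarrow> 'e matroid \<Rightarrow> bool" where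
  "is_matroid_of_chain_group R E C M \<longleftrightarrow>
     is_matroid M \<and> ground M = E \<and>
     cocircuits M = chain_support R E ` {c. elementary R E C c}"

definition representable_over_partial_field ::
    "'e matroid \<Rightarrow> ('r, 'm) ring_scheme \<Rightarrow> 'r set \<Rightarrow> bool" where
  "representable_over_partial_field M R G \<longleftrightarrow>
     (\<exists>C. partial_field_chain_group R G (ground M) C \<and>
          is_matroid_of_chain_group R (ground M) C M)"

definition representable_over_skew_field :: "'e matroid \<Rightarrow> ('r, 'm) ring_scheme \<Rightarrow> bool" where
  "representable_over_skew_field M F \<longleftrightarrow>
     representable_over_partial_field M F (carrier F - {\<zero>\<^bsub>F\<^esub>})"

lemma skew_field_imp_skew_partial_field:
  assumes "skew_field F"
  shows "skew_partial_field F (carrier F - {\<zero>\<^bsub>F\<^esub>})"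
proof -
  interpret ring F using assms by (simp add: skew_field_def)
  have U: "carrier F - {\<zero>\<^bsub>F\<^esub>} = Units F"
    using assms by (simp add: skew_field_def)
  have "subgroup (carrier (units_of F)) (units_of F)"
    by (rule group.subgroup_self[OF units_group])
  then show ?thesis
    unfolding skew_partial_field_def U
    by (simp add: units_of_carrier ring_axioms Units_minus_one_closed)
qed


section \<open>The quaternions and the matroid of the quaternion group\<close>

text \<open>The tuple \<open>(a, b, c, d)\<close> stands for \<open>a + b i + c j + d k\<close>.\<close>
type_synonym quat = "real \<times> real \<times> real \<times> real"

fun quat_mult :: "quat \<Rightarrow> quat \<Rightarrow> quat" where
  "quat_mult (a, b, c, d) (a', b', c', d') =
     (a * a' - b * b' - c * c' - d * d',
      a * b' + b * a' + c * d' - d * c',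
      a * c' - b * d' + c * a' + d * b',
      a * d' + b * c' - c * b' + d * a')"

definition quaternions :: "quat ring" where
  "quaternions = \<lparr>carrier = UNIV, monoid.mult = quat_mult, one = (1, 0, 0, 0),
                  zero = 0, add = (+)\<rparr>"

definition quat_1 :: quat where "quat_1 = (1, 0, 0, 0)"
definition quat_i :: quat where "quat_i = (0, 1, 0, 0)"
definition quat_j :: quat where "quat_j = (0, 0, 1, 0)"
definition quat_k :: quat where "quat_k = (0, 0, 0, 1)"

lemma quat_relations:
  "quat_mult quat_i quat_i = - quat_1"
  "quat_mult quat_j quat_j = - quat_1"
  "quat_mult quat_k quat_k = - quat_1"
  "quat_mult (quat_mult quat_i quat_j) quat_k = - quat_1"
  by (simp_all add: quat_1_def quat_i_def quat_j_def quat_k_def)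

lemma ring_quaternions: "ring quaternions"
proof (rule ringI)
  show "abelian_group quaternions"
  proof (rule abelian_groupI)
    show "\<exists>y\<in>carrier quaternions. y \<oplus>\<^bsub>quaternions\<^esub> x = \<zero>\<^bsub>quaternions\<^esub>" for x
      by (rule bexI[of _ "- x"]) (simp_all add: quaternions_def)
  qed (simp_all add: quaternions_def add_ac)
  show "Group.monoid quaternions"
    by (rule Group.monoidI) (auto simp: quaternions_def algebra_simps)
qed (auto simp: quaternions_def algebra_simps)

lemma skew_field_quaternions: "skew_field quaternions"
proof -
  have inv: "\<exists>y. quat_mult y x = (1, 0, 0, 0) \<and> quat_mult x y = (1, 0, 0, 0)"
    if "x \<noteq> 0" for x :: quat
  proof -
    obtain a b c d where x: "x = (a, b, c, d)" by (cases x)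
    define n where "n = a * a + b * b + c * c + d * d"
    have "n \<noteq> 0"
      using that x unfolding n_def
      by (auto simp: zero_prod_def)
        (smt (verit) mult_eq_0_iff zero_le_square)+
    define s where "s = 1 / n"
    have s: "a * a * s + b * b * s + c * c * s + d * d * s = 1"
      using \<open>n \<noteq> 0\<close> unfolding s_def n_def
      by (simp flip: distrib_right add_divide_distrib)
    show ?thesis unfolding x
      by (intro exI[of _ "(a * s, - b * s, - c * s, - d * s)"])
        (use s in \<open>simp add: algebra_simps\<close>)
  qed
  have zero: "quat_mult y 0 \<noteq> (1, 0, 0, 0)" for y :: quat
    by (cases y) (simp add: zero_prod_def)
  have "Units quaternions = {x. \<exists>y. quat_mult y x = (1, 0, 0, 0) \<and> quat_mult x y = (1, 0, 0, 0)}"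
    by (simp add: Units_def quaternions_def del: split_paired_Ex)
  also have "\<dots> = carrier quaternions - {\<zero>\<^bsub>quaternions\<^esub>}"
    using inv zero by (auto simp: quaternions_def simp del: split_paired_Ex split_paired_All)
  finally have "Units quaternions = carrier quaternions - {\<zero>\<^bsub>quaternions\<^esub>}" .
  then show ?thesis
    by (simp add: skew_field_def ring_quaternions)
qed

definition quaternion_group :: "quat list" where
  "quaternion_group = [quat_1, - quat_1, quat_i, - quat_i, quat_j, - quat_j, quat_k, - quat_k]"

definition quat_g :: "nat \<Rightarrow> quat" where
  "quat_g m = quaternion_group ! (m - 1)"

datatype dowling_elt = Elt_e nat | Elt_a nat | Elt_b nat | Elt_c nat

definition Q3_ground :: "dowling_elt set" where
  "Q3_ground = Elt_e ` {1..3} \<union> Elt_a ` {1..8} \<union> Elt_b ` {1..8} \<union> Elt_c ` {1..8}"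

fun Q3_column :: "dowling_elt \<Rightarrow> quat list" where
  "Q3_column (Elt_e t) = map (\<lambda>s. if s = t then quat_1 else 0) [1, 2, 3]"
| "Q3_column (Elt_a m) = [- quat_1, quat_g m, 0]"
| "Q3_column (Elt_b m) = [0, - quat_1, quat_g m]"
| "Q3_column (Elt_c m) = [quat_g m, 0, - quat_1]"

definition Q3_quaternion :: "dowling_elt matroid" where
  "Q3_quaternion =
     matrix_matroid quaternions {1..3::nat} Q3_ground (\<lambda>t e. Q3_column e ! (t - 1))"


section \<open>The matroid \<open>R\<^sub>9\<close>\<close>

definition R9_rows :: "int list list" where
  "R9_rows = [[1, 0, 0, 1, 1, 1, 0, 0, 1],
              [0, 1, 0, 1, 1, 2, 1, 1, 0],
              [0, 0, 1, 1, 0, 0, 1, 2, 1]]"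

definition R9 :: "nat matroid" where
  "R9 = matrix_matroid (residue_ring 3) {1..3::nat} {1..9} (\<lambda>t e. R9_rows ! (t - 1) ! (e - 1))"

end

theory Submission
  imports Defs "HOL-Algebra.Weak_Morphisms" "HOL-Library.Countable"
begin

text \<open>
  The quaternion algebra over the field with three elements is a finite noncommutative ring of
  characteristic 3 in which any two distinct elements of \<open>{0} \<union> {\<plusminus>1, \<plusminus>i, \<plusminus>j, \<plusminus>k}\<close> differ by a unit.
  Hence the defining matrices of \<open>R\<^sub>9\<close> and of \<open>Q\<^sub>3(G)\<close> can both be read over it, and they keep their
  cocircuits: a line of \<open>Q\<^sub>3(G)\<close> is given by a vector with entries in \<open>G \<union> {0}\<close>, so its
  incidences with the columns only compare elements of \<open>G \<union> {0}\<close>. Conversely, a representation of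
  \<open>R\<^sub>9\<close> over a skew field forces \<open>3 = 0\<close>, and a representation of \<open>Q\<^sub>3(G)\<close> yields a homomorphism
  \<open>G \<rightarrow> F - {0}\<close> that does not kill \<open>-1\<close>. In characteristic 3 the elements \<open>1 \<plusminus> (i + j)\<close> are then
  zero divisors.
\<close>

section \<open>Cocircuits\<close>

text \<open>The common ring cannot be a skew field, so linear algebra is available only over GF(3)
  and over the quaternions, where the two matroids are defined. Over the finite algebra, a ring of 2
  by 2 matrices over GF(3), a nonzero chain may have no unit entry and cannot be normalised. Two
  facts replace linear algebra there: the support of every nonzero chain contains a cocircuit, and
  every cocircuit is the support of a chain whose entries are 0 or units. The second comes from the
  original vectors. For the first, an additive map collapses a chain of \<open>R\<^sub>9\<close> to
  a row over GF(3), and a chain of \<open>Q\<^sub>3(G)\<close> is replaced by its ratios in G. In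
  the opposite direction only the supports of elementary chains are given, so coordinates have to be
  rebuilt: chains may be scaled from the left, one element or one line fixes that freedom, and the
  rest is read off from which columns lie on which lines. As multiplication does not commute, left
  factors of chains and right factors of columns are kept apart throughout.\<close>

no_notation set_add (infixl \<open><+>\<index>\<close> 60)

text \<open>A set is independent in the dual exactly when it misses some basis, so circuits of the
  dual are the minimal sets meeting all bases. The later arguments mostly use cocircuits in this
  form.\<close>

lemma cocircuits_iff:
  assumes "bases M \<subseteq> Pow (ground M)"
  shows "D \<in> cocircuits M \<longleftrightarrow>
    D \<subseteq> ground M \<and> (\<forall>B\<in>bases M. D \<inter> B \<noteq> {}) \<and> (\<forall>D'. D' \<subset> D \<longrightarrow> (\<exists>B\<in>bases M. D' \<inter> B = {}))"
proof -
  have *: "X \<in> indeps (dual M) \<longleftrightarrow> X \<subseteq> ground M \<and> (\<exists>B\<in>bases M. X \<inter> B = {})" for X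
    using assms unfolding dual_def by auto
  have "ground (dual M) = ground M" by (simp add: dual_def)
  moreover have "Y \<subseteq> ground M" if "D \<subseteq> ground M" "Y \<subset> D" for Y using that by blast
  ultimately show ?thesis
    unfolding cocircuits_def circuits_def mem_Collect_eq * by (cases "D \<subseteq> ground M") simp_all
qed

lemma bases_subset_ground: "is_matroid M \<Longrightarrow> bases M \<subseteq> Pow (ground M)"
  unfolding is_matroid_def bases_def by blast

lemma cocircuit_subset_ground: "D \<in> cocircuits M \<Longrightarrow> D \<subseteq> ground M"
  unfolding cocircuits_def circuits_def dual_def by simp

lemma cocircuit_psubset: "D \<in> cocircuits M \<Longrightarrow> D' \<in> cocircuits M \<Longrightarrow> D' \<subseteq> D \<Longrightarrow> D' = D"
  unfolding cocircuits_def circuits_def by blast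

lemma indep_finite: "is_matroid M \<Longrightarrow> X \<in> indeps M \<Longrightarrow> finite X"
  unfolding is_matroid_def by (metis PowD finite_subset subsetD)

lemma indep_subset: "is_matroid M \<Longrightarrow> X \<in> indeps M \<Longrightarrow> Y \<subseteq> X \<Longrightarrow> Y \<in> indeps M"
  by (simp add: is_matroid_def)

lemma indep_augment:
  "is_matroid M \<Longrightarrow> X \<in> indeps M \<Longrightarrow> Y \<in> indeps M \<Longrightarrow> card X < card Y \<Longrightarrow>
    \<exists>y\<in>Y - X. insert y X \<in> indeps M"
  by (simp add: is_matroid_def)

lemma indep_extends_to_basis:
  assumes "is_matroid M" and "I \<in> indeps M"
  obtains B where "B \<in> bases M" and "I \<subseteq> B"
proof -
  have "indeps M \<subseteq> Pow (ground M)" "finite (ground M)"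
    using assms(1) by (simp_all add: is_matroid_def)
  then have "finite (indeps M)" by (meson finite_Pow_iff finite_subset)
  from finite_has_maximal2[OF this assms(2)]
  obtain B where "B \<in> indeps M" "I \<subseteq> B" "\<forall>X\<in>indeps M. B \<subseteq> X \<longrightarrow> B = X"
    by blast
  then have "B \<in> bases M" by (auto simp: bases_def)
  then show ?thesis using \<open>I \<subseteq> B\<close> by (rule that)
qed

lemma ex_basis:
  assumes "is_matroid M"
  shows "bases M \<noteq> {}"
proof -
  have "{} \<in> indeps M" using assms by (simp add: is_matroid_def)
  then show ?thesis using indep_extends_to_basis[OF assms] by (metis empty_iff)
qed

lemma transversal_contains_cocircuit:
  assumes M: "is_matroid M" and X: "X \<subseteq> ground M" "\<And>B. B \<in> bases M \<Longrightarrow> X \<inter> B \<noteq> {}"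
  obtains D where "D \<in> cocircuits M" and "D \<subseteq> X"
proof -
  let ?S = "{Y. Y \<subseteq> X \<and> (\<forall>B\<in>bases M. Y \<inter> B \<noteq> {})}"
  have "finite (ground M)" using M by (simp add: is_matroid_def)
  then have "finite X" using X(1) by (rule rev_finite_subset)
  then have "finite ?S" by simp
  moreover have "X \<in> ?S" using X by simp
  ultimately obtain D where D: "D \<in> ?S" and min: "\<forall>Y\<in>?S. Y \<subseteq> D \<longrightarrow> D = Y"
    using finite_has_minimal2 by (metis (no_types, lifting))
  have "\<exists>B\<in>bases M. D' \<inter> B = {}" if D': "D' \<subset> D" for D'
  proof (rule ccontr)
    assume "\<not> (\<exists>B\<in>bases M. D' \<inter> B = {})"
    then have "D' \<in> ?S" using D D' by auto
    then show False using min D' by auto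
  qed
  moreover have "D \<subseteq> ground M" "\<forall>B\<in>bases M. D \<inter> B \<noteq> {}" using D X(1) by auto
  ultimately have "D \<in> cocircuits M"
    unfolding cocircuits_iff[OF bases_subset_ground[OF M]] by simp
  then show ?thesis using that D by simp
qed

text \<open>A squeeze: each member of the family contains a cocircuit because it meets all bases,
  and each cocircuit contains a member. Hence both families have the same minimal members, and the
  cocircuits already form an antichain. It serves for direct sums and for matrix matroids.\<close>

lemma cocircuits_eq_minimal:
  assumes M: "is_matroid M"
    and transversal: "\<And>S B. S \<in> \<S> \<Longrightarrow> B \<in> bases M \<Longrightarrow> S \<inter> B \<noteq> {}"
    and ground: "\<And>S. S \<in> \<S> \<Longrightarrow> S \<subseteq> ground M"
    and contains: "\<And>D. D \<in> cocircuits M \<Longrightarrow> \<exists>S\<in>\<S>. S \<subseteq> D"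
  shows "cocircuits M = {S \<in> \<S>. \<forall>S'\<in>\<S>. S' \<subseteq> S \<longrightarrow> S' = S}"
proof -
  have sub: "\<exists>D\<in>cocircuits M. D \<subseteq> S" if "S \<in> \<S>" for S
    by (rule transversal_contains_cocircuit[OF M ground[OF that] transversal[OF that]]) auto
  show ?thesis
  proof (rule Set.set_eqI, rule iffI)
    fix D assume D: "D \<in> cocircuits M"
    have *: "S' = D" if S': "S' \<in> \<S>" "S' \<subseteq> D" for S'
    proof -
      obtain D' where "D' \<in> cocircuits M" "D' \<subseteq> S'" using sub[OF S'(1)] by blast
      moreover from this have "D' = D" using cocircuit_psubset[OF D] S'(2) by simp
      ultimately show ?thesis using S'(2) by simp
    qed
    obtain S where S: "S \<in> \<S>" "S \<subseteq> D" using contains[OF D] by blast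
    then have "S = D" by (rule *)
    then have "D \<in> \<S>" using S(1) by (simp only:)
    then show "D \<in> {S \<in> \<S>. \<forall>S'\<in>\<S>. S' \<subseteq> S \<longrightarrow> S' = S}"
      using * by auto
  next
    fix S assume S: "S \<in> {S \<in> \<S>. \<forall>S'\<in>\<S>. S' \<subseteq> S \<longrightarrow> S' = S}"
    then obtain D where D: "D \<in> cocircuits M" "D \<subseteq> S" using sub by blast
    obtain S' where S': "S' \<in> \<S>" "S' \<subseteq> D" using contains[OF D(1)] by blast
    then have "S' = S" using S D(2) by simp
    then have "D = S" using S' D by simp
    then show "S \<in> cocircuits M" using D by simp
  qed
qed

subsection \<open>Direct sums\<close>

lemma Plus_subset_iff: "X <+> Y \<subseteq> X' <+> Y' \<longleftrightarrow> X \<subseteq> X' \<and> Y \<subseteq> Y'"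
  by (auto simp: subset_iff)

lemma Plus_eq_iff: "X <+> Y = X' <+> Y' \<longleftrightarrow> X = X' \<and> Y = Y'"
  by (simp only: set_eq_subset Plus_subset_iff) argo

lemma set_sum_eq_Plus: "X = (Inl -` X) <+> (Inr -` X)"
proof (rule Set.set_eqI)
  show "x \<in> X \<longleftrightarrow> x \<in> (Inl -` X) <+> (Inr -` X)" for x by (cases x) auto
qed

lemma indeps_direct_sum: "X <+> Y \<in> indeps (M \<oplus>\<^sub>M N) \<longleftrightarrow> X \<in> indeps M \<and> Y \<in> indeps N"
  by (auto simp: direct_sum_def Plus_eq_iff)

lemma is_matroid_direct_sum:
  assumes M: "is_matroid M" and N: "is_matroid N"
  shows "is_matroid (M \<oplus>\<^sub>M N)"
proof -
  have fin: "finite X" if "X \<in> indeps M" for X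
    using indep_finite[OF M that] .
  have fin': "finite X" if "X \<in> indeps N" for X
    using indep_finite[OF N that] .
  have aug: "\<exists>y\<in>Y - X. insert y X \<in> indeps (M \<oplus>\<^sub>M N)"
    if X: "X \<in> indeps (M \<oplus>\<^sub>M N)" and Y: "Y \<in> indeps (M \<oplus>\<^sub>M N)" and less: "card X < card Y" for X Y
  proof -
    obtain X1 X2 where X: "X = X1 <+> X2" "X1 \<in> indeps M" "X2 \<in> indeps N"
      using X by (auto simp: direct_sum_def)
    obtain Y1 Y2 where Y: "Y = Y1 <+> Y2" "Y1 \<in> indeps M" "Y2 \<in> indeps N"
      using Y by (auto simp: direct_sum_def)
    have "card X1 + card X2 < card Y1 + card Y2"
      using less X Y fin fin' by (simp add: card_Plus)
    then consider "card X1 < card Y1" | "card X2 < card Y2" by linarith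
    then show ?thesis
    proof cases
      case 1
      then obtain y where "y \<in> Y1 - X1" "insert y X1 \<in> indeps M"
        using indep_augment[OF M X(2) Y(2)] by blast
      moreover have "insert (Inl y) X = insert y X1 <+> X2" using X by auto
      ultimately show ?thesis
        using X Y by (intro bexI[of _ "Inl y"]) (auto simp: indeps_direct_sum)
    next
      case 2
      then obtain y where "y \<in> Y2 - X2" "insert y X2 \<in> indeps N"
        using indep_augment[OF N X(3) Y(3)] by blast
      moreover have "insert (Inr y) X = X1 <+> insert y X2" using X by auto
      ultimately show ?thesis
        using X Y by (intro bexI[of _ "Inr y"]) (auto simp: indeps_direct_sum)
    qed
  qed
  have down: "Y \<in> indeps (M \<oplus>\<^sub>M N)" if X: "X \<in> indeps (M \<oplus>\<^sub>M N)" and "Y \<subseteq> X" for X Y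
  proof -
    obtain X1 X2 where X: "X = X1 <+> X2" "X1 \<in> indeps M" "X2 \<in> indeps N"
      using X by (auto simp: direct_sum_def)
    have "Inl -` Y \<subseteq> X1" "Inr -` Y \<subseteq> X2"
      using \<open>Y \<subseteq> X\<close> set_sum_eq_Plus[of Y] X(1) Plus_subset_iff by metis+
    then have "Inl -` Y \<in> indeps M" "Inr -` Y \<in> indeps N"
      using indep_subset[OF M] indep_subset[OF N] X by blast+
    then show ?thesis by (subst set_sum_eq_Plus) (simp add: indeps_direct_sum)
  qed
  have "finite (ground (M \<oplus>\<^sub>M N))"
    using M N unfolding is_matroid_def by (simp add: direct_sum_def)
  moreover have "indeps (M \<oplus>\<^sub>M N) \<subseteq> Pow (ground (M \<oplus>\<^sub>M N))"
    using M N by (auto simp: is_matroid_def direct_sum_def)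
  moreover have "{} <+> {} \<in> indeps (M \<oplus>\<^sub>M N)"
    using M N by (simp add: indeps_direct_sum is_matroid_def)
  ultimately show ?thesis
    using aug down unfolding is_matroid_def by auto
qed

lemma bases_direct_sum:
  "bases (M \<oplus>\<^sub>M N) = {X <+> Y | X Y. X \<in> bases M \<and> Y \<in> bases N}"
proof (rule Set.set_eqI)
  fix Z :: "('a + 'b) set"
  obtain X Y where Z: "Z = X <+> Y" using set_sum_eq_Plus by blast
  have "(\<forall>W\<in>indeps (M \<oplus>\<^sub>M N). X <+> Y \<subseteq> W \<longrightarrow> W = X <+> Y) \<longleftrightarrow>
    (\<forall>V\<in>indeps M. \<forall>W\<in>indeps N. X \<subseteq> V \<and> Y \<subseteq> W \<longrightarrow> V = X \<and> W = Y)"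
    by (auto simp: direct_sum_def Plus_subset_iff Plus_eq_iff)
  then have "X <+> Y \<in> bases (M \<oplus>\<^sub>M N) \<longleftrightarrow> X \<in> bases M \<and> Y \<in> bases N"
    unfolding bases_def using indeps_direct_sum[of X Y M N] by blast
  then show "Z \<in> bases (M \<oplus>\<^sub>M N) \<longleftrightarrow> Z \<in> {X <+> Y | X Y. X \<in> bases M \<and> Y \<in> bases N}"
    by (simp add: Z Plus_eq_iff)
qed

text \<open>If each half of a set misses a basis of its summand, the set misses the union of the
  two. So a set meeting all bases of the sum has a half that meets all bases of its summand.\<close>

lemma cocircuits_direct_sum:
  assumes M: "is_matroid M" and N: "is_matroid N"
  shows "cocircuits (M \<oplus>\<^sub>M N) = (`) Inl ` cocircuits M \<union> (`) Inr ` cocircuits N"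
proof -
  let ?S = "(`) Inl ` cocircuits M \<union> (`) Inr ` cocircuits N"
  note MN = is_matroid_direct_sum[OF M N]
  have tM: "D \<inter> B \<noteq> {}" if "D \<in> cocircuits M" "B \<in> bases M" for D B
    using that cocircuits_iff[OF bases_subset_ground[OF M]] by blast
  have tN: "D \<inter> B \<noteq> {}" if "D \<in> cocircuits N" "B \<in> bases N" for D B
    using that cocircuits_iff[OF bases_subset_ground[OF N]] by blast
  have min: "S' = S" if "S \<in> ?S" "S' \<in> ?S" "S' \<subseteq> S" for S S'
  proof -
    \<comment> \<open>An image under \<open>Inl\<close> lies inside an image under
      \<open>Inr\<close> only if it is empty, so nonemptiness settles the mixed comparisons.\<close>
    have "D \<noteq> {}" if "D \<in> cocircuits M" for D using ex_basis[OF M] tM[OF that] by blast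
    moreover have "D \<noteq> {}" if "D \<in> cocircuits N" for D using ex_basis[OF N] tN[OF that] by blast
    ultimately show ?thesis
      using that cocircuit_psubset[of _ M] cocircuit_psubset[of _ N]
      by (auto simp: inj_image_subset_iff) blast+
  qed
  have "cocircuits (M \<oplus>\<^sub>M N) = {S \<in> ?S. \<forall>S'\<in>?S. S' \<subseteq> S \<longrightarrow> S' = S}"
  proof (rule cocircuits_eq_minimal[OF MN])
    fix S B assume S: "S \<in> ?S" and "B \<in> bases (M \<oplus>\<^sub>M N)"
    then obtain X Y where B: "B = X <+> Y" "X \<in> bases M" "Y \<in> bases N"
      unfolding bases_direct_sum by blast
    from S consider D where "D \<in> cocircuits M" "S = Inl ` D" | D where "D \<in> cocircuits N" "S = Inr ` D"
      by blast
    then show "S \<inter> B \<noteq> {}"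
      using tM[OF _ B(2)] tN[OF _ B(3)] B(1) by cases (auto simp: disjoint_iff)
  next
    show "S \<subseteq> ground (M \<oplus>\<^sub>M N)" if "S \<in> ?S" for S
      using that cocircuit_subset_ground[of _ M] cocircuit_subset_ground[of _ N]
      by (auto simp: direct_sum_def)
  next
    fix D assume D: "D \<in> cocircuits (M \<oplus>\<^sub>M N)"
    have sub: "Inl -` D \<subseteq> ground M" "Inr -` D \<subseteq> ground N"
      using cocircuit_subset_ground[OF D] by (auto simp: direct_sum_def)
    have meets: "D \<inter> (B <+> B') \<noteq> {}" if "B \<in> bases M" "B' \<in> bases N" for B B'
      using D that cocircuits_iff[OF bases_subset_ground[OF MN]] unfolding bases_direct_sum by blast
    show "\<exists>S\<in>?S. S \<subseteq> D"
    proof (cases "\<forall>B\<in>bases M. Inl -` D \<inter> B \<noteq> {}")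
      case True
      then obtain D' where "D' \<in> cocircuits M" "D' \<subseteq> Inl -` D"
        using transversal_contains_cocircuit[OF M sub(1)] by blast
      then show ?thesis by (intro bexI[of _ "Inl ` D'"]) auto
    next
      case False
      then obtain B where B: "B \<in> bases M" "Inl -` D \<inter> B = {}" by blast
      have "Inr -` D \<inter> B' \<noteq> {}" if B': "B' \<in> bases N" for B'
      proof -
        obtain z where "z \<in> D" "z \<in> B <+> B'" using meets[OF B(1) B'] by blast
        then show ?thesis using B(2) by (cases z) auto
      qed
      then obtain D' where "D' \<in> cocircuits N" "D' \<subseteq> Inr -` D"
        using transversal_contains_cocircuit[OF N sub(2)] by blast
      then show ?thesis by (intro bexI[of _ "Inr ` D'"]) auto
    qed
  qed
  also have "\<dots> = ?S"
    by (rule Set.Collect_mem_eq[THEN trans[rotated]], rule Collect_cong, metis min)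
  finally show ?thesis .
qed

section \<open>Matroids of matrices over a skew field\<close>

locale skew_field_ring = ring F for F :: "('r, 'm) ring_scheme" (structure) +
  assumes Units_eq: "Units F = carrier F - {\<zero>}"
begin

lemma one_neq_zero: "\<one> \<noteq> \<zero>"
  using Units_eq Units_one_closed by blast

lemma nonzero_inv:
  assumes "a \<in> carrier F" "a \<noteq> \<zero>"
  shows "inv a \<in> carrier F" "a \<otimes> inv a = \<one>" "inv a \<otimes> a = \<one>"
  using assms Units_eq by auto

lemma mult_eq_zero_iff:
  assumes "a \<in> carrier F" "b \<in> carrier F"
  shows "a \<otimes> b = \<zero> \<longleftrightarrow> a = \<zero> \<or> b = \<zero>"
proof
  assume ab: "a \<otimes> b = \<zero>"
  show "a = \<zero> \<or> b = \<zero>"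
  proof (cases "a = \<zero>")
    case False
    note i = nonzero_inv[OF assms(1) this]
    have "b = inv a \<otimes> (a \<otimes> b)" using i assms by (simp flip: m_assoc)
    then show ?thesis using ab i by simp
  qed simp
qed (use assms in auto)

lemma finsum_swap:
  assumes "finite S" "finite X" and f: "\<And>s x. s \<in> S \<Longrightarrow> x \<in> X \<Longrightarrow> f s x \<in> carrier F"
  shows "(\<Oplus>s\<in>S. \<Oplus>x\<in>X. f s x) = (\<Oplus>x\<in>X. \<Oplus>s\<in>S. f s x)"
  using assms(1) f
proof (induction S)
  case empty
  then show ?case by simp
next
  case (insert s S)
  have "(\<Oplus>x\<in>X. \<Oplus>s\<in>insert s S. f s x) = (\<Oplus>x\<in>X. f s x \<oplus> (\<Oplus>s\<in>S. f s x))"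
    using insert by (intro finsum_cong') auto
  also have "\<dots> = (\<Oplus>x\<in>X. f s x) \<oplus> (\<Oplus>x\<in>X. \<Oplus>s\<in>S. f s x)"
    using insert by (intro finsum_addf) auto
  also have "\<dots> = (\<Oplus>s\<in>insert s S. \<Oplus>x\<in>X. f s x)"
    using insert by (subst finsum_insert) auto
  finally show ?case by simp
qed

lemma homogeneous_system_solution:
  assumes "finite S" "finite X" "card S < card X" "a \<in> S \<rightarrow> X \<rightarrow> carrier F"
  shows "\<exists>x\<in>X \<rightarrow> carrier F. (\<exists>e\<in>X. x e \<noteq> \<zero>) \<and> (\<forall>s\<in>S. (\<Oplus>e\<in>X. a s e \<otimes> x e) = \<zero>)"
  using assms
proof (induction S arbitrary: X a)
  case empty
  then have "X \<noteq> {}" by auto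
  then show ?case using one_neq_zero by (intro bexI[of _ "\<lambda>_. \<one>"]) auto
next
  case (insert s S)
  note a = funcset_mem[OF funcset_mem[OF insert.prems(3)]]
  show ?case
  proof (cases "\<forall>e\<in>X. a s e = \<zero>")
    case True
    obtain x where x: "x \<in> X \<rightarrow> carrier F" "\<exists>e\<in>X. x e \<noteq> \<zero>"
      "\<forall>s\<in>S. (\<Oplus>e\<in>X. a s e \<otimes> x e) = \<zero>"
      using insert.IH[of X a] insert.prems insert.hyps by auto
    have "(\<Oplus>e\<in>X. a s e \<otimes> x e) = (\<Oplus>e\<in>X. \<zero>)"
      using True x(1) by (intro finsum_cong') (auto intro!: l_null funcset_mem[OF x(1)])
    then show ?thesis using x by (intro bexI[of _ x]) auto
  next
    case False
    then obtain e0 where e0: "e0 \<in> X" "a s e0 \<noteq> \<zero>" by blast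
    note p = nonzero_inv[OF a[OF insertI1 e0(1)] e0(2)]
    define X' where "X' = X - {e0}"
    have X: "X = insert e0 X'" "e0 \<notin> X'" "finite X'" using e0 insert.prems by (auto simp: X'_def)
    define b where "b = (\<lambda>e. inv (a s e0) \<otimes> a s e)"
    have b: "b e \<in> carrier F" if "e \<in> X" for e using p a[OF insertI1 that] by (simp add: b_def)
    \<comment> \<open>The remaining equations after the pivot equation has been solved for the
      unknown at \<open>e0\<close>, which is minus the sum of all
      \<open>b e \<otimes> x e\<close>.\<close>
    define a' where "a' = (\<lambda>t e. a t e \<ominus> a t e0 \<otimes> b e)"
    have a': "a' \<in> S \<rightarrow> X' \<rightarrow> carrier F" using a b e0 X by (auto simp: a'_def)
    have "card S < card X'" using insert.prems insert.hyps X by simp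
    then obtain x where x: "x \<in> X' \<rightarrow> carrier F" "\<exists>e\<in>X'. x e \<noteq> \<zero>"
      "\<forall>s\<in>S. (\<Oplus>e\<in>X'. a' s e \<otimes> x e) = \<zero>"
      using insert.IH[of X' a'] X a' by auto
    have xc: "x e \<in> carrier F" if "e \<in> X'" for e using x that by auto
    define y where "y = (\<Oplus>e\<in>X'. b e \<otimes> x e)"
    have y: "y \<in> carrier F" using b xc X unfolding y_def by (auto intro!: finsum_closed)
    define z where "z = x(e0 := \<ominus> y)"
    have zX: "z e = x e" if "e \<in> X'" for e using that X by (auto simp: z_def)
    have split: "(\<Oplus>e\<in>X. a t e \<otimes> z e) = \<ominus> (a t e0 \<otimes> y) \<oplus> (\<Oplus>e\<in>X'. a t e \<otimes> x e)"
      if t: "t \<in> insert s S" for t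
    proof -
      have "(\<Oplus>e\<in>X. a t e \<otimes> z e) = a t e0 \<otimes> z e0 \<oplus> (\<Oplus>e\<in>X'. a t e \<otimes> z e)"
        unfolding X(1) using X(2,3) a[OF t] X(1) xc zX y
        by (subst finsum_insert) (auto simp: z_def)
      also have "(\<Oplus>e\<in>X'. a t e \<otimes> z e) = (\<Oplus>e\<in>X'. a t e \<otimes> x e)"
        using a[OF t] X xc zX by (intro finsum_cong') auto
      finally show ?thesis using a[OF t e0(1)] y by (simp add: z_def r_minus)
    qed
    have scaled: "(\<Oplus>e\<in>X'. c \<otimes> b e \<otimes> x e) = c \<otimes> y" if c: "c \<in> carrier F" for c
    proof -
      have "(\<Oplus>e\<in>X'. c \<otimes> b e \<otimes> x e) = (\<Oplus>e\<in>X'. c \<otimes> (b e \<otimes> x e))"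
        using b xc X c by (intro finsum_cong') (auto simp: m_assoc)
      also have "\<dots> = c \<otimes> y"
        unfolding y_def using b xc X c by (subst finsum_rdistr) auto
      finally show ?thesis .
    qed
    have s: "(\<Oplus>e\<in>X. a s e \<otimes> z e) = \<zero>"
    proof -
      have "(\<Oplus>e\<in>X'. a s e \<otimes> x e) = (\<Oplus>e\<in>X'. a s e0 \<otimes> b e \<otimes> x e)"
        using a[OF insertI1] e0 p xc X by (intro finsum_cong') (auto simp: b_def simp flip: m_assoc)
      also have "\<dots> = a s e0 \<otimes> y" using scaled a[OF insertI1 e0(1)] .
      finally show ?thesis using split[of s] a[OF insertI1 e0(1)] y by (simp add: l_neg)
    qed
    have S: "(\<Oplus>e\<in>X. a t e \<otimes> z e) = \<zero>" if t: "t \<in> S" for t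
    proof -
      have at: "a t e \<in> carrier F" if "e \<in> X" for e using a t that by auto
      have "(\<Oplus>e\<in>X'. a t e \<otimes> x e) = (\<Oplus>e\<in>X'. a' t e \<otimes> x e \<oplus> a t e0 \<otimes> b e \<otimes> x e)"
        using at b xc X by (intro finsum_cong')
          (auto simp: a'_def minus_eq l_distr l_minus a_assoc l_neg)
      also have "\<dots> = (\<Oplus>e\<in>X'. a' t e \<otimes> x e) \<oplus> (\<Oplus>e\<in>X'. a t e0 \<otimes> b e \<otimes> x e)"
        using at b xc X funcset_mem[OF funcset_mem[OF a' t]] by (intro finsum_addf) auto
      also have "\<dots> = a t e0 \<otimes> y" using x(3) t scaled[OF at[OF e0(1)]] at[OF e0(1)] y by simp
      finally show ?thesis using split[of t] t at[OF e0(1)] y by (simp add: l_neg)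
    qed
    have "z \<in> X \<rightarrow> carrier F" using X xc zX y by (auto simp: z_def)
    moreover have "\<exists>e\<in>X. z e \<noteq> \<zero>" using x(2) zX X(1) by auto
    ultimately show ?thesis using s S by blast
  qed
qed

end

lemma skew_field_ringI: "skew_field F \<Longrightarrow> skew_field_ring F"
  by (simp add: skew_field_def skew_field_ring_def skew_field_ring_axioms_def)

text \<open>Left solutions over \<open>F\<close> are right solutions over the opposite ring, so the
  elimination above yields both versions. Sums do not see the multiplication, hence the simp rule
  for \<open>finsum\<close>.\<close>

definition opposite_ring :: "('r, 'm) ring_scheme \<Rightarrow> ('r, 'm) ring_scheme" where
  "opposite_ring F = F\<lparr>monoid.mult := \<lambda>x y. y \<otimes>\<^bsub>F\<^esub> x\<rparr>"

lemma opposite_ring_simps [simp]: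
  "carrier (opposite_ring F) = carrier F"
  "\<zero>\<^bsub>opposite_ring F\<^esub> = \<zero>\<^bsub>F\<^esub>" "\<one>\<^bsub>opposite_ring F\<^esub> = \<one>\<^bsub>F\<^esub>"
  "x \<oplus>\<^bsub>opposite_ring F\<^esub> y = x \<oplus>\<^bsub>F\<^esub> y" "x \<otimes>\<^bsub>opposite_ring F\<^esub> y = y \<otimes>\<^bsub>F\<^esub> x"
  "finsum (opposite_ring F) = finsum F"
  by (simp_all add: opposite_ring_def finsum_def)

context skew_field_ring
begin

lemma opposite_skew_field: "skew_field_ring (opposite_ring F)"
proof -
  have "ring (opposite_ring F)"
  proof (rule ringI)
    show "abelian_group (opposite_ring F)"
      by (rule abelian_groupI) (auto simp: a_ac intro: bexI[of _ "\<ominus> _"] l_neg)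
    show "Group.monoid (opposite_ring F)"
      by (rule Group.monoidI) (auto simp: m_assoc)
  qed (auto simp: l_distr r_distr)
  moreover have "Units (opposite_ring F) = Units F"
    by (auto simp: Units_def)
  ultimately show ?thesis
    using Units_eq by (simp add: skew_field_ring_def skew_field_ring_axioms_def)
qed

lemma homogeneous_system_left_solution:
  assumes "finite S" "finite X" "card S < card X" "a \<in> S \<rightarrow> X \<rightarrow> carrier F"
  shows "\<exists>x\<in>X \<rightarrow> carrier F. (\<exists>e\<in>X. x e \<noteq> \<zero>) \<and> (\<forall>s\<in>S. (\<Oplus>e\<in>X. x e \<otimes> a s e) = \<zero>)"
  using skew_field_ring.homogeneous_system_solution[OF opposite_skew_field assms(1-3), of a] assms(4)
  by simp

end

section \<open>Rows, independent columns and cocircuits of a matrix\<close>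

locale skew_field_matrix = skew_field_ring F for F :: "('r, 'm) ring_scheme" (structure) +
  fixes T :: "'t set" and E :: "'e set" and A :: "'t \<Rightarrow> 'e \<Rightarrow> 'r"
  assumes finite_T: "finite T" and finite_E: "finite E"
    and A_closed: "\<And>t e. t \<in> T \<Longrightarrow> e \<in> E \<Longrightarrow> A t e \<in> carrier F"
begin

abbreviation M where "M \<equiv> matrix_matroid F T E A"

text \<open>Multipliers of rows act from the left, while relations between columns act from the
  right; associativity is what lets the two interact.\<close>

definition row :: "('t \<Rightarrow> 'r) \<Rightarrow> 'e \<Rightarrow> 'r" where
  "row y e = (\<Oplus>t\<in>T. y t \<otimes> A t e)"

lemma indep_iff:
  "X \<in> indeps M \<longleftrightarrow> X \<subseteq> E \<and> (\<forall>x\<in>X \<rightarrow> carrier F.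
     (\<forall>t\<in>T. (\<Oplus>e\<in>X. A t e \<otimes> x e) = \<zero>) \<longrightarrow> (\<forall>e\<in>X. x e = \<zero>))"
  by (auto simp: matrix_matroid_def)

lemma indep_subset_E: "X \<in> indeps M \<Longrightarrow> X \<subseteq> E"
  by (simp add: indep_iff)

lemma finite_indep: "X \<in> indeps M \<Longrightarrow> finite X"
  using indep_subset_E finite_E finite_subset by blast

lemma indep_zero:
  assumes "X \<in> indeps M" "x \<in> X \<rightarrow> carrier F" "\<And>t. t \<in> T \<Longrightarrow> (\<Oplus>e\<in>X. A t e \<otimes> x e) = \<zero>" "e \<in> X"
  shows "x e = \<zero>"
  using assms by (simp add: indep_iff)

lemma card_indep_le:
  assumes X: "X \<in> indeps M"
  shows "card X \<le> card T"
proof (rule ccontr)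
  assume "\<not> card X \<le> card T"
  moreover have "A \<in> T \<rightarrow> X \<rightarrow> carrier F" using A_closed indep_subset_E[OF X] by auto
  ultimately obtain x where "x \<in> X \<rightarrow> carrier F" "\<exists>e\<in>X. x e \<noteq> \<zero>" "\<forall>t\<in>T. (\<Oplus>e\<in>X. A t e \<otimes> x e) = \<zero>"
    using homogeneous_system_solution[OF finite_T finite_indep[OF X], of A] by auto
  then show False using indep_zero[OF X] by blast
qed

text \<open>A nontrivial relation on \<open>insert e X\<close> must involve \<open>e\<close>, since
  \<open>X\<close> is independent, and can be divided from the right by the coefficient of
  \<open>e\<close>. The alternative \<open>e \<in> X\<close> lets every element spanned by
  \<open>X\<close> be treated alike.\<close>

lemma dependent_column:
  assumes X: "X \<in> indeps M" and e: "e \<in> E" "insert e X \<notin> indeps M \<or> e \<in> X"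
  obtains l where "l \<in> X \<rightarrow> carrier F" "\<And>t. t \<in> T \<Longrightarrow> A t e = (\<Oplus>x\<in>X. A t x \<otimes> l x)"
proof (cases "e \<in> X")
  case True
  let ?l = "\<lambda>x. if e = x then \<one> else \<zero>"
  have "(\<Oplus>x\<in>X. A t x \<otimes> ?l x) = A t e" if t: "t \<in> T" for t
  proof -
    have "(\<Oplus>x\<in>X. A t x \<otimes> ?l x) = (\<Oplus>x\<in>X. if e = x then A t x else \<zero>)"
      using A_closed[OF t] indep_subset_E[OF X] by (intro finsum_cong') auto
    also have "\<dots> = A t e"
      using A_closed[OF t] indep_subset_E[OF X] by (intro finsum_singleton[OF True finite_indep[OF X]]) auto
    finally show ?thesis .
  qed
  then show ?thesis by (intro that[of ?l]) auto
next
  case False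
  have At: "A t x \<in> carrier F" if "t \<in> T" "x \<in> insert e X" for t x
    using that A_closed e(1) indep_subset_E[OF X] by auto
  obtain z where z: "z \<in> insert e X \<rightarrow> carrier F" "\<exists>x\<in>insert e X. z x \<noteq> \<zero>"
    and rel: "\<And>t. t \<in> T \<Longrightarrow> (\<Oplus>x\<in>insert e X. A t x \<otimes> z x) = \<zero>"
    using e False indep_subset_E[OF X] unfolding indep_iff[of "insert e X"] by auto
  have zc: "z x \<in> carrier F" if "x \<in> insert e X" for x using z(1) that by auto
  have rel': "A t e \<otimes> z e \<oplus> (\<Oplus>x\<in>X. A t x \<otimes> z x) = \<zero>" if t: "t \<in> T" for t
    using rel[OF t] finite_indep[OF X] False At[OF t] zc
    by (subst (asm) finsum_insert) auto
  have ze: "z e \<noteq> \<zero>"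
  proof
    assume 0: "z e = \<zero>"
    have rel0: "(\<Oplus>x\<in>X. A t x \<otimes> z x) = \<zero>" if t: "t \<in> T" for t
    proof -
      have "(\<Oplus>x\<in>X. A t x \<otimes> z x) \<in> carrier F" using At[OF t] zc by (auto intro!: finsum_closed)
      then show ?thesis using rel'[OF t] 0 At[OF t] by simp
    qed
    have "z x = \<zero>" if "x \<in> X" for x
      by (rule indep_zero[OF X _ rel0 that]) (use zc in auto)
    then show False using 0 z(2) by auto
  qed
  note i = nonzero_inv[OF zc[OF insertI1] ze]
  define l where "l = (\<lambda>x. \<ominus> (z x \<otimes> inv (z e)))"
  have "A t e = (\<Oplus>x\<in>X. A t x \<otimes> l x)" if t: "t \<in> T" for t
  proof -
    let ?s = "\<Oplus>x\<in>X. A t x \<otimes> z x"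
    have s: "?s \<in> carrier F" using At[OF t] zc by (auto intro!: finsum_closed)
    have ae: "A t e \<in> carrier F" using At t by simp
    have "(\<Oplus>x\<in>X. A t x \<otimes> l x) = (\<Oplus>x\<in>X. A t x \<otimes> z x \<otimes> (\<ominus> (inv (z e))))"
      using At[OF t] zc i by (intro finsum_cong') (auto simp: l_def r_minus m_assoc)
    also have "\<dots> = ?s \<otimes> (\<ominus> (inv (z e)))"
      using At[OF t] zc i finite_indep[OF X] by (subst finsum_ldistr) auto
    also have "?s = \<ominus> (A t e \<otimes> z e)"
      using rel'[OF t] s ae zc[OF insertI1] by (metis a_comm m_closed minus_equality)
    also have "\<ominus> (A t e \<otimes> z e) \<otimes> (\<ominus> (inv (z e))) = A t e"
      using i ae zc[OF insertI1] by (simp add: l_minus r_minus m_assoc)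
    finally show ?thesis by simp
  qed
  moreover have "l \<in> X \<rightarrow> carrier F" using zc i by (auto simp: l_def)
  ultimately show ?thesis using that by blast
qed

text \<open>Only augmentation needs an idea. If no element of \<open>Y\<close> enlarges
  \<open>X\<close>, all columns of \<open>Y\<close> are combinations of those of \<open>X\<close>.
  The coefficients form a system with fewer equations than unknowns, and a nonzero solution is a
  relation on \<open>Y\<close>.\<close>

lemma matroid: "is_matroid M"
proof -
  have aug: "\<exists>y\<in>Y - X. insert y X \<in> indeps M"
    if X: "X \<in> indeps M" and Y: "Y \<in> indeps M" and less: "card X < card Y" for X Y
  proof (rule ccontr)
    assume *: "\<not> (\<exists>y\<in>Y - X. insert y X \<in> indeps M)"
    have AX: "A t x \<in> carrier F" if "t \<in> T" "x \<in> X" for t x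
      using that A_closed indep_subset_E[OF X] by auto
    have "\<exists>l. l \<in> X \<rightarrow> carrier F \<and> (\<forall>t\<in>T. A t y = (\<Oplus>x\<in>X. A t x \<otimes> l x))" if "y \<in> Y" for y
    proof -
      have y: "y \<in> E" "insert y X \<notin> indeps M \<or> y \<in> X" using that * indep_subset_E[OF Y] by auto
      show ?thesis by (rule dependent_column[OF X y]) blast
    qed
    then obtain l where l: "\<And>y. y \<in> Y \<Longrightarrow> l y \<in> X \<rightarrow> carrier F"
      and Al: "\<And>y t. y \<in> Y \<Longrightarrow> t \<in> T \<Longrightarrow> A t y = (\<Oplus>x\<in>X. A t x \<otimes> l y x)"
      by metis
    have lc: "l y x \<in> carrier F" if "y \<in> Y" "x \<in> X" for x y using l that by auto
    have "(\<lambda>x y. l y x) \<in> X \<rightarrow> Y \<rightarrow> carrier F" using lc by auto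
    from homogeneous_system_solution[OF finite_indep[OF X] finite_indep[OF Y] less this]
    obtain z where z: "z \<in> Y \<rightarrow> carrier F" "\<exists>y\<in>Y. z y \<noteq> \<zero>"
      and rel: "\<And>x. x \<in> X \<Longrightarrow> (\<Oplus>y\<in>Y. l y x \<otimes> z y) = \<zero>" by blast
    have zc: "z y \<in> carrier F" if "y \<in> Y" for y using z(1) that by auto
    have rel0: "(\<Oplus>y\<in>Y. A t y \<otimes> z y) = \<zero>" if t: "t \<in> T" for t
    proof -
      have "(\<Oplus>y\<in>Y. A t y \<otimes> z y) = (\<Oplus>y\<in>Y. \<Oplus>x\<in>X. A t x \<otimes> l y x \<otimes> z y)"
      proof (intro finsum_cong')
        fix y assume y: "y \<in> Y"
        have "A t y \<otimes> z y = (\<Oplus>x\<in>X. A t x \<otimes> l y x) \<otimes> z y" using Al[OF y t] by simp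
        also have "\<dots> = (\<Oplus>x\<in>X. A t x \<otimes> l y x \<otimes> z y)"
          using finite_indep[OF X] AX[OF t] lc[OF y] zc[OF y] by (intro finsum_ldistr) auto
        finally show "A t y \<otimes> z y = (\<Oplus>x\<in>X. A t x \<otimes> l y x \<otimes> z y)" .
      qed (use AX[OF t] lc zc in \<open>auto intro!: finsum_closed\<close>)
      also have "\<dots> = (\<Oplus>x\<in>X. \<Oplus>y\<in>Y. A t x \<otimes> l y x \<otimes> z y)"
        using AX[OF t] lc zc by (intro finsum_swap finite_indep X Y) auto
      also have "\<dots> = (\<Oplus>x\<in>X. \<zero>)"
      proof (intro finsum_cong')
        fix x assume x: "x \<in> X"
        have "(\<Oplus>y\<in>Y. A t x \<otimes> l y x \<otimes> z y) = (\<Oplus>y\<in>Y. A t x \<otimes> (l y x \<otimes> z y))"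
          using AX[OF t] lc zc x by (intro finsum_cong') (auto simp: m_assoc)
        also have "\<dots> = A t x \<otimes> (\<Oplus>y\<in>Y. l y x \<otimes> z y)"
          using AX[OF t] lc zc x finite_indep[OF Y] by (intro finsum_rdistr[symmetric]) auto
        finally show "(\<Oplus>y\<in>Y. A t x \<otimes> l y x \<otimes> z y) = \<zero>" using rel[OF x] AX[OF t x] by simp
      qed auto
      finally show ?thesis by simp
    qed
    have "z y = \<zero>" if "y \<in> Y" for y
      by (rule indep_zero[OF Y z(1) rel0 that])
    then show False using z(2) by blast
  qed
  have down: "Y \<in> indeps M" if X: "X \<in> indeps M" and "Y \<subseteq> X" for X Y
    unfolding indep_iff
  proof (intro conjI ballI impI)
    show "Y \<subseteq> E" using indep_subset_E[OF X] \<open>Y \<subseteq> X\<close> by blast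
    fix x e assume x: "x \<in> Y \<rightarrow> carrier F" "\<forall>t\<in>T. (\<Oplus>e\<in>Y. A t e \<otimes> x e) = \<zero>" and e: "e \<in> Y"
    let ?x = "\<lambda>e. if e \<in> Y then x e else \<zero>"
    have rel0: "(\<Oplus>e\<in>X. A t e \<otimes> ?x e) = \<zero>" if t: "t \<in> T" for t
    proof -
      have c: "A t e \<in> carrier F" if "e \<in> X" for e using A_closed t that indep_subset_E[OF X] by auto
      have "(\<Oplus>e\<in>X. A t e \<otimes> ?x e) = (\<Oplus>e\<in>Y. A t e \<otimes> ?x e)"
        using \<open>Y \<subseteq> X\<close> c x(1) finite_indep[OF X]
        by (intro add.finprod_mono_neutral_cong_right) (auto simp: Pi_iff)
      also have "\<dots> = (\<Oplus>e\<in>Y. A t e \<otimes> x e)"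
        using \<open>Y \<subseteq> X\<close> c x(1) by (intro finsum_cong') (auto simp: Pi_iff)
      finally show ?thesis using x(2) t by simp
    qed
    have "?x \<in> X \<rightarrow> carrier F" using x(1) by auto
    moreover have "e \<in> X" using e \<open>Y \<subseteq> X\<close> by blast
    ultimately have "?x e = \<zero>" by (intro indep_zero[OF X _ rel0])
    then show "x e = \<zero>" using e by simp
  qed
  have "ground M = E" by (simp add: matrix_matroid_def)
  moreover have "{} \<in> indeps M" by (simp add: indep_iff)
  moreover have "indeps M \<subseteq> Pow E" using indep_subset_E by blast
  ultimately show ?thesis
    unfolding is_matroid_def using finite_E aug down by simp
qed

text \<open>If column \<open>e\<close> is a combination of the columns in \<open>X\<close> with
  right coefficients \<open>l x\<close>, exchanging the sums turns \<open>row y e\<close> into the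
  sum of all \<open>row y x \<otimes> l x\<close>.\<close>

lemma row_eq_zero_on_closure:
  assumes y: "y \<in> T \<rightarrow> carrier F" and X: "X \<in> indeps M" "\<And>x. x \<in> X \<Longrightarrow> row y x = \<zero>"
    and e: "e \<in> E" "insert e X \<notin> indeps M \<or> e \<in> X"
  shows "row y e = \<zero>"
proof -
  obtain l where l: "l \<in> X \<rightarrow> carrier F" and Al: "\<And>t. t \<in> T \<Longrightarrow> A t e = (\<Oplus>x\<in>X. A t x \<otimes> l x)"
    using dependent_column[OF X(1) e] by metis
  have yc: "y t \<in> carrier F" if "t \<in> T" for t using y that by auto
  have lc: "l x \<in> carrier F" if "x \<in> X" for x using l that by auto
  have Ac: "A t x \<in> carrier F" if "t \<in> T" "x \<in> X" for t x
    using that A_closed indep_subset_E[OF X(1)] by auto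
  have "row y e = (\<Oplus>t\<in>T. \<Oplus>x\<in>X. y t \<otimes> A t x \<otimes> l x)"
    unfolding row_def
  proof (intro finsum_cong')
    fix t assume t: "t \<in> T"
    have "y t \<otimes> A t e = (\<Oplus>x\<in>X. y t \<otimes> (A t x \<otimes> l x))"
      unfolding Al[OF t] using finite_indep[OF X(1)] yc[OF t] Ac[OF t] lc
      by (intro finsum_rdistr) auto
    also have "\<dots> = (\<Oplus>x\<in>X. y t \<otimes> A t x \<otimes> l x)"
      using yc[OF t] Ac[OF t] lc by (intro finsum_cong') (auto simp: m_assoc)
    finally show "y t \<otimes> A t e = (\<Oplus>x\<in>X. y t \<otimes> A t x \<otimes> l x)" .
  qed (use yc Ac lc in \<open>auto intro!: finsum_closed\<close>)
  also have "\<dots> = (\<Oplus>x\<in>X. \<Oplus>t\<in>T. y t \<otimes> A t x \<otimes> l x)"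
    using yc Ac lc by (intro finsum_swap finite_T finite_indep X) auto
  also have "\<dots> = (\<Oplus>x\<in>X. row y x \<otimes> l x)"
    unfolding row_def using yc Ac lc finite_T
    by (intro finsum_cong' finsum_ldistr[symmetric]) (auto intro!: finsum_closed)
  also have "\<dots> = (\<Oplus>x\<in>X. \<zero>)"
    using X(2) lc by (intro finsum_cong') auto
  finally show ?thesis by simp
qed

text \<open>A row vanishing on a basis would vanish on everything the basis spans, which is all of
  \<open>E\<close>; nondegeneracy then makes its multipliers zero.\<close>

lemma basis_meets_row_support:
  assumes nondegenerate: "\<forall>y\<in>T \<rightarrow> carrier F. (\<forall>e\<in>E. row y e = \<zero>) \<longrightarrow> (\<forall>t\<in>T. y t = \<zero>)"
    and B: "B \<in> bases M" and y: "y \<in> T \<rightarrow> carrier F" "t \<in> T" "y t \<noteq> \<zero>"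
  shows "{e \<in> E. row y e \<noteq> \<zero>} \<inter> B \<noteq> {}"
proof
  assume *: "{e \<in> E. row y e \<noteq> \<zero>} \<inter> B = {}"
  have Bi: "B \<in> indeps M" and max: "\<And>X. X \<in> indeps M \<Longrightarrow> B \<subseteq> X \<Longrightarrow> X = B"
    using B by (simp_all add: bases_def)
  have "row y x = \<zero>" if "x \<in> B" for x using * that indep_subset_E[OF Bi] by blast
  then have "row y e = \<zero>" if "e \<in> E" for e
    using row_eq_zero_on_closure[OF y(1) Bi _ that] max[of "insert e B"] by blast
  then show False using nondegenerate y by blast
qed

text \<open>As \<open>D\<close> meets every basis, a maximal independent set \<open>I\<close> off
  \<open>D\<close> lies properly inside a basis and has fewer elements than \<open>T\<close>. Asking
  a row to vanish on \<open>I\<close> is then an underdetermined system, and a solution vanishes on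
  all that \<open>I\<close> spans, in particular everywhere off \<open>D\<close>.\<close>

lemma cocircuit_contains_row_support:
  assumes D: "D \<in> cocircuits M"
  obtains y t where "y \<in> T \<rightarrow> carrier F" "t \<in> T" "y t \<noteq> \<zero>" "{e \<in> E. row y e \<noteq> \<zero>} \<subseteq> D"
proof -
  let ?S = "{X \<in> indeps M. X \<subseteq> E - D}"
  have "?S \<subseteq> Pow E" by auto
  then have "finite ?S" using finite_E by (meson finite_Pow_iff finite_subset)
  moreover have "{} \<in> ?S" by (simp add: indep_iff)
  ultimately obtain I where I: "I \<in> ?S" and maxI: "\<forall>X\<in>?S. I \<subseteq> X \<longrightarrow> I = X"
    using finite_has_maximal[of ?S] by auto
  then have Ii: "I \<in> indeps M" and ID: "I \<subseteq> E - D" by auto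
  obtain B where B: "B \<in> bases M" "I \<subseteq> B" by (rule indep_extends_to_basis[OF matroid Ii])
  have "D \<inter> B \<noteq> {}"
    using D B(1) cocircuits_iff[OF bases_subset_ground[OF matroid]] by blast
  then have "I \<subset> B" using B(2) ID by auto
  moreover have "B \<in> indeps M" using B(1) by (simp add: bases_def)
  ultimately have "card I < card T"
    using card_indep_le[of B] psubset_card_mono[OF finite_indep, of B I] by simp
  moreover have "(\<lambda>e t. A t e) \<in> I \<rightarrow> T \<rightarrow> carrier F" using A_closed ID by auto
  ultimately obtain y where y: "y \<in> T \<rightarrow> carrier F" "\<exists>t\<in>T. y t \<noteq> \<zero>"
    and "\<forall>e\<in>I. (\<Oplus>t\<in>T. y t \<otimes> A t e) = \<zero>"
    using homogeneous_system_left_solution[OF finite_indep[OF Ii] finite_T, of "\<lambda>e t. A t e"] by auto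
  then have yI: "row y e = \<zero>" if "e \<in> I" for e using that by (simp add: row_def)
  have "row y e = \<zero>" if e: "e \<in> E" "e \<notin> D" for e
  proof (rule row_eq_zero_on_closure[OF y(1) Ii yI e(1)])
    have "insert e I \<subseteq> E - D" using e ID by simp
    then show "insert e I \<notin> indeps M \<or> e \<in> I" using maxI by (metis (no_types, lifting) insertI1 mem_Collect_eq subset_insertI)
  qed
  then have "{e \<in> E. row y e \<noteq> \<zero>} \<subseteq> D" by blast
  then show ?thesis using that y by blast
qed

lemma cocircuits_eq_minimal_row_supports:
  assumes nondegenerate: "\<forall>y\<in>T \<rightarrow> carrier F. (\<forall>e\<in>E. row y e = \<zero>) \<longrightarrow> (\<forall>t\<in>T. y t = \<zero>)"
  defines "\<S> \<equiv> {{e \<in> E. row y e \<noteq> \<zero>} | y. y \<in> T \<rightarrow> carrier F \<and> (\<exists>t\<in>T. y t \<noteq> \<zero>)}"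
  shows "cocircuits M = {S \<in> \<S>. \<forall>S'\<in>\<S>. S' \<subseteq> S \<longrightarrow> S' = S}"
proof (rule cocircuits_eq_minimal[OF matroid])
  show "S \<inter> B \<noteq> {}" if "S \<in> \<S>" "B \<in> bases M" for S B
    using basis_meets_row_support[OF nondegenerate that(2)] that(1) unfolding \<S>_def by auto
  show "S \<subseteq> ground M" if "S \<in> \<S>" for S
    using that by (auto simp: \<S>_def matrix_matroid_def)
  show "\<exists>S\<in>\<S>. S \<subseteq> D" if D: "D \<in> cocircuits M" for D
    by (rule cocircuit_contains_row_support[OF D]) (auto simp: \<S>_def)
qed

end

section \<open>The cocircuits of \<open>R\<^sub>9\<close>\<close>

lemma atLeastAtMost_1_3: "{1..3::nat} = {1, 2, 3}"
  by auto

lemma (in ring) finsum_1_3: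
  assumes "f \<in> {1..3::nat} \<rightarrow> carrier R"
  shows "(\<Oplus>t\<in>{1..3}. f t) = f 1 \<oplus> (f 2 \<oplus> f 3)"
proof -
  have "f 1 \<in> carrier R" "f 2 \<in> carrier R" "f 3 \<in> carrier R" using assms by auto
  then show ?thesis unfolding atLeastAtMost_1_3 by simp
qed

text \<open>The product of \<open>y\<close> with the matrix of \<open>R\<^sub>9\<close>, where the
  entry 2 is read as -1. In this form it makes sense over every ring, and all its coefficients are
  0, 1 or -1.\<close>

definition R9_row :: "('r, 'm) ring_scheme \<Rightarrow> (nat \<Rightarrow> 'r) \<Rightarrow> nat \<Rightarrow> 'r" where
  "R9_row R y i =
    [y 1, y 2, y 3, y 1 \<oplus>\<^bsub>R\<^esub> (y 2 \<oplus>\<^bsub>R\<^esub> y 3), y 1 \<oplus>\<^bsub>R\<^esub> y 2, y 1 \<ominus>\<^bsub>R\<^esub> y 2,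
     y 2 \<oplus>\<^bsub>R\<^esub> y 3, y 2 \<ominus>\<^bsub>R\<^esub> y 3, y 1 \<oplus>\<^bsub>R\<^esub> y 3] ! (i - 1)"

lemma R9_ground_cases:
  assumes "i \<in> {1..9::nat}"
  obtains "i = 1" | "i = 2" | "i = 3" | "i = 4" | "i = 5" | "i = 6" | "i = 7" | "i = 8" | "i = 9"
proof -
  have "i = 1 \<or> i = 2 \<or> i = 3 \<or> i = 4 \<or> i = 5 \<or> i = 6 \<or> i = 7 \<or> i = 8 \<or> i = 9"
    using assms unfolding atLeastAtMost_iff by arith
  then show ?thesis using that by blast
qed

lemma R9_row_simps:
  "R9_row R y (Suc 0) = y 1" "R9_row R y 1 = y 1" "R9_row R y 2 = y 2" "R9_row R y 3 = y 3"
  "R9_row R y 4 = y 1 \<oplus>\<^bsub>R\<^esub> (y 2 \<oplus>\<^bsub>R\<^esub> y 3)"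
  "R9_row R y 5 = y 1 \<oplus>\<^bsub>R\<^esub> y 2" "R9_row R y 6 = y 1 \<ominus>\<^bsub>R\<^esub> y 2"
  "R9_row R y 7 = y 2 \<oplus>\<^bsub>R\<^esub> y 3" "R9_row R y 8 = y 2 \<ominus>\<^bsub>R\<^esub> y 3"
  "R9_row R y 9 = y 1 \<oplus>\<^bsub>R\<^esub> y 3"
  by (simp_all add: R9_row_def)

abbreviation GF3 :: "int ring" where
  "GF3 \<equiv> residue_ring 3"

interpretation GF3: residues 3 GF3
  by unfold_locales simp_all

lemma GF3_carrier: "carrier GF3 = {0, 1, 2}"
  unfolding GF3.res_carrier_eq by auto

lemma GF3_add: "x \<oplus>\<^bsub>GF3\<^esub> y = (x + y) mod 3"
  by (rule GF3.res_add_eq)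

lemma GF3_minus: "x \<in> carrier GF3 \<Longrightarrow> y \<in> carrier GF3 \<Longrightarrow> x \<ominus>\<^bsub>GF3\<^esub> y = (x - y) mod 3"
  by (simp add: GF3.minus_eq GF3.res_add_eq GF3.res_neg_eq mod_simps)

lemma GF3_zero: "\<zero>\<^bsub>GF3\<^esub> = 0"
  by (rule GF3.res_zero_eq)

lemma GF3_Units: "Units GF3 = {1, 2}"
proof (rule Set.set_eqI)
  fix x :: int
  show "x \<in> Units GF3 \<longleftrightarrow> x \<in> {1, 2}"
  proof (cases "0 < x \<and> x < 3")
    case True
    then have "x = 1 \<or> x = 2" by arith
    then show ?thesis by (auto simp: GF3.res_units_eq)
  qed (auto simp: GF3.res_units_eq)
qed

definition R9_support :: "(nat \<Rightarrow> int) \<Rightarrow> nat set" where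
  "R9_support y = {i \<in> {1..9}. R9_row GF3 y i \<noteq> 0}"

definition R9_supports :: "nat set set" where
  "R9_supports = {R9_support y | y. y \<in> {1..3} \<rightarrow> {0, 1, 2} \<and> (\<exists>t\<in>{1..3}. y t \<noteq> 0)}"

lemma R9_matrix: "skew_field_matrix GF3 {1..3} {1..9} (\<lambda>t e. R9_rows ! (t - 1) ! (e - 1))"
proof -
  have "Units GF3 = carrier GF3 - {\<zero>\<^bsub>GF3\<^esub>}"
    unfolding GF3_Units GF3_carrier GF3_zero by auto
  moreover have "R9_rows ! (t - 1) ! (e - 1) \<in> carrier GF3" if "t \<in> {1..3}" "e \<in> {1..9}" for t e
    using that(1) unfolding atLeastAtMost_1_3
    by (cases rule: R9_ground_cases[OF that(2)]) (auto simp: R9_rows_def GF3_carrier)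
  ultimately show ?thesis
    by unfold_locales auto
qed

interpretation R9: skew_field_matrix GF3 "{1..3}" "{1..9}" "\<lambda>t e. R9_rows ! (t - 1) ! (e - 1)"
  by (rule R9_matrix)

lemma R9_is_matroid: "is_matroid R9"
  unfolding R9_def by (rule R9.matroid)

lemma ground_R9: "ground R9 = {1..9}"
  by (simp add: R9_def matrix_matroid_def)

lemma R9_matrix_row:
  assumes y: "y \<in> {1..3} \<rightarrow> {0, 1, 2}" and i: "i \<in> {1..9}"
  shows "R9.row y i = R9_row GF3 y i"
proof -
  have y': "y 1 \<in> {0, 1, 2}" "y 2 \<in> {0, 1, 2}" "y 3 \<in> {0, 1, 2}" using y by auto
  have yc: "y t \<in> carrier GF3" if "t \<in> {1..3}" for t
    using y that unfolding GF3_carrier by auto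
  have "R9.row y i = (\<Oplus>\<^bsub>GF3\<^esub>t\<in>{1..3}. y t \<otimes>\<^bsub>GF3\<^esub> R9_rows ! (t - 1) ! (i - 1))"
    by (rule R9.row_def)
  also have "\<dots> = y 1 \<otimes>\<^bsub>GF3\<^esub> R9_rows ! 0 ! (i - 1) \<oplus>\<^bsub>GF3\<^esub>
      (y 2 \<otimes>\<^bsub>GF3\<^esub> R9_rows ! 1 ! (i - 1) \<oplus>\<^bsub>GF3\<^esub> y 3 \<otimes>\<^bsub>GF3\<^esub> R9_rows ! 2 ! (i - 1))"
    by (subst GF3.finsum_1_3) (use R9.A_closed[OF _ i] yc in \<open>auto intro!: GF3.m_closed\<close>)
  also have "\<dots> = R9_row GF3 y i"
    using y' by (cases rule: R9_ground_cases[OF i])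
      (auto simp: R9_row_simps R9_rows_def GF3_add GF3_minus GF3.res_mult_eq GF3_carrier)
  finally show ?thesis .
qed

lemma cocircuits_R9: "cocircuits R9 = {S \<in> R9_supports. \<forall>S'\<in>R9_supports. S' \<subseteq> S \<longrightarrow> S' = S}"
proof -
  have eq: "{e \<in> {1..9}. R9.row y e \<noteq> \<zero>\<^bsub>GF3\<^esub>} = R9_support y" if "y \<in> {1..3} \<rightarrow> {0, 1, 2}" for y
    unfolding R9_support_def using R9_matrix_row[OF that] by (intro Collect_cong) (auto simp: GF3_zero)
  have "{{e \<in> {1..9}. R9.row y e \<noteq> \<zero>\<^bsub>GF3\<^esub>} | y. y \<in> {1..3} \<rightarrow> carrier GF3 \<and> (\<exists>t\<in>{1..3}. y t \<noteq> \<zero>\<^bsub>GF3\<^esub>)}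
      = R9_supports"
    unfolding R9_supports_def GF3_carrier GF3_zero
    by (intro Collect_cong ex_cong1 rev_conj_cong refl) (simp only: eq[unfolded GF3_zero])
  moreover have "\<forall>y\<in>{1..3} \<rightarrow> carrier GF3. (\<forall>e\<in>{1..9}. R9.row y e = \<zero>\<^bsub>GF3\<^esub>) \<longrightarrow> (\<forall>t\<in>{1..3}. y t = \<zero>\<^bsub>GF3\<^esub>)"
  proof (intro ballI impI)
    fix y :: "nat \<Rightarrow> int" and t :: nat
    assume y: "y \<in> {1..3} \<rightarrow> carrier GF3" "\<forall>e\<in>{1..9}. R9.row y e = \<zero>\<^bsub>GF3\<^esub>" and t: "t \<in> {1..3}"
    \<comment> \<open>Columns 1 to 3 are the unit vectors, so there the row returns the coordinates
      of \<open>y\<close>.\<close>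
    then have "R9_row GF3 y t = \<zero>\<^bsub>GF3\<^esub>" using R9_matrix_row[of y t] by (auto simp: GF3_carrier)
    then show "y t = \<zero>\<^bsub>GF3\<^esub>" using t unfolding atLeastAtMost_1_3 by (auto simp: R9_row_simps)
  qed
  ultimately show ?thesis
    using R9.cocircuits_eq_minimal_row_supports unfolding R9_def by simp
qed

lemma R9_support_contains_cocircuit:
  assumes S: "S \<in> R9_supports"
  obtains D where "D \<in> cocircuits R9" "D \<subseteq> S"
proof -
  have "R9_supports \<subseteq> Pow {1..9}" by (auto simp: R9_supports_def R9_support_def)
  then have "finite R9_supports" by (rule finite_subset) simp
  from finite_has_minimal2[OF this S] obtain D where "D \<in> R9_supports" "D \<subseteq> S"
    "\<forall>X\<in>R9_supports. X \<subseteq> D \<longrightarrow> D = X" by blast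
  then show ?thesis using that[of D] unfolding cocircuits_R9 by auto
qed

section \<open>The cocircuits of \<open>Q\<^sub>3(G)\<close>\<close>

abbreviation quats :: "quat set" where
  "quats \<equiv> set quaternion_group"

lemmas quat_unit_defs = quat_1_def quat_i_def quat_j_def quat_k_def

lemma quat_mult_one [simp]: "quat_mult quat_1 q = q" "quat_mult q quat_1 = q"
  by (cases q; simp add: quat_1_def)+

lemma quat_mult_zero [simp]: "quat_mult 0 q = 0" "quat_mult q 0 = 0"
  by (cases q; simp add: zero_prod_def)+

lemma quat_mult_assoc: "quat_mult (quat_mult p q) r = quat_mult p (quat_mult q r)"
  by (cases p; cases q; cases r) (simp add: algebra_simps)

lemma quats_mult: "g \<in> quats \<Longrightarrow> h \<in> quats \<Longrightarrow> quat_mult g h \<in> quats"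
  unfolding quaternion_group_def quat_unit_defs by auto

lemma quats_inverse:
  assumes "g \<in> quats"
  obtains h where "h \<in> quats" "quat_mult g h = quat_1" "quat_mult h g = quat_1"
proof -
  let ?h = "case g of (a, b, c, d) \<Rightarrow> (a, - b, - c, - d)"
  consider "g = quat_1" | "g = - quat_1" | "g = quat_i" | "g = - quat_i" | "g = quat_j" | "g = - quat_j"
    | "g = quat_k" | "g = - quat_k"
    using assms by (auto simp: quaternion_group_def)
  then have "?h \<in> quats \<and> quat_mult g ?h = quat_1 \<and> quat_mult ?h g = quat_1"
    by cases (simp_all add: quaternion_group_def quat_unit_defs)
  then show ?thesis using that by blast
qed

lemma quat_1_in_quats: "quat_1 \<in> quats" and zero_notin_quats: "0 \<notin> quats"
  by (simp_all add: quaternion_group_def quat_unit_defs zero_prod_def)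

lemma quat_g_in_quats:
  assumes "m \<in> {1..8}"
  shows "quat_g m \<in> quats"
proof -
  have "m - 1 < length quaternion_group" using assms by (auto simp: quaternion_group_def)
  then show ?thesis unfolding quat_g_def by (rule nth_mem)
qed

lemma quats_eq_quat_g:
  assumes "g \<in> quats"
  obtains m where "m \<in> {1..8}" "g = quat_g m"
proof -
  obtain n where "n < length quaternion_group" "g = quaternion_group ! n"
    using assms by (auto simp: in_set_conv_nth)
  then show ?thesis using that[of "Suc n"] by (simp add: quat_g_def quaternion_group_def)
qed

section \<open>Rows of the matrix of \<open>Q\<^sub>3(G)\<close> over rings with a copy of G\<close>

definition quats0 :: "quat set" where
  "quats0 = insert 0 quats"

lemma quats0_mult: "g \<in> quats0 \<Longrightarrow> h \<in> quats0 \<Longrightarrow> quat_mult g h \<in> quats0"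
  by (auto simp: quats0_def quats_mult)

text \<open>An entry at a, b or c vanishes exactly when one coordinate is another one times a group
  element from the right. The ring and the map \<open>\<phi>\<close> are parameters so that the
  quaternions and the algebra in characteristic 3 share the arguments.\<close>

fun Q3_row :: "('r, 'm) ring_scheme \<Rightarrow> (quat \<Rightarrow> 'r) \<Rightarrow> (nat \<Rightarrow> 'r) \<Rightarrow> dowling_elt \<Rightarrow> 'r" where
  "Q3_row R \<phi> y (Elt_e t) = y t"
| "Q3_row R \<phi> y (Elt_a m) = y 2 \<otimes>\<^bsub>R\<^esub> \<phi> (quat_g m) \<ominus>\<^bsub>R\<^esub> y 1"
| "Q3_row R \<phi> y (Elt_b m) = y 3 \<otimes>\<^bsub>R\<^esub> \<phi> (quat_g m) \<ominus>\<^bsub>R\<^esub> y 2"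
| "Q3_row R \<phi> y (Elt_c m) = y 1 \<otimes>\<^bsub>R\<^esub> \<phi> (quat_g m) \<ominus>\<^bsub>R\<^esub> y 3"

lemma Q3_ground_cases:
  assumes "e \<in> Q3_ground"
  obtains t where "t \<in> {1..3}" "e = Elt_e t" | m where "m \<in> {1..8}" "e = Elt_a m"
    | m where "m \<in> {1..8}" "e = Elt_b m" | m where "m \<in> {1..8}" "e = Elt_c m"
  using assms unfolding Q3_ground_def by blast

lemma Q3_ground_simps [simp]:
  "Elt_e t \<in> Q3_ground \<longleftrightarrow> t \<in> {1..3}" "Elt_a m \<in> Q3_ground \<longleftrightarrow> m \<in> {1..8}"
  "Elt_b m \<in> Q3_ground \<longleftrightarrow> m \<in> {1..8}" "Elt_c m \<in> Q3_ground \<longleftrightarrow> m \<in> {1..8}"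
  by (auto simp: Q3_ground_def)

lemma finite_Q3_ground: "finite Q3_ground"
  by (simp add: Q3_ground_def)

lemma quaternions_simps [simp]:
  "carrier quaternions = UNIV" "x \<otimes>\<^bsub>quaternions\<^esub> y = quat_mult x y"
  "x \<oplus>\<^bsub>quaternions\<^esub> y = x + y" "\<zero>\<^bsub>quaternions\<^esub> = 0" "\<one>\<^bsub>quaternions\<^esub> = quat_1"
  by (simp_all add: quaternions_def quat_1_def)

interpretation H: skew_field_ring quaternions
  by (rule skew_field_ringI[OF skew_field_quaternions])

lemma quaternions_minus [simp]: "\<ominus>\<^bsub>quaternions\<^esub> x = - x" "x \<ominus>\<^bsub>quaternions\<^esub> y = x - y"
proof -
  show m: "\<ominus>\<^bsub>quaternions\<^esub> x = - x" for x by (rule H.minus_equality) simp_all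
  show "x \<ominus>\<^bsub>quaternions\<^esub> y = x - y" by (simp add: H.minus_eq m)
qed

text \<open>What the quaternions and the finite algebra have in common. Zero divisors are allowed;
  \<open>\<phi>_diff\<close> is the substitute for division and makes \<open>\<phi>\<close>
  injective on \<open>quats0\<close>.\<close>

locale quaternion_group_ring = ring R for R :: "('r, 'm) ring_scheme" (structure) +
  fixes \<phi> :: "quat \<Rightarrow> 'r"
  assumes one_neq_zero: "\<one> \<noteq> \<zero>"
    and \<phi>_zero: "\<phi> 0 = \<zero>" and \<phi>_one: "\<phi> quat_1 = \<one>"
    and \<phi>_closed: "\<And>g. g \<in> quats0 \<Longrightarrow> \<phi> g \<in> carrier R"
    and \<phi>_mult: "\<And>g h. g \<in> quats0 \<Longrightarrow> h \<in> quats0 \<Longrightarrow> \<phi> (quat_mult g h) = \<phi> g \<otimes> \<phi> h"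
    and \<phi>_diff: "\<And>g h. g \<in> quats0 \<Longrightarrow> h \<in> quats0 \<Longrightarrow> g \<noteq> h \<Longrightarrow> \<phi> g \<ominus> \<phi> h \<in> Units R"
begin

lemma zero_notin_Units: "\<zero> \<notin> Units R"
  using one_neq_zero unfolding Units_def by auto

lemma \<phi>_diff_eq_zero_iff:
  assumes "g \<in> quats0" "h \<in> quats0"
  shows "\<phi> g \<ominus> \<phi> h = \<zero> \<longleftrightarrow> g = h"
  using assms \<phi>_diff[OF assms] zero_notin_Units \<phi>_closed r_neg by (cases "g = h") (auto simp: minus_eq)

text \<open>Although \<open>x\<close> may be a zero divisor, distinct \<open>g\<close> and
  \<open>h\<close> have images that differ by a unit, and a nonzero \<open>x\<close> times a unit is
  not zero.\<close>

lemma \<phi>_cancel: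
  assumes x: "x \<in> carrier R" "x \<noteq> \<zero>" and g: "g \<in> quats0" "h \<in> quats0" and eq: "x \<otimes> \<phi> g = x \<otimes> \<phi> h"
  shows "g = h"
proof (rule ccontr)
  assume "g \<noteq> h"
  define d where "d = \<phi> g \<ominus> \<phi> h"
  have u: "d \<in> Units R" using \<phi>_diff g \<open>g \<noteq> h\<close> by (simp add: d_def)
  have "x \<otimes> d = \<zero>"
    using x g \<phi>_closed eq by (simp add: d_def minus_eq r_distr r_minus r_neg)
  moreover have "x = x \<otimes> d \<otimes> inv d" using u x by (simp add: m_assoc Units_closed)
  ultimately show False using u x by simp
qed

lemma Q3_row_closed:
  assumes "y \<in> {1..3} \<rightarrow> carrier R" "e \<in> Q3_ground"
  shows "Q3_row R \<phi> y e \<in> carrier R"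
proof -
  have "y t \<in> carrier R" if "t \<in> {1..3}" for t using assms(1) that by auto
  then show ?thesis using \<phi>_closed quat_g_in_quats
    by (cases rule: Q3_ground_cases[OF assms(2)]) (auto simp: quats0_def)
qed

lemma Q3_row_zero_iff:
  assumes y: "y \<in> {1..3} \<rightarrow> carrier R" and m: "m \<in> {1..8}"
  shows "Q3_row R \<phi> y (Elt_a m) = \<zero> \<longleftrightarrow> y 1 = y 2 \<otimes> \<phi> (quat_g m)"
    "Q3_row R \<phi> y (Elt_b m) = \<zero> \<longleftrightarrow> y 2 = y 3 \<otimes> \<phi> (quat_g m)"
    "Q3_row R \<phi> y (Elt_c m) = \<zero> \<longleftrightarrow> y 3 = y 1 \<otimes> \<phi> (quat_g m)"
proof -
  have "y 1 \<in> carrier R" "y 2 \<in> carrier R" "y 3 \<in> carrier R" using y by auto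
  moreover have "\<phi> (quat_g m) \<in> carrier R" using \<phi>_closed quat_g_in_quats[OF m] by (simp add: quats0_def)
  ultimately show "Q3_row R \<phi> y (Elt_a m) = \<zero> \<longleftrightarrow> y 1 = y 2 \<otimes> \<phi> (quat_g m)"
    "Q3_row R \<phi> y (Elt_b m) = \<zero> \<longleftrightarrow> y 2 = y 3 \<otimes> \<phi> (quat_g m)"
    "Q3_row R \<phi> y (Elt_c m) = \<zero> \<longleftrightarrow> y 3 = y 1 \<otimes> \<phi> (quat_g m)"
    by auto
qed

lemma eq_mult_\<phi>_inverse:
  assumes "x \<in> carrier R" "z \<in> carrier R" "g \<in> quats" "h \<in> quats" "quat_mult g h = quat_1" "quat_mult h g = quat_1"
  shows "x = z \<otimes> \<phi> g \<longleftrightarrow> z = x \<otimes> \<phi> h"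
proof -
  have g: "g \<in> quats0" "h \<in> quats0" using assms by (simp_all add: quats0_def)
  have 1: "\<phi> g \<otimes> \<phi> h = \<one>" "\<phi> h \<otimes> \<phi> g = \<one>"
    using \<phi>_mult[OF g] \<phi>_mult[OF g(2,1)] assms(5,6) \<phi>_one by auto
  show ?thesis using assms(1,2) \<phi>_closed[OF g(1)] \<phi>_closed[OF g(2)] 1
    by (metis m_assoc r_one)
qed

text \<open>The columns a, b, c express coordinate 1 through 2, 2 through 3 and 3 through 1. The
  opposite directions are served by the columns of the inverse of \<open>g\<close>.\<close>

lemma Q3_row_links:
  assumes "s \<in> {1..3}" "t \<in> {1..3}" "s \<noteq> t" "g \<in> quats"
  obtains e where "e \<in> Q3_ground"
    "\<forall>y\<in>{1..3} \<rightarrow> carrier R. Q3_row R \<phi> y e = \<zero> \<longleftrightarrow> y s = y t \<otimes> \<phi> g"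
proof -
  obtain h where h: "h \<in> quats" "quat_mult g h = quat_1" "quat_mult h g = quat_1"
    by (rule quats_inverse[OF assms(4)])
  obtain m where m: "m \<in> {1..8}" "g = quat_g m" by (rule quats_eq_quat_g[OF assms(4)])
  obtain n where n: "n \<in> {1..8}" "h = quat_g n" by (rule quats_eq_quat_g[OF h(1)])
  have flip: "y t = y s \<otimes> \<phi> h \<longleftrightarrow> y s = y t \<otimes> \<phi> g" if "y \<in> {1..3} \<rightarrow> carrier R" for y
    using that assms h by (intro eq_mult_\<phi>_inverse) auto
  have "s = 1 \<and> t = 2 \<or> s = 2 \<and> t = 3 \<or> s = 3 \<and> t = 1 \<or> s = 2 \<and> t = 1 \<or> s = 3 \<and> t = 2 \<or> s = 1 \<and> t = 3"
    using assms(1-3) by (auto simp: atLeastAtMost_1_3)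
  then consider "s = 1" "t = 2" | "s = 2" "t = 3" | "s = 3" "t = 1" | "s = 2" "t = 1" | "s = 3" "t = 2" | "s = 1" "t = 3"
    by blast
  then show ?thesis
  proof cases
    case 1 then show ?thesis using that[of "Elt_a m"] m Q3_row_zero_iff by simp
  next
    case 2 then show ?thesis using that[of "Elt_b m"] m Q3_row_zero_iff by simp
  next
    case 3 then show ?thesis using that[of "Elt_c m"] m Q3_row_zero_iff by simp
  next
    case 4 then show ?thesis using that[of "Elt_a n"] n Q3_row_zero_iff flip by simp
  next
    case 5 then show ?thesis using that[of "Elt_b n"] n Q3_row_zero_iff flip by simp
  next
    case 6 then show ?thesis using that[of "Elt_c n"] n Q3_row_zero_iff flip by simp
  qed
qed

text \<open>Each entry compares two elements of \<open>quats0\<close>, which is closed under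
  multiplication, so the same pair \<open>g\<close>, \<open>h\<close> describes the entry over
  \<open>R\<close> and over the quaternions. Hence zeros transfer and all other entries are
  units.\<close>

lemma Q3_row_of_quats0:
  assumes y: "y \<in> {1..3} \<rightarrow> quats0" and e: "e \<in> Q3_ground"
  obtains g h where "g \<in> quats0" "h \<in> quats0" "Q3_row R \<phi> (\<phi> \<circ> y) e = \<phi> g \<ominus> \<phi> h"
    "Q3_row quaternions id y e = g - h"
proof -
  have y': "y t \<in> quats0" if "t \<in> {1..3}" for t using y that by auto
  have g: "quat_g m \<in> quats0" if "m \<in> {1..8}" for m using quat_g_in_quats[OF that] by (simp add: quats0_def)
  have 0: "0 \<in> quats0" by (simp add: quats0_def)
  from e show ?thesis
  proof (cases rule: Q3_ground_cases)
    case (1 t)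
    then show ?thesis using that[OF y' 0] y' \<phi>_closed by (simp add: \<phi>_zero minus_eq)
  next
    case (2 m)
    then show ?thesis
      using that[OF quats0_mult[OF y'[of 2] g[of m]] y'[of 1]] y' g by (simp add: \<phi>_mult)
  next
    case (3 m)
    then show ?thesis
      using that[OF quats0_mult[OF y'[of 3] g[of m]] y'[of 2]] y' g by (simp add: \<phi>_mult)
  next
    case (4 m)
    then show ?thesis
      using that[OF quats0_mult[OF y'[of 1] g[of m]] y'[of 3]] y' g by (simp add: \<phi>_mult)
  qed
qed

end

interpretation HG: quaternion_group_ring quaternions id
  by unfold_locales (auto simp: H.Units_eq quat_1_def zero_prod_def)

lemma (in quaternion_group_ring) Q3_row_zero_transfer:
  assumes "y \<in> {1..3} \<rightarrow> quats0" "e \<in> Q3_ground"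
  shows "Q3_row R \<phi> (\<phi> \<circ> y) e = \<zero> \<longleftrightarrow> Q3_row quaternions id y e = 0"
    and "Q3_row R \<phi> (\<phi> \<circ> y) e \<in> Units R \<union> {\<zero>}"
proof -
  obtain g h where gh: "g \<in> quats0" "h \<in> quats0" "Q3_row R \<phi> (\<phi> \<circ> y) e = \<phi> g \<ominus> \<phi> h"
    "Q3_row quaternions id y e = g - h"
    by (rule Q3_row_of_quats0[OF assms])
  then show "Q3_row R \<phi> (\<phi> \<circ> y) e = \<zero> \<longleftrightarrow> Q3_row quaternions id y e = 0"
    by (simp add: \<phi>_diff_eq_zero_iff)
  show "Q3_row R \<phi> (\<phi> \<circ> y) e \<in> Units R \<union> {\<zero>}"
    using \<phi>_diff_eq_zero_iff[OF gh(1,2)] \<phi>_diff[OF gh(1,2)] gh(3) by auto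
qed

text \<open>
  Relative to a fixed nonzero coordinate, record the ratio of each coordinate if it lies in the
  group and \<open>0\<close> otherwise. Every column of the matrix relates two coordinates by a group element,
  so no zero of the chain is lost.
\<close>
lemma (in quaternion_group_ring) Q3_row_reduce:
  assumes y: "y \<in> {1..3} \<rightarrow> carrier R" and t: "t \<in> {1..3}" "y t \<noteq> \<zero>"
  obtains y' where "y' \<in> {1..3} \<rightarrow> quats0" "y' t \<noteq> 0"
    "\<And>e. e \<in> Q3_ground \<Longrightarrow> Q3_row R \<phi> y e = \<zero> \<Longrightarrow> Q3_row quaternions id y' e = 0"
proof -
  note [simp del] = split_paired_Ex split_paired_All
  have yc: "y s \<in> carrier R" if "s \<in> {1..3}" for s using y that by auto
  define P where "P w g \<longleftrightarrow> g \<in> quats0 \<and> w = y t \<otimes> \<phi> g" for w g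
  \<comment> \<open>Uniqueness of the ratio is \<open>\<phi>_cancel\<close>. The default 0 agrees
    with the ratio of a zero coordinate.\<close>
  define r where "r w = (if \<exists>g. P w g then THE g. P w g else 0)" for w
  have r_eq: "r w = g" if "P w g" for w g
  proof -
    have "(THE g. P w g) = g"
      using that \<phi>_cancel[OF yc[OF t(1)] t(2)] unfolding P_def by (intro the_equality) auto
    then show ?thesis using that by (auto simp: r_def)
  qed
  have r_quats0: "r w \<in> quats0" for w
  proof (cases "\<exists>g. P w g")
    case True
    then obtain g where "P w g" by blast
    then show ?thesis using r_eq[of w g] by (simp add: P_def)
  qed (simp add: r_def quats0_def)
  \<comment> \<open>The default is compatible with the columns: a ratio outside
    \<open>quats0\<close> stays outside after multiplication by a group element, because that
    element has an inverse in G. Then both sides are 0.\<close>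
  have r_mult: "r w = quat_mult (r z) g" if g: "g \<in> quats" and z: "z \<in> carrier R" and w: "w = z \<otimes> \<phi> g" for w z g
  proof (cases "\<exists>k. P z k")
    case True
    then obtain k where k: "P z k" by blast
    have "g \<in> quats0" using g by (simp add: quats0_def)
    then have "P w (quat_mult k g)"
      using k w yc[OF t(1)] by (simp add: P_def quats0_mult \<phi>_mult \<phi>_closed m_assoc)
    then show ?thesis using r_eq k by metis
  next
    case False
    obtain h where h: "h \<in> quats" "quat_mult g h = quat_1" "quat_mult h g = quat_1"
      by (rule quats_inverse[OF g])
    have gh: "g \<in> quats0" "h \<in> quats0" using g h by (simp_all add: quats0_def)
    have z_eq: "z = w \<otimes> \<phi> h"
      using eq_mult_\<phi>_inverse[of w z g h] w z g h gh \<phi>_closed by auto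
    have "\<not> (\<exists>k. P w k)"
    proof
      assume "\<exists>k. P w k"
      then obtain k where "P w k" by blast
      then have "P z (quat_mult k h)"
        using z_eq gh yc[OF t(1)] by (simp add: P_def quats0_mult \<phi>_mult \<phi>_closed m_assoc)
      then show False using False by blast
    qed
    then show ?thesis using False by (simp add: r_def)
  qed
  show ?thesis
  proof (rule that[of "\<lambda>s. r (y s)"])
    show "(\<lambda>s. r (y s)) \<in> {1..3} \<rightarrow> quats0" using r_quats0 by simp
    have "P (y t) quat_1"
      using yc[OF t(1)] quat_1_in_quats by (simp add: P_def \<phi>_one quats0_def)
    then have "r (y t) = quat_1" by (rule r_eq)
    then show "r (y t) \<noteq> 0" using H.one_neq_zero by simp
  next
    fix e assume e: "e \<in> Q3_ground" and zero: "Q3_row R \<phi> y e = \<zero>"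
    have "P \<zero> 0" using yc[OF t(1)] by (simp add: P_def quats0_def \<phi>_zero)
    then have r0: "r \<zero> = 0" by (rule r_eq)
    from e show "Q3_row quaternions id (\<lambda>s. r (y s)) e = 0"
    proof (cases rule: Q3_ground_cases)
      case (1 s)
      then show ?thesis using zero r0 by simp
    next
      case (2 m)
      have "y 1 = y 2 \<otimes> \<phi> (quat_g m)" using zero Q3_row_zero_iff[OF y 2(1)] 2 by blast
      then have "r (y 1) = quat_mult (r (y 2)) (quat_g m)"
        by (intro r_mult quat_g_in_quats 2 yc) simp_all
      then show ?thesis using 2 by simp
    next
      case (3 m)
      have "y 2 = y 3 \<otimes> \<phi> (quat_g m)" using zero Q3_row_zero_iff[OF y 3(1)] 3 by blast
      then have "r (y 2) = quat_mult (r (y 3)) (quat_g m)"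
        by (intro r_mult quat_g_in_quats 3 yc) simp_all
      then show ?thesis using 3 by simp
    next
      case (4 m)
      have "y 3 = y 1 \<otimes> \<phi> (quat_g m)" using zero Q3_row_zero_iff[OF y 4(1)] 4 by blast
      then have "r (y 3) = quat_mult (r (y 1)) (quat_g m)"
        by (intro r_mult quat_g_in_quats 4 yc) simp_all
      then show ?thesis using 4 by simp
    qed
  qed
qed

text \<open>Each further nonzero coordinate of \<open>y\<close> is tied to \<open>y t\<close> by a
  column on which \<open>y\<close> vanishes, and each zero coordinate is witnessed by a unit column.
  As \<open>y'\<close> vanishes there too, all its coordinates follow from \<open>y' t\<close>, and
  \<open>k\<close> is \<open>y' t\<close> times the inverse of \<open>y t\<close>. This is what
  makes the supports minimal.\<close>

lemma Q3_row_proportional: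
  assumes y: "y \<in> {1..3} \<rightarrow> quats0" "t \<in> {1..3}" "y t \<noteq> 0"
    and zero: "\<And>e. e \<in> Q3_ground \<Longrightarrow> Q3_row quaternions id y e = 0 \<Longrightarrow> Q3_row quaternions id y' e = 0"
  shows "\<exists>k. \<forall>s\<in>{1..3}. y' s = quat_mult k (y s)"
proof -
  have "y t \<in> quats" using y by (auto simp: quats0_def Pi_iff)
  then obtain h where h: "h \<in> quats" "quat_mult (y t) h = quat_1" "quat_mult h (y t) = quat_1"
    by (rule quats_inverse)
  have "y' s = quat_mult (quat_mult (y' t) h) (y s)" if s: "s \<in> {1..3}" for s
  proof -
    have "y s \<in> quats0" using y(1) s by (rule funcset_mem)
    then consider "s = t" | "y s = 0" | "s \<noteq> t" "y s \<in> quats"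
      unfolding quats0_def by blast
    then show ?thesis
    proof cases
      case 1
      then show ?thesis using h by (simp add: quat_mult_assoc)
    next
      case 2
      then show ?thesis using zero[of "Elt_e s"] s by simp
    next
      case 3
      obtain e where e: "e \<in> Q3_ground"
        "\<forall>z\<in>{1..3} \<rightarrow> carrier quaternions.
          Q3_row quaternions id z e = \<zero>\<^bsub>quaternions\<^esub> \<longleftrightarrow> z s = z t \<otimes>\<^bsub>quaternions\<^esub> id (quat_mult h (y s))"
        by (rule HG.Q3_row_links[OF s y(2) 3(1) quats_mult[OF h(1) 3(2)]])
      then have e': "Q3_row quaternions id z e = 0 \<longleftrightarrow> z s = quat_mult (z t) (quat_mult h (y s))" for z
        by simp
      have "Q3_row quaternions id y e = 0"
        using h unfolding e' by (simp flip: quat_mult_assoc)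
      then have "Q3_row quaternions id y' e = 0" by (rule zero[OF e(1)])
      then show ?thesis unfolding e' by (simp add: quat_mult_assoc)
    qed
  qed
  then show ?thesis by blast
qed

definition Q3_support :: "(nat \<Rightarrow> quat) \<Rightarrow> dowling_elt set" where
  "Q3_support y = {e \<in> Q3_ground. Q3_row quaternions id y e \<noteq> 0}"

lemma quat_mult_diff_right: "quat_mult k (p - q) = quat_mult k p - quat_mult k q"
  by (cases k; cases p; cases q) (simp add: algebra_simps)

lemma Q3_row_scale:
  assumes "e \<in> Q3_ground" and "\<And>s. s \<in> {1..3} \<Longrightarrow> y' s = quat_mult k (y s)"
  shows "Q3_row quaternions id y' e = quat_mult k (Q3_row quaternions id y e)"
  using assms(1)
  by (cases rule: Q3_ground_cases) (simp_all add: assms(2) quat_mult_assoc quat_mult_diff_right)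

interpretation Q3: skew_field_matrix quaternions "{1..3}" Q3_ground "\<lambda>t e. Q3_column e ! (t - 1)"
  by unfold_locales (simp_all add: finite_Q3_ground)

lemma Q3_is_matroid: "is_matroid Q3_quaternion"
  unfolding Q3_quaternion_def by (rule Q3.matroid)

lemma ground_Q3: "ground Q3_quaternion = Q3_ground"
  by (simp add: Q3_quaternion_def matrix_matroid_def)

lemma Q3_matrix_row:
  assumes "e \<in> Q3_ground"
  shows "Q3.row y e = Q3_row quaternions id y e"
proof -
  have neg: "quat_mult q (- quat_1) = - q" for q
    by (cases q) (simp add: quat_1_def)
  have "Q3.row y e = (\<Oplus>\<^bsub>quaternions\<^esub>t\<in>{1..3}. y t \<otimes>\<^bsub>quaternions\<^esub> Q3_column e ! (t - 1))"
    by (rule Q3.row_def)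
  also have "\<dots> = quat_mult (y 1) (Q3_column e ! 0) + (quat_mult (y 2) (Q3_column e ! 1) + quat_mult (y 3) (Q3_column e ! 2))"
    by (subst H.finsum_1_3) simp_all
  also have "\<dots> = Q3_row quaternions id y e"
    using assms
  proof (cases rule: Q3_ground_cases)
    case (1 t)
    then have "t = 1 \<or> t = 2 \<or> t = 3" by auto
    then show ?thesis using 1 by (elim disjE) simp_all
  qed (simp_all add: neg)
  finally show ?thesis .
qed

text \<open>Passing to ratios in G shows that a minimal support comes from a vector over
  \<open>quats0\<close>. Conversely proportionality makes every such support minimal, since a
  nonzero left factor over the quaternions changes no support.\<close>

lemma cocircuits_Q3:
  "cocircuits Q3_quaternion = {Q3_support y | y. y \<in> {1..3} \<rightarrow> quats0 \<and> (\<exists>t\<in>{1..3}. y t \<noteq> 0)}"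
    (is "_ = ?S")
proof -
  let ?T = "{Q3_support y | y. \<exists>t\<in>{1..3}. y t \<noteq> 0}"
  have supp: "{e \<in> Q3_ground. Q3.row y e \<noteq> \<zero>\<^bsub>quaternions\<^esub>} = Q3_support y" for y
    unfolding Q3_support_def by (intro Collect_cong conj_cong refl) (simp only: Q3_matrix_row quaternions_simps)
  have "\<forall>y\<in>{1..3} \<rightarrow> carrier quaternions. (\<forall>e\<in>Q3_ground. Q3.row y e = \<zero>\<^bsub>quaternions\<^esub>) \<longrightarrow>
      (\<forall>t\<in>{1..3}. y t = \<zero>\<^bsub>quaternions\<^esub>)"
  proof (intro ballI impI)
    fix y t assume "\<forall>e\<in>Q3_ground. Q3.row y e = \<zero>\<^bsub>quaternions\<^esub>" "t \<in> {1..3::nat}"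
    then have "Q3_row quaternions id y (Elt_e t) = \<zero>\<^bsub>quaternions\<^esub>" 
      using Q3_matrix_row[of "Elt_e t" y] by (metis Q3_ground_simps(1))
    then show "y t = \<zero>\<^bsub>quaternions\<^esub>" by simp
  qed
  from Q3.cocircuits_eq_minimal_row_supports[OF this]
  have eq: "cocircuits Q3_quaternion = {S \<in> ?T. \<forall>S'\<in>?T. S' \<subseteq> S \<longrightarrow> S' = S}"
    unfolding Q3_quaternion_def supp by simp
  show ?thesis
  proof (rule subset_antisym; rule subsetI)
    fix D assume "D \<in> cocircuits Q3_quaternion"
    then have "D \<in> ?T" and min: "\<And>S'. S' \<in> ?T \<Longrightarrow> S' \<subseteq> D \<Longrightarrow> S' = D" unfolding eq by auto
    then obtain y t where D: "D = Q3_support y" and t: "t \<in> {1..3}" "y t \<noteq> 0" by blast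
    have "y \<in> {1..3} \<rightarrow> carrier quaternions" "y t \<noteq> \<zero>\<^bsub>quaternions\<^esub>" using t by simp_all
    then obtain y' where y': "y' \<in> {1..3} \<rightarrow> quats0" "y' t \<noteq> 0"
      and "\<And>e. e \<in> Q3_ground \<Longrightarrow> Q3_row quaternions id y e = \<zero>\<^bsub>quaternions\<^esub> \<Longrightarrow> Q3_row quaternions id y' e = 0"
      using HG.Q3_row_reduce[OF _ t(1)] by metis
    then have sub: "Q3_support y' \<subseteq> D" unfolding D Q3_support_def by auto
    have "Q3_support y' \<in> ?T" using y' t(1) by blast
    then have "Q3_support y' = D" using sub by (rule min)
    moreover have "Q3_support y' \<in> ?S" using y' t(1) by blast
    ultimately show "D \<in> ?S" by simp
  next
    fix D assume "D \<in> ?S"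
    then obtain y t where D: "D = Q3_support y" and y: "y \<in> {1..3} \<rightarrow> quats0" and t: "t \<in> {1..3}" "y t \<noteq> 0" by blast
    have "S' = D" if S': "S' \<in> ?T" "S' \<subseteq> D" for S'
    proof -
      obtain y' s where y': "S' = Q3_support y'" "s \<in> {1..3}" "y' s \<noteq> 0" using S'(1) by blast
      have zero: "Q3_row quaternions id y' e = 0"
        if "e \<in> Q3_ground" "Q3_row quaternions id y e = 0" for e
        using S'(2) that unfolding D y'(1) Q3_support_def by blast
      obtain k where "\<forall>s\<in>{1..3}. y' s = quat_mult k (y s)"
        using Q3_row_proportional[OF y t zero] by blast
      then have k: "y' s = quat_mult k (y s)" if "s \<in> {1..3}" for s using that by blast
      have "k \<noteq> 0" using k[OF y'(2)] y'(3) by auto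
      then have "Q3_row quaternions id y' e = 0 \<longleftrightarrow> Q3_row quaternions id y e = 0" if "e \<in> Q3_ground" for e
        using Q3_row_scale[OF that k] H.mult_eq_zero_iff[of k "Q3_row quaternions id y e"] by simp
      then show ?thesis unfolding y'(1) D Q3_support_def by (intro Collect_cong) auto
    qed
    moreover have "D \<in> ?T" using D t by blast
    ultimately show "D \<in> cocircuits Q3_quaternion" unfolding eq by simp
  qed
qed

section \<open>A representation over algebras of characteristic 3\<close>

lemma zero_chain_iff_support_empty:
  assumes "c \<in> E \<rightarrow>\<^sub>E carrier R"
  shows "c = zero_chain R E \<longleftrightarrow> chain_support R E c = {}"
proof
  assume "chain_support R E c = {}"
  then show "c = zero_chain R E"
    using assms unfolding chain_support_def zero_chain_def
    by (intro extensionalityI[of _ E]) (auto simp: PiE_def)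
qed (simp add: chain_support_def zero_chain_def)

text \<open>The squeeze of \<open>cocircuits_eq_minimal\<close> on the side of chains: supports of
  nonzero chains contain cocircuits, and cocircuits are supports of chains, so the minimal supports
  are the cocircuits. Zero divisors do no harm, because an elementary chain is only ever divided by
  a unit entry of a primitive chain with the same support.\<close>

lemma (in ring) representable_over_units:
  assumes C: "chain_group R E C" and M: "is_matroid M" "ground M = E"
    and contains: "\<And>c. c \<in> C \<Longrightarrow> c \<noteq> zero_chain R E \<Longrightarrow> \<exists>D\<in>cocircuits M. D \<subseteq> chain_support R E c"
    and primitive: "\<And>D. D \<in> cocircuits M \<Longrightarrow> D \<noteq> {} \<and> (\<exists>d\<in>C. primitive R (Units R) E d \<and> chain_support R E d = D)"
  shows "representable_over_partial_field M R (Units R)"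
proof -
  have CE: "c \<in> E \<rightarrow>\<^sub>E carrier R" if "c \<in> C" for c using C that unfolding chain_group_def by blast
  have el: "chain_support R E c \<in> cocircuits M" if c: "elementary R E C c" for c
  proof -
    have "c \<in> C" "c \<noteq> zero_chain R E" using c by (simp_all add: elementary_def)
    then obtain D where D: "D \<in> cocircuits M" "D \<subseteq> chain_support R E c" using contains by blast
    obtain d where d: "d \<in> C" "chain_support R E d = D" "D \<noteq> {}" using primitive[OF D(1)] by blast
    then have "d \<noteq> zero_chain R E" using zero_chain_iff_support_empty[OF CE[OF d(1)]] by simp
    then have "\<not> D \<subset> chain_support R E c" using c d unfolding elementary_def by auto
    then have "D = chain_support R E c" using D(2) by simp
    then show ?thesis using D(1) by simp
  qed
  have el': "elementary R E C d" if D: "chain_support R E d \<in> cocircuits M" and d: "d \<in> C" for d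
    unfolding elementary_def
  proof (intro conjI notI)
    assume "d = zero_chain R E"
    then show False using zero_chain_iff_support_empty[OF CE[OF d]] primitive[OF D] by simp
  next
    assume "\<exists>d'\<in>C. d' \<noteq> zero_chain R E \<and> chain_support R E d' \<subset> chain_support R E d"
    then obtain d' where d': "d' \<in> C" "d' \<noteq> zero_chain R E" "chain_support R E d' \<subset> chain_support R E d"
      by blast
    obtain D' where "D' \<in> cocircuits M" "D' \<subseteq> chain_support R E d'" using contains[OF d'(1,2)] by blast
    then show False using cocircuit_psubset[OF D, of D'] d'(3) by auto
  qed (rule d)
  have "cocircuits M = chain_support R E ` {c. elementary R E C c}"
  proof (rule subset_antisym; rule subsetI)
    fix D assume D: "D \<in> cocircuits M"
    then obtain d where "d \<in> C" "chain_support R E d = D" using primitive by blast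
    then show "D \<in> chain_support R E ` {c. elementary R E C c}" using el'[of d] D by auto
  qed (use el in auto)
  then have "is_matroid_of_chain_group R E C M"
    using M by (simp add: is_matroid_of_chain_group_def)
  moreover have "\<exists>r\<in>carrier R. \<exists>d\<in>C. primitive R (Units R) E d \<and> c = (\<lambda>e\<in>E. r \<otimes> d e)"
    if c: "elementary R E C c" for c
  proof -
    obtain d where d: "d \<in> C" "primitive R (Units R) E d" "chain_support R E d = chain_support R E c"
      "chain_support R E c \<noteq> {}" using primitive[OF el[OF c]] by blast
    have cC: "c \<in> C" using c by (simp add: elementary_def)
    have cc: "c x \<in> carrier R" and dc: "d x \<in> carrier R" if "x \<in> E" for x
      using CE[OF cC] CE[OF d(1)] that by auto
    obtain e where e: "e \<in> E" "c e \<noteq> \<zero>" "d e \<noteq> \<zero>"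
      using d(3,4) unfolding chain_support_def by blast
    then have u: "d e \<in> Units R" using d(2) unfolding primitive_def by auto
    \<comment> \<open>Chosen so that \<open>c\<close> minus \<open>r\<close> times \<open>d\<close>
      vanishes at \<open>e\<close>. The support of the difference is then properly inside that of
      \<open>c\<close>, and \<open>c\<close> is elementary.\<close>
    define r where "r = c e \<otimes> inv (d e)"
    have r: "r \<in> carrier R" "r \<otimes> d e = c e" using u cc[OF e(1)] by (simp_all add: r_def m_assoc Units_closed)
    define c' where "c' = (\<lambda>x\<in>E. c x \<oplus> (\<lambda>x\<in>E. (\<ominus> r) \<otimes> d x) x)"
    have c': "c' \<in> C" using C cC d(1) r(1) unfolding c'_def chain_group_def by blast
    have c'_eq: "c' x = c x \<ominus> r \<otimes> d x" if "x \<in> E" for x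
      using that cc[OF that] dc[OF that] r(1) by (simp add: c'_def l_minus minus_eq)
    have "c' x = \<zero>" if "x \<in> E" "c x = \<zero>" for x
    proof -
      have "d x = \<zero>" using that d(3) unfolding chain_support_def by blast
      then show ?thesis using c'_eq[OF that(1)] that r(1) by (simp add: minus_eq)
    qed
    moreover have "c' e = \<zero>" using c'_eq[OF e(1)] r(2) cc[OF e(1)] by (simp add: minus_eq r_neg)
    ultimately have "chain_support R E c' \<subset> chain_support R E c"
      using e unfolding chain_support_def by blast
    then have "c' = zero_chain R E" using c c' unfolding elementary_def by blast
    then have diff: "c x \<ominus> r \<otimes> d x = \<zero>" if "x \<in> E" for x
      using c'_eq[OF that] that by (simp add: zero_chain_def)
    have "c x = r \<otimes> d x" if "x \<in> E" for x
      using diff[OF that] cc[OF that] dc[OF that] r(1) by simp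
    then have "c = (\<lambda>e\<in>E. r \<otimes> d e)"
      using CE[OF cC] by (intro extensionalityI[of _ E]) (auto simp: PiE_def)
    then show ?thesis using r(1) d(1,2) by blast
  qed
  then have "partial_field_chain_group R (Units R) E C"
    using C unfolding partial_field_chain_group_def by blast
  ultimately show ?thesis
    unfolding representable_over_partial_field_def M(2) by blast
qed

text \<open>\<open>separating\<close> provides enough additive maps to the integers mod 3, with
  values written as 0, 1, 2, to detect every nonzero element. Additivity suffices because the rows
  of \<open>R\<^sub>9\<close> only have coefficients 0, 1 and -1.\<close>

locale quaternion_group_algebra = quaternion_group_ring +
  assumes three: "x \<in> carrier R \<Longrightarrow> x \<oplus> (x \<oplus> x) = \<zero>"
    and separating: "x \<in> carrier R \<Longrightarrow> x \<noteq> \<zero> \<Longrightarrow> \<exists>l :: 'a \<Rightarrow> int. (\<forall>a\<in>carrier R. l a \<in> {0, 1, 2}) \<and>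
      (\<forall>a\<in>carrier R. \<forall>b\<in>carrier R. l (a \<oplus> b) = (l a + l b) mod 3) \<and> l x \<noteq> 0"
begin

text \<open>The embedding of GF(3), with 2 sent to -1.\<close>

definition scalar :: "int \<Rightarrow> 'a" where
  "scalar a = (if a = 0 then \<zero> else if a = 1 then \<one> else \<ominus> \<one>)"

lemma one_plus_one: "\<one> \<oplus> \<one> = \<ominus> \<one>"
  using minus_equality[of "\<one> \<oplus> \<one>" \<one>] three[of \<one>] by (simp add: a_assoc)

text \<open>Characteristic 3 makes \<open>scalar\<close> respect sums and differences mod 3. The
  chains obtained in this way have entries 0, 1 and -1 and realise the cocircuits of
  \<open>R\<^sub>9\<close>.\<close>

lemma R9_row_scalar:
  assumes y: "y \<in> {1..3} \<rightarrow> {0, 1, 2}" and i: "i \<in> {1..9}"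
  shows "R9_row R (scalar \<circ> y) i = scalar (R9_row GF3 y i)"
proof -
  have y': "y 1 \<in> {0, 1, 2}" "y 2 \<in> {0, 1, 2}" "y 3 \<in> {0, 1, 2}" using y by auto
  have add: "scalar a \<oplus> scalar b = scalar ((a + b) mod 3)" if "a \<in> {0, 1, 2}" "b \<in> {0, 1, 2}" for a b
    using that one_plus_one one_neq_zero by (auto simp: scalar_def l_neg r_neg minus_add[symmetric])
  have diff: "scalar a \<ominus> scalar b = scalar ((a - b) mod 3)" if "a \<in> {0, 1, 2}" "b \<in> {0, 1, 2}" for a b
    using that one_plus_one one_neq_zero by (auto simp: scalar_def minus_eq l_neg r_neg minus_add[symmetric])
  have mod: "a mod 3 \<in> {0, 1, 2}" for a :: int
    by auto
  from i show ?thesis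
    by (cases rule: R9_ground_cases)
      (simp_all only: R9_row_simps comp_apply add[OF y'(2,3)] add[OF y'(1,2)] add[OF y'(1,3)] add[OF y'(1) mod]
        diff[OF y'(1,2)] diff[OF y'(2,3)] GF3_add GF3_minus GF3_carrier y')
qed

text \<open>This handles chains whose entries are neither zero nor units: an additive map sends such
  a chain to a row over GF(3), whose support can only be smaller.\<close>

lemma R9_row_functional:
  assumes l: "\<forall>a\<in>carrier R. l a \<in> {0, 1, 2 :: int}"
    and l_add: "\<forall>a\<in>carrier R. \<forall>b\<in>carrier R. l (a \<oplus> b) = (l a + l b) mod 3"
    and y: "y \<in> {1..3} \<rightarrow> carrier R" and i: "i \<in> {1..9}"
  shows "R9_row GF3 (l \<circ> y) i = l (R9_row R y i)"
proof -
  have y': "y 1 \<in> carrier R" "y 2 \<in> carrier R" "y 3 \<in> carrier R" using y by auto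
  have l0: "l \<zero> = 0" using l_add[rule_format, OF zero_closed zero_closed] l[rule_format, OF zero_closed] by auto
  have lc: "l a \<in> carrier GF3" if "a \<in> carrier R" for a
    using l that unfolding GF3_carrier by blast
  have l_diff: "l (a \<ominus> b) = (l a - l b) mod 3" if ab: "a \<in> carrier R" "b \<in> carrier R" for a b
  proof -
    have "a \<ominus> b \<oplus> b = a" using ab by (simp add: minus_eq a_assoc l_neg)
    then have "l a = (l (a \<ominus> b) + l b) mod 3" using l_add ab by (metis minus_closed)
    then have "(l a - l b) mod 3 = l (a \<ominus> b) mod 3" by (simp add: mod_simps)
    also have "\<dots> = l (a \<ominus> b)" using bspec[OF l minus_closed[OF ab]] by auto
    finally show ?thesis by simp
  qed
  from i show ?thesis
    by (cases rule: R9_ground_cases)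
      (simp_all add: R9_row_simps GF3_add GF3_minus lc l_add l_diff y'[unfolded One_nat_def])
qed

section \<open>The chain group of the direct sum\<close>

definition sum_chain :: "(nat \<Rightarrow> 'a) \<Rightarrow> (nat \<Rightarrow> 'a) \<Rightarrow> nat + dowling_elt \<Rightarrow> 'a" where
  "sum_chain y z = (\<lambda>e\<in>{1..9} <+> Q3_ground. case e of Inl i \<Rightarrow> R9_row R y i | Inr d \<Rightarrow> Q3_row R \<phi> z d)"

definition sum_chains :: "(nat + dowling_elt \<Rightarrow> 'a) set" where
  "sum_chains = {sum_chain y z | y z. y \<in> {1..3} \<rightarrow> carrier R \<and> z \<in> {1..3} \<rightarrow> carrier R}"

lemma R9_row_closed:
  assumes "y \<in> {1..3} \<rightarrow> carrier R" "i \<in> {1..9}"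
  shows "R9_row R y i \<in> carrier R"
proof -
  have "y 1 \<in> carrier R" "y 2 \<in> carrier R" "y 3 \<in> carrier R" using assms(1) by auto
  with assms(2) show ?thesis
    by (cases rule: R9_ground_cases) (simp_all add: R9_row_simps)
qed

lemma R9_row_add:
  assumes "y \<in> {1..3} \<rightarrow> carrier R" "z \<in> {1..3} \<rightarrow> carrier R" "i \<in> {1..9}"
  shows "R9_row R (\<lambda>t. y t \<oplus> z t) i = R9_row R y i \<oplus> R9_row R z i"
proof -
  have "y 1 \<in> carrier R" "y 2 \<in> carrier R" "y 3 \<in> carrier R"
    "z 1 \<in> carrier R" "z 2 \<in> carrier R" "z 3 \<in> carrier R" using assms(1,2) by auto
  with assms(3) show ?thesis
    by (cases rule: R9_ground_cases) (simp_all add: R9_row_simps minus_eq minus_add a_ac)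
qed

lemma R9_row_mult:
  assumes "r \<in> carrier R" "y \<in> {1..3} \<rightarrow> carrier R" "i \<in> {1..9}"
  shows "R9_row R (\<lambda>t. r \<otimes> y t) i = r \<otimes> R9_row R y i"
proof -
  have "y 1 \<in> carrier R" "y 2 \<in> carrier R" "y 3 \<in> carrier R" using assms(2) by auto
  with assms(1) show ?thesis
    by (cases rule: R9_ground_cases[OF assms(3)]) (simp_all add: R9_row_simps minus_eq r_distr r_minus)
qed

lemma Q3_row_add:
  assumes "y \<in> {1..3} \<rightarrow> carrier R" "z \<in> {1..3} \<rightarrow> carrier R" "e \<in> Q3_ground"
  shows "Q3_row R \<phi> (\<lambda>t. y t \<oplus> z t) e = Q3_row R \<phi> y e \<oplus> Q3_row R \<phi> z e"
proof -
  have "y 1 \<in> carrier R" "y 2 \<in> carrier R" "y 3 \<in> carrier R"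
    "z 1 \<in> carrier R" "z 2 \<in> carrier R" "z 3 \<in> carrier R" using assms(1,2) by auto
  moreover have "\<phi> (quat_g m) \<in> carrier R" if "m \<in> {1..8}" for m
    using \<phi>_closed quat_g_in_quats[OF that] by (simp add: quats0_def)
  ultimately show ?thesis
    by (cases rule: Q3_ground_cases[OF assms(3)]) (simp_all add: minus_eq minus_add l_distr a_ac)
qed

lemma Q3_row_mult:
  assumes "r \<in> carrier R" "y \<in> {1..3} \<rightarrow> carrier R" "e \<in> Q3_ground"
  shows "Q3_row R \<phi> (\<lambda>t. r \<otimes> y t) e = r \<otimes> Q3_row R \<phi> y e"
proof -
  have "y 1 \<in> carrier R" "y 2 \<in> carrier R" "y 3 \<in> carrier R" using assms(2) by auto
  moreover have "\<phi> (quat_g m) \<in> carrier R" if "m \<in> {1..8}" for m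
    using \<phi>_closed quat_g_in_quats[OF that] by (simp add: quats0_def)
  ultimately show ?thesis using assms(1)
    by (cases rule: Q3_ground_cases[OF assms(3)]) (simp_all add: minus_eq r_distr r_minus m_assoc)
qed

lemma zero_rows:
  "i \<in> {1..9} \<Longrightarrow> R9_row R (\<lambda>_. \<zero>) i = \<zero>" "e \<in> Q3_ground \<Longrightarrow> Q3_row R \<phi> (\<lambda>_. \<zero>) e = \<zero>"
  using R9_row_mult[of \<zero> "\<lambda>_. \<zero>" i] R9_row_closed[of "\<lambda>_. \<zero>" i]
    Q3_row_mult[of \<zero> "\<lambda>_. \<zero>" e] Q3_row_closed[of "\<lambda>_. \<zero>" e] by auto

lemma sum_chains_chain_group: "chain_group R ({1..9} <+> Q3_ground) sum_chains"
  unfolding chain_group_def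
proof (intro conjI ballI)
  show "finite ({1..9::nat} <+> Q3_ground)" using finite_Q3_ground by simp
  show "sum_chains \<subseteq> ({1..9} <+> Q3_ground) \<rightarrow>\<^sub>E carrier R"
    using R9_row_closed Q3_row_closed by (auto simp: sum_chains_def sum_chain_def)
  have "zero_chain R ({1..9} <+> Q3_ground) = sum_chain (\<lambda>_. \<zero>) (\<lambda>_. \<zero>)"
    unfolding zero_chain_def sum_chain_def using zero_rows by (intro restrict_ext) auto
  then show "zero_chain R ({1..9} <+> Q3_ground) \<in> sum_chains" unfolding sum_chains_def by blast
next
  fix c d assume "c \<in> sum_chains" "d \<in> sum_chains"
  then obtain y z y' z' where c: "c = sum_chain y z" "y \<in> {1..3} \<rightarrow> carrier R" "z \<in> {1..3} \<rightarrow> carrier R"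
    and d: "d = sum_chain y' z'" "y' \<in> {1..3} \<rightarrow> carrier R" "z' \<in> {1..3} \<rightarrow> carrier R"
    unfolding sum_chains_def by blast
  have "(\<lambda>e\<in>{1..9} <+> Q3_ground. c e \<oplus> d e) = sum_chain (\<lambda>t. y t \<oplus> y' t) (\<lambda>t. z t \<oplus> z' t)"
    unfolding c(1) d(1) sum_chain_def using R9_row_add[OF c(2) d(2)] Q3_row_add[OF c(3) d(3)]
    by (intro restrict_ext) auto
  moreover have "(\<lambda>t. y t \<oplus> y' t) \<in> {1..3} \<rightarrow> carrier R" "(\<lambda>t. z t \<oplus> z' t) \<in> {1..3} \<rightarrow> carrier R"
    using c d by auto
  ultimately show "(\<lambda>e\<in>{1..9} <+> Q3_ground. c e \<oplus> d e) \<in> sum_chains" unfolding sum_chains_def by blast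
next
  fix r c assume r: "r \<in> carrier R" and "c \<in> sum_chains"
  then obtain y z where c: "c = sum_chain y z" "y \<in> {1..3} \<rightarrow> carrier R" "z \<in> {1..3} \<rightarrow> carrier R"
    unfolding sum_chains_def by blast
  have "(\<lambda>e\<in>{1..9} <+> Q3_ground. r \<otimes> c e) = sum_chain (\<lambda>t. r \<otimes> y t) (\<lambda>t. r \<otimes> z t)"
    unfolding c(1) sum_chain_def using R9_row_mult[OF r c(2)] Q3_row_mult[OF r c(3)]
    by (intro restrict_ext) auto
  moreover have "(\<lambda>t. r \<otimes> y t) \<in> {1..3} \<rightarrow> carrier R" "(\<lambda>t. r \<otimes> z t) \<in> {1..3} \<rightarrow> carrier R"
    using c r by auto
  ultimately show "(\<lambda>e\<in>{1..9} <+> Q3_ground. r \<otimes> c e) \<in> sum_chains" unfolding sum_chains_def by blast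
qed

lemma sum_chain_support:
  "chain_support R ({1..9} <+> Q3_ground) (sum_chain y z) =
    {i \<in> {1..9}. R9_row R y i \<noteq> \<zero>} <+> {e \<in> Q3_ground. Q3_row R \<phi> z e \<noteq> \<zero>}"
  by (auto simp: chain_support_def sum_chain_def)

theorem representable:
  "representable_over_partial_field (R9 \<oplus>\<^sub>M Q3_quaternion) R (Units R)"
proof (rule representable_over_units)
  let ?E = "{1..9::nat} <+> Q3_ground"
  show ground: "ground (R9 \<oplus>\<^sub>M Q3_quaternion) = ?E"
    by (simp add: direct_sum_def ground_R9 ground_Q3)
  show "chain_group R ?E sum_chains" by (rule sum_chains_chain_group)
  show "is_matroid (R9 \<oplus>\<^sub>M Q3_quaternion)"
    by (rule is_matroid_direct_sum[OF R9_is_matroid Q3_is_matroid])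
  note coc = cocircuits_direct_sum[OF R9_is_matroid Q3_is_matroid]
  show "\<exists>D\<in>cocircuits (R9 \<oplus>\<^sub>M Q3_quaternion). D \<subseteq> chain_support R ?E c"
    if c: "c \<in> sum_chains" "c \<noteq> zero_chain R ?E" for c
  proof -
    obtain y z where yz: "c = sum_chain y z" "y \<in> {1..3} \<rightarrow> carrier R" "z \<in> {1..3} \<rightarrow> carrier R"
      using c(1) unfolding sum_chains_def by blast
    have "\<exists>t\<in>{1..3}. y t \<noteq> \<zero> \<or> z t \<noteq> \<zero>"
    proof (rule ccontr)
      assume "\<not> ?thesis"
      then have 0: "y t = \<zero>" "z t = \<zero>" if "t \<in> {1..3}" for t using that by auto
      have "R9_row R y i = \<zero>" if "i \<in> {1..9}" for i
      proof -
        have "R9_row R y i = R9_row R (\<lambda>_. \<zero>) i"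
          using 0(1)[of 1] 0(1)[of 2] 0(1)[of 3] by (simp add: R9_row_def)
        then show ?thesis using zero_rows(1)[OF that] by simp
      qed
      moreover have "Q3_row R \<phi> z e = \<zero>" if "e \<in> Q3_ground" for e
      proof -
        have "Q3_row R \<phi> z e = Q3_row R \<phi> (\<lambda>_. \<zero>) e"
          using that 0(2) by (cases rule: Q3_ground_cases) simp_all
        then show ?thesis using zero_rows(2)[OF that] by simp
      qed
      ultimately have "c = zero_chain R ?E"
        unfolding yz(1) sum_chain_def zero_chain_def by (intro restrict_ext) auto
      then show False using c(2) by simp
    qed
    then consider t where "t \<in> {1..3}" "y t \<noteq> \<zero>" | t where "t \<in> {1..3}" "z t \<noteq> \<zero>" by blast
    then show ?thesis
    proof cases
      case (1 t)
      then have "y t \<in> carrier R" using yz(2) by auto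
      \<comment> \<open>A map that does not vanish at \<open>y t\<close> keeps the vector over GF(3)
        from collapsing to zero.\<close>
      then obtain l :: "'a \<Rightarrow> int" where l: "\<forall>a\<in>carrier R. l a \<in> {0, 1, 2}"
        "\<forall>a\<in>carrier R. \<forall>b\<in>carrier R. l (a \<oplus> b) = (l a + l b) mod 3" "l (y t) \<noteq> 0"
        using separating[of "y t"] 1(2) by blast
      have "l \<circ> y \<in> {1..3} \<rightarrow> {0, 1, 2}" using l(1) yz(2) by (auto simp: Pi_iff)
      moreover have "(l \<circ> y) t \<noteq> 0" using l(3) by simp
      ultimately have "R9_support (l \<circ> y) \<in> R9_supports"
        using 1(1) unfolding R9_supports_def by blast
      then obtain D where D: "D \<in> cocircuits R9" "D \<subseteq> R9_support (l \<circ> y)"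
        by (rule R9_support_contains_cocircuit)
      have "l \<zero> = 0"
        using l(2)[rule_format, OF zero_closed zero_closed] l(1)[rule_format, OF zero_closed] by auto
      then have "D \<subseteq> {i \<in> {1..9}. R9_row R y i \<noteq> \<zero>}"
        using D(2) R9_row_functional[OF l(1,2) yz(2)] unfolding R9_support_def by auto
      then have "Inl ` D \<subseteq> chain_support R ?E c" unfolding yz(1) sum_chain_support by auto
      then show ?thesis using D(1) unfolding coc by blast
    next
      case (2 t)
      obtain z' where z': "z' \<in> {1..3} \<rightarrow> quats0" "z' t \<noteq> 0"
        "\<And>e. e \<in> Q3_ground \<Longrightarrow> Q3_row R \<phi> z e = \<zero> \<Longrightarrow> Q3_row quaternions id z' e = 0"
        using Q3_row_reduce[OF yz(3) 2] by metis
      have "Q3_support z' \<in> cocircuits Q3_quaternion" using z' 2(1) unfolding cocircuits_Q3 by blast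
      moreover have "Inr ` Q3_support z' \<subseteq> chain_support R ?E c"
        unfolding yz(1) sum_chain_support Q3_support_def using z'(3) by auto
      ultimately show ?thesis unfolding coc by blast
    qed
  qed
  show "D \<noteq> {} \<and> (\<exists>d\<in>sum_chains. primitive R (Units R) ?E d \<and> chain_support R ?E d = D)"
    if D: "D \<in> cocircuits (R9 \<oplus>\<^sub>M Q3_quaternion)" for D
  proof -
    from D consider D' where "D' \<in> cocircuits R9" "D = Inl ` D'"
      | D' where "D' \<in> cocircuits Q3_quaternion" "D = Inr ` D'"
      unfolding coc by blast
    then show ?thesis
    proof cases
      case (1 D')
      then have "D' \<in> R9_supports" unfolding cocircuits_R9 by blast
      then obtain y t where y: "D' = R9_support y" "y \<in> {1..3} \<rightarrow> {0, 1, 2}" "t \<in> {1..3}" "y t \<noteq> 0"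
        unfolding R9_supports_def by blast
      note row = R9_row_scalar[OF y(2)]
      have sc: "scalar a \<in> Units R \<union> {\<zero>}" "scalar a \<in> carrier R" "scalar a = \<zero> \<longleftrightarrow> a = 0" for a
        using one_neq_zero by (auto simp: scalar_def)
      have "R9_row GF3 y t \<noteq> 0" using y(3,4) unfolding atLeastAtMost_1_3 by (auto simp: R9_row_simps)
      then have "t \<in> D'" using y(1,3) by (auto simp: R9_support_def)
      moreover have "scalar \<circ> y \<in> {1..3} \<rightarrow> carrier R" using sc(2) by simp
      moreover have "chain_support R ?E (sum_chain (scalar \<circ> y) (\<lambda>_. \<zero>)) = D"
        unfolding sum_chain_support using row sc(3) zero_rows(2)
        by (auto simp: 1(2) y(1) R9_support_def)
      moreover have "primitive R (Units R) ?E (sum_chain (scalar \<circ> y) (\<lambda>_. \<zero>))"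
        unfolding primitive_def
      proof
        fix e :: "nat + dowling_elt" assume "e \<in> ?E"
        then show "sum_chain (scalar \<circ> y) (\<lambda>_. \<zero>) e \<in> Units R \<union> {\<zero>}"
        proof (rule PlusE)
          fix i assume "i \<in> {1..9}" "e = Inl i"
          then have "sum_chain (scalar \<circ> y) (\<lambda>_. \<zero>) e = scalar (R9_row GF3 y i)"
            using row[of i] by (simp add: sum_chain_def InlI)
          then show ?thesis by (simp only: sc(1))
        qed (simp add: sum_chain_def InrI zero_rows(2))
      qed
      ultimately show ?thesis unfolding sum_chains_def 1(2) by blast
    next
      case (2 D')
      then obtain z t where z: "D' = Q3_support z" "z \<in> {1..3} \<rightarrow> quats0" "t \<in> {1..3}" "z t \<noteq> 0"
        unfolding cocircuits_Q3 by blast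
      have "Elt_e t \<in> D'" using z by (simp add: Q3_support_def)
      moreover have "\<phi> \<circ> z \<in> {1..3} \<rightarrow> carrier R" using \<phi>_closed[OF funcset_mem[OF z(2)]] by simp
      moreover have "chain_support R ?E (sum_chain (\<lambda>_. \<zero>) (\<phi> \<circ> z)) = D"
        unfolding sum_chain_support using Q3_row_zero_transfer(1)[OF z(2)] zero_rows(1)
        by (auto simp: 2(2) z(1) Q3_support_def)
      moreover have "primitive R (Units R) ?E (sum_chain (\<lambda>_. \<zero>) (\<phi> \<circ> z))"
        unfolding primitive_def
      proof
        fix e :: "nat + dowling_elt" assume "e \<in> ?E"
        then show "sum_chain (\<lambda>_. \<zero>) (\<phi> \<circ> z) e \<in> Units R \<union> {\<zero>}"
        proof (rule PlusE)
          fix d assume d: "d \<in> Q3_ground" "e = Inr d"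
          then have "sum_chain (\<lambda>_. \<zero>) (\<phi> \<circ> z) e = Q3_row R \<phi> (\<phi> \<circ> z) d"
            by (simp add: sum_chain_def InrI)
          then show ?thesis using Q3_row_zero_transfer(2)[OF z(2) d(1)] by (simp only:)
        qed (simp add: sum_chain_def InlI zero_rows(1))
      qed
      ultimately show ?thesis unfolding sum_chains_def 2(2) by blast
    qed
  qed
qed

end

section \<open>The quaternions over the field with three elements\<close>

text \<open>Serves to copy the finite algebra onto natural numbers, the type that the theorem asks
  for. The additive maps are composed with the inverse of \<open>f\<close>, which is controlled only
  on the carrier.\<close>

lemma (in quaternion_group_algebra) quaternion_group_algebra_iso:
  assumes f: "f \<in> ring_iso R S" and S: "ring S"
  shows "quaternion_group_algebra S (f \<circ> \<phi>)"
proof -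
  interpret S: ring S by (rule S)
  interpret f: ring_hom_ring R S f
    using f by (intro ring_hom_ringI2 ring_axioms S) (simp add: ring_iso_def)
  have inj: "inj_on f (carrier R)" and surj: "f ` carrier R = carrier S"
    using f by (simp_all add: ring_iso_def bij_betw_def)
  have zero_iff: "f x = \<zero>\<^bsub>S\<^esub> \<longleftrightarrow> x = \<zero>" if "x \<in> carrier R" for x
    using inj_on_eq_iff[OF inj that zero_closed] by simp
  define g where "g = inv_into (carrier R) f"
  have g: "g x \<in> carrier R" "f (g x) = x" if "x \<in> carrier S" for x
    using that surj by (auto simp: g_def inv_into_into f_inv_into_f)
  have g_add: "g (x \<oplus>\<^bsub>S\<^esub> y) = g x \<oplus> g y" if "x \<in> carrier S" "y \<in> carrier S" for x y
  proof -
    have "f (g x \<oplus> g y) = x \<oplus>\<^bsub>S\<^esub> y" using g that by simp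
    then show ?thesis using g that unfolding g_def by (metis a_closed inj inv_into_f_f)
  qed
  show ?thesis
  proof unfold_locales
    show "\<one>\<^bsub>S\<^esub> \<noteq> \<zero>\<^bsub>S\<^esub>" using zero_iff[OF one_closed] one_neq_zero by simp
    show "(f \<circ> \<phi>) 0 = \<zero>\<^bsub>S\<^esub>" "(f \<circ> \<phi>) quat_1 = \<one>\<^bsub>S\<^esub>" by (simp_all add: \<phi>_zero \<phi>_one)
    show "(f \<circ> \<phi>) x \<in> carrier S" if "x \<in> quats0" for x using that \<phi>_closed by simp
    show "(f \<circ> \<phi>) (quat_mult x y) = (f \<circ> \<phi>) x \<otimes>\<^bsub>S\<^esub> (f \<circ> \<phi>) y" if "x \<in> quats0" "y \<in> quats0" for x y
      using that \<phi>_mult \<phi>_closed by simp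
    show "(f \<circ> \<phi>) x \<ominus>\<^bsub>S\<^esub> (f \<circ> \<phi>) y \<in> Units S" if "x \<in> quats0" "y \<in> quats0" "x \<noteq> y" for x y
    proof -
      define u where "u = \<phi> x \<ominus> \<phi> y"
      have u: "u \<in> Units R" using \<phi>_diff[OF that] by (simp add: u_def)
      have "f u \<otimes>\<^bsub>S\<^esub> f (inv u) = \<one>\<^bsub>S\<^esub>" "f (inv u) \<otimes>\<^bsub>S\<^esub> f u = \<one>\<^bsub>S\<^esub>"
        using u by (simp_all add: Units_closed flip: f.hom_mult)
      moreover have "f u \<in> carrier S" "f (inv u) \<in> carrier S" using u by (simp_all add: Units_closed)
      ultimately have "f u \<in> Units S" unfolding Units_def by blast
      then show ?thesis using \<phi>_closed[OF that(1)] \<phi>_closed[OF that(2)]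
        by (simp add: u_def minus_eq S.minus_eq)
    qed
    show "x \<oplus>\<^bsub>S\<^esub> (x \<oplus>\<^bsub>S\<^esub> x) = \<zero>\<^bsub>S\<^esub>" if "x \<in> carrier S" for x
    proof -
      have "f (g x \<oplus> (g x \<oplus> g x)) = \<zero>\<^bsub>S\<^esub>" using three[OF g(1)[OF that]] by simp
      then show ?thesis using g[OF that] by simp
    qed
    show "\<exists>l :: _ \<Rightarrow> int. (\<forall>a\<in>carrier S. l a \<in> {0, 1, 2}) \<and>
      (\<forall>a\<in>carrier S. \<forall>b\<in>carrier S. l (a \<oplus>\<^bsub>S\<^esub> b) = (l a + l b) mod 3) \<and> l x \<noteq> 0"
      if x: "x \<in> carrier S" "x \<noteq> \<zero>\<^bsub>S\<^esub>" for x
    proof -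
      have "g x \<noteq> \<zero>" using g[OF x(1)] x(2) f.hom_zero by metis
      then obtain l :: "'a \<Rightarrow> int" where "\<forall>a\<in>carrier R. l a \<in> {0, 1, 2}"
        "\<forall>a\<in>carrier R. \<forall>b\<in>carrier R. l (a \<oplus> b) = (l a + l b) mod 3" "l (g x) \<noteq> 0"
        using separating[OF g(1)[OF x(1)]] by blast
      then show ?thesis using g g_add by (intro exI[of _ "l \<circ> g"]) simp
    qed
  qed
qed

type_synonym int_quat = "int \<times> int \<times> int \<times> int"

fun int_quat_mult :: "int_quat \<Rightarrow> int_quat \<Rightarrow> int_quat" where
  "int_quat_mult (a, b, c, d) (a', b', c', d') =
     (a * a' - b * b' - c * c' - d * d',
      a * b' + b * a' + c * d' - d * c',
      a * c' - b * d' + c * a' + d * b',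
      a * d' + b * c' - c * b' + d * a')"

fun mod3 :: "int_quat \<Rightarrow> int_quat" where
  "mod3 (a, b, c, d) = (a mod 3, b mod 3, c mod 3, d mod 3)"

lemma mod3_mod3 [simp]: "mod3 (mod3 x) = mod3 x"
  by (cases x) simp

lemma mod3_zero [simp]: "mod3 0 = 0"
  by (simp add: zero_prod_def)

lemma mod3_add [simp]: "mod3 (mod3 x + y) = mod3 (x + y)" "mod3 (x + mod3 y) = mod3 (x + y)"
  by (cases x; cases y; simp add: mod_simps)+

lemma mod3_mult [simp]:
  "mod3 (int_quat_mult (mod3 x) y) = mod3 (int_quat_mult x y)"
  "mod3 (int_quat_mult x (mod3 y)) = mod3 (int_quat_mult x y)"
proof -
  obtain a b c d a' b' c' d' where x: "x = (a, b, c, d)" and y: "y = (a', b', c', d')"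
    by (cases x, cases y) blast
  \<comment> \<open>In each component both sides are the same polynomial, evaluated at congruent
    arguments.\<close>
  have *: "[p mod 3 = p] (mod 3)" for p :: int by (simp add: cong_def)
  show "mod3 (int_quat_mult (mod3 x) y) = mod3 (int_quat_mult x y)"
    "mod3 (int_quat_mult x (mod3 y)) = mod3 (int_quat_mult x y)"
    unfolding x y mod3.simps int_quat_mult.simps prod.inject
    by (intro conjI cong_add cong_diff cong_mult * cong_refl; fold cong_def;
      intro cong_add cong_diff cong_mult * cong_refl)+
qed

lemma int_quat_mult_assoc: "int_quat_mult (int_quat_mult x y) z = int_quat_mult x (int_quat_mult y z)"
  by (cases x; cases y; cases z) (simp add: algebra_simps)

lemma int_quat_mult_distrib:
  "int_quat_mult (x + y) z = int_quat_mult x z + int_quat_mult y z"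
  "int_quat_mult z (x + y) = int_quat_mult z x + int_quat_mult z y"
  by (cases x; cases y; cases z; simp add: algebra_simps)+

lemma int_quat_mult_one: "int_quat_mult (1, 0, 0, 0) x = x" "int_quat_mult x (1, 0, 0, 0) = x"
  by (cases x; simp)+

text \<open>Reduced quadruples represent the residues, so equality in the carrier is plain equality.
  The rules \<open>mod3_add\<close> and \<open>mod3_mult\<close> let the ring axioms be inherited
  from integer quadruples.\<close>

definition F3_quaternions :: "int_quat ring" where
  "F3_quaternions = \<lparr>carrier = {x. mod3 x = x}, monoid.mult = (\<lambda>x y. mod3 (int_quat_mult x y)),
     one = (1, 0, 0, 0), zero = 0, add = (\<lambda>x y. mod3 (x + y))\<rparr>"

lemma F3_quaternions_simps [simp]:
  "x \<otimes>\<^bsub>F3_quaternions\<^esub> y = mod3 (int_quat_mult x y)" "x \<oplus>\<^bsub>F3_quaternions\<^esub> y = mod3 (x + y)"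
  "\<zero>\<^bsub>F3_quaternions\<^esub> = 0" "\<one>\<^bsub>F3_quaternions\<^esub> = (1, 0, 0, 0)"
  "x \<in> carrier F3_quaternions \<longleftrightarrow> mod3 x = x"
  by (simp_all add: F3_quaternions_def)

lemma ring_F3_quaternions: "ring F3_quaternions"
proof (rule ringI)
  show "abelian_group F3_quaternions"
  proof (rule abelian_groupI)
    show "\<exists>y\<in>carrier F3_quaternions. y \<oplus>\<^bsub>F3_quaternions\<^esub> x = \<zero>\<^bsub>F3_quaternions\<^esub>" for x
      by (rule bexI[of _ "mod3 (- x)"]) simp_all
  qed (simp_all add: add_ac del: mod3.simps)
  show "Group.monoid F3_quaternions"
    by (rule Group.monoidI) (simp_all add: int_quat_mult_assoc int_quat_mult_one)
qed (simp_all add: int_quat_mult_distrib)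

text \<open>The inverse is the conjugate divided by the norm, and the norm is invertible mod 3 by
  assumption.\<close>

lemma F3_quaternions_Units:
  assumes x: "(a, b, c, d) \<in> carrier F3_quaternions" and n: "(a * a + b * b + c * c + d * d) mod 3 \<noteq> 0"
  shows "(a, b, c, d) \<in> Units F3_quaternions"
proof -
  define m where "m = a * a + b * b + c * c + d * d"
  have m: "m * m mod 3 = 1"
  proof -
    have "m mod 3 = 1 \<or> m mod 3 = 2" using n unfolding m_def[symmetric] by presburger
    then have "m mod 3 * (m mod 3) mod 3 = 1" by auto
    then show ?thesis by (simp add: mod_mult_eq)
  qed
  \<comment> \<open>The norm \<open>m\<close> is 1 or -1 mod 3 and hence its own inverse, so
    \<open>m\<close> times the conjugate is the inverse.\<close>
  define y where "y = (m * a, - m * b, - m * c, - m * d)"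
  have "int_quat_mult y (a, b, c, d) = (m * m, 0, 0, 0)" "int_quat_mult (a, b, c, d) y = (m * m, 0, 0, 0)"
    by (simp_all add: y_def m_def algebra_simps)
  then have "mod3 (int_quat_mult (mod3 y) (a, b, c, d)) = (1, 0, 0, 0)"
    "mod3 (int_quat_mult (a, b, c, d) (mod3 y)) = (1, 0, 0, 0)"
    using m by simp_all
  then show ?thesis using x unfolding Units_def mem_Collect_eq
    by (intro conjI bexI[of _ "mod3 y"]) simp_all
qed

text \<open>A conversion from real to integer coordinates, meant for elements of
  \<open>quats0\<close>, whose coordinates are 0, 1 and -1. In general it is not
  multiplicative.\<close>

fun quat_floor :: "quat \<Rightarrow> int_quat" where
  "quat_floor (a, b, c, d) = (\<lfloor>a\<rfloor>, \<lfloor>b\<rfloor>, \<lfloor>c\<rfloor>, \<lfloor>d\<rfloor>)"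

lemma quats0_cases:
  assumes "g \<in> quats0"
  obtains "g = (0, 0, 0, 0)" | "g = (1, 0, 0, 0)" | "g = (- 1, 0, 0, 0)" | "g = (0, 1, 0, 0)"
    | "g = (0, - 1, 0, 0)" | "g = (0, 0, 1, 0)" | "g = (0, 0, - 1, 0)" | "g = (0, 0, 0, 1)" | "g = (0, 0, 0, - 1)"
  using assms by (auto simp: quats0_def quaternion_group_def quat_unit_defs zero_prod_def)

lemma F3_quaternion_group_algebra: "quaternion_group_algebra F3_quaternions (mod3 \<circ> quat_floor)"
proof -
  interpret ring F3_quaternions by (rule ring_F3_quaternions)
  have floor: "\<lfloor>- 1 :: real\<rfloor> = - 1" by linarith
  have minus: "x \<ominus>\<^bsub>F3_quaternions\<^esub> y = mod3 (x - y)" if "mod3 y = y" for x y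
  proof -
    have "\<ominus>\<^bsub>F3_quaternions\<^esub> y = mod3 (- y)"
      by (rule minus_equality) (use that in simp_all)
    then show ?thesis by (simp add: minus_eq)
  qed
  show ?thesis
  proof unfold_locales
    show "\<one>\<^bsub>F3_quaternions\<^esub> \<noteq> \<zero>\<^bsub>F3_quaternions\<^esub>" by (simp add: zero_prod_def)
    show "(mod3 \<circ> quat_floor) 0 = \<zero>\<^bsub>F3_quaternions\<^esub>" by (simp add: zero_prod_def)
    show "(mod3 \<circ> quat_floor) quat_1 = \<one>\<^bsub>F3_quaternions\<^esub>" by (simp add: quat_1_def)
    show "(mod3 \<circ> quat_floor) g \<in> carrier F3_quaternions" for g by simp
    show "(mod3 \<circ> quat_floor) (quat_mult g h) = (mod3 \<circ> quat_floor) g \<otimes>\<^bsub>F3_quaternions\<^esub> (mod3 \<circ> quat_floor) h"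
      if "g \<in> quats0" "h \<in> quats0" for g h
    proof -
      have "quat_floor (quat_mult g h) = int_quat_mult (quat_floor g) (quat_floor h)"
        by (cases rule: quats0_cases[OF that(1)]; cases rule: quats0_cases[OF that(2)]; simp add: floor)
      then show ?thesis by simp
    qed
    show "(mod3 \<circ> quat_floor) g \<ominus>\<^bsub>F3_quaternions\<^esub> (mod3 \<circ> quat_floor) h \<in> Units F3_quaternions"
      if "g \<in> quats0" "h \<in> quats0" "g \<noteq> h" for g h
    proof -
      \<comment> \<open>The difference of two distinct elements of \<open>quats0\<close> has norm 1,
        2 or 4, and reducing coordinates changes a norm only by multiples of 3. So the norm is never
        0 mod 3.\<close>
      have "mod3 (mod3 (quat_floor g) - mod3 (quat_floor h)) \<in> Units F3_quaternions"
        using that(3)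
        by (cases rule: quats0_cases[OF that(1)]; cases rule: quats0_cases[OF that(2)];
            simp add: F3_quaternions_Units floor zero_prod_def)
      then show ?thesis by (simp add: minus)
    qed
    show "x \<oplus>\<^bsub>F3_quaternions\<^esub> (x \<oplus>\<^bsub>F3_quaternions\<^esub> x) = \<zero>\<^bsub>F3_quaternions\<^esub>" for x
      by (cases x) (simp add: zero_prod_def mod_simps)
    show "\<exists>l :: int_quat \<Rightarrow> int. (\<forall>a\<in>carrier F3_quaternions. l a \<in> {0, 1, 2}) \<and>
      (\<forall>a\<in>carrier F3_quaternions. \<forall>b\<in>carrier F3_quaternions. l (a \<oplus>\<^bsub>F3_quaternions\<^esub> b) = (l a + l b) mod 3) \<and> l x \<noteq> 0"
      if x: "x \<in> carrier F3_quaternions" "x \<noteq> \<zero>\<^bsub>F3_quaternions\<^esub>" for x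
    proof -
      \<comment> \<open>The four coordinates mod 3 are additive, and a nonzero quadruple has a
        nonzero one.\<close>
      let ?ls = "{\<lambda>(a, b, c, d). a mod 3, \<lambda>(a, b, c, d). b mod 3, \<lambda>(a, b, c, d). c mod 3, \<lambda>(a, b, c, d). d mod 3} :: (int_quat \<Rightarrow> int) set"
      have "\<exists>l\<in>?ls. l x \<noteq> 0" using x by (cases x) (auto simp: zero_prod_def)
      then obtain l where l: "l \<in> ?ls" "l x \<noteq> 0" by blast
      have "l a \<in> {0, 1, 2}" for a
      proof -
        have "p mod 3 \<in> {0, 1, 2}" for p :: int by auto
        then show ?thesis using l(1) by (cases a) (elim insertE emptyE; simp)
      qed
      moreover have "l (a \<oplus>\<^bsub>F3_quaternions\<^esub> b) = (l a + l b) mod 3" for a b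
        using l(1) by (cases a; cases b) (elim insertE emptyE; simp add: mod_simps)
      ultimately show ?thesis using l(2) by blast
    qed
  qed
qed

lemma ex_nat_ring_representation:
  "\<exists>(R :: nat ring) G. skew_partial_field R G \<and>
     representable_over_partial_field (R9 \<oplus>\<^sub>M Q3_quaternion) R G"
proof -
  interpret F3: quaternion_group_algebra F3_quaternions "mod3 \<circ> quat_floor"
    by (rule F3_quaternion_group_algebra)
  define R :: "nat ring" where "R = image_ring (to_nat :: int_quat \<Rightarrow> nat) F3_quaternions"
  have inj: "inj_on to_nat (carrier F3_quaternions)" by (rule inj_on_subset[OF inj_to_nat]) simp
  have iso: "to_nat \<in> ring_iso F3_quaternions R"
    unfolding R_def by (rule inj_imp_image_ring_iso[OF inj])
  have "ring R" unfolding R_def by (rule F3.inj_imp_image_ring_is_ring[OF inj])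
  then interpret R: quaternion_group_algebra R "to_nat \<circ> (mod3 \<circ> quat_floor)"
    by (rule F3.quaternion_group_algebra_iso[OF iso])
  have "subgroup (carrier (units_of R)) (units_of R)"
    by (rule group.subgroup_self[OF R.units_group])
  then have "skew_partial_field R (Units R)"
    by (simp add: skew_partial_field_def units_of_carrier R.ring_axioms R.Units_minus_one_closed)
  then show ?thesis using R.representable by blast
qed

section \<open>Representations over skew fields\<close>

definition vec3 :: "'a \<Rightarrow> 'a \<Rightarrow> 'a \<Rightarrow> nat \<Rightarrow> 'a" where
  "vec3 a b c t = (if t = 1 then a else if t = 2 then b else c)"

lemma vec3_simps [simp]: "vec3 a b c (Suc 0) = a" "vec3 a b c 1 = a" "vec3 a b c 2 = b" "vec3 a b c 3 = c"
  by (simp_all add: vec3_def)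

lemma vec3_in: "vec3 a b c \<in> {1..3} \<rightarrow> S \<longleftrightarrow> a \<in> S \<and> b \<in> S \<and> c \<in> S"
  unfolding atLeastAtMost_1_3 by (auto simp: vec3_def)

definition R9_lines :: "(int \<times> int \<times> int) set" where
  "R9_lines = {(1, 0, 0), (0, 1, 0), (0, 0, 1), (1, 2, 0), (0, 1, 2), (1, 0, 2), (1, 1, 2), (1, 2, 2), (1, 1, 1)}"

text \<open>A nonzero vector over GF(3) vanishing at all elements of one of these lines is a
  multiple of its equation, so it has no further zeros and the support is minimal. The proof checks
  the finitely many vectors.\<close>

lemma R9_line_cocircuit:
  assumes line: "(a, b, c) \<in> R9_lines"
  shows "R9_support (vec3 a b c) \<in> cocircuits R9"
proof -
  have abc: "a \<in> {0, 1, 2}" "b \<in> {0, 1, 2}" "c \<in> {0, 1, 2}" "a \<noteq> 0 \<or> b \<noteq> 0 \<or> c \<noteq> 0"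
    using line by (auto simp: R9_lines_def)
  have "R9_support (vec3 a b c) \<in> R9_supports"
    unfolding R9_supports_def
  proof (intro CollectI exI[of _ "vec3 a b c"] conjI refl)
    show "vec3 a b c \<in> {1..3} \<rightarrow> {0, 1, 2}" using abc by (simp only: vec3_in)
    show "\<exists>t\<in>{1..3}. vec3 a b c t \<noteq> 0" using abc(4) unfolding atLeastAtMost_1_3 by simp
  qed
  moreover have "S' = R9_support (vec3 a b c)" if S': "S' \<in> R9_supports" "S' \<subseteq> R9_support (vec3 a b c)" for S'
  proof -
    obtain y where y: "S' = R9_support y" "y \<in> {1..3} \<rightarrow> {0, 1, 2}" "\<exists>t\<in>{1..3}. y t \<noteq> 0"
      using S'(1) unfolding R9_supports_def by blast
    have y0: "y 1 \<noteq> 0 \<or> y 2 \<noteq> 0 \<or> y 3 \<noteq> 0" using y(3) unfolding atLeastAtMost_1_3 by simp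
    have yr: "y 1 \<in> {0, 1, 2}" "y 2 \<in> {0, 1, 2}" "y 3 \<in> {0, 1, 2}" using y(2) by auto
    have zero: "R9_row GF3 (vec3 a b c) i = 0 \<Longrightarrow> R9_row GF3 y i = 0" if "i \<in> {1..9}" for i
      using S'(2) that unfolding y(1) R9_support_def by blast
    have zeros: "\<forall>i\<in>set [1, 2, 3, 4, 5, 6, 7, 8, 9]. R9_row GF3 (vec3 a b c) i = 0 \<longrightarrow> R9_row GF3 y i = 0"
      using zero by simp
    have "\<forall>i\<in>set [1, 2, 3, 4, 5, 6, 7, 8, 9]. R9_row GF3 y i = 0 \<longrightarrow> R9_row GF3 (vec3 a b c) i = 0"
      using zeros y0 line yr unfolding R9_lines_def
      by (elim insertE emptyE; simp add: R9_row_simps GF3_add GF3_minus GF3_carrier)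
    moreover have "i \<in> set [1, 2, 3, 4, 5, 6, 7, 8, 9]" if "i \<in> {1..9}" for i :: nat
      by (cases rule: R9_ground_cases[OF that]) simp_all
    ultimately show ?thesis unfolding y(1) R9_support_def using zero by (intro Collect_cong) blast
  qed
  ultimately show ?thesis unfolding cocircuits_R9 by simp
qed

section \<open>Chains of a representation over a skew field\<close>

abbreviation sum_ground :: "(nat + dowling_elt) set" where
  "sum_ground \<equiv> {1..9} <+> Q3_ground"

locale skew_field_representation = skew_field_ring F for F :: "('r, 'm) ring_scheme" (structure) +
  fixes C :: "(nat + dowling_elt \<Rightarrow> 'r) set"
  assumes chain_group: "chain_group F sum_ground C"
    and cocircuits_C: "cocircuits (R9 \<oplus>\<^sub>M Q3_quaternion) =
      chain_support F sum_ground ` {c. elementary F sum_ground C c}"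
begin

abbreviation support where "support \<equiv> chain_support F sum_ground"

lemmas cocircuits_sum = cocircuits_direct_sum[OF R9_is_matroid Q3_is_matroid]

lemma finite_sum_ground: "finite sum_ground"
  using finite_Q3_ground by simp

lemma chain_closed: "c \<in> C \<Longrightarrow> e \<in> sum_ground \<Longrightarrow> c e \<in> carrier F"
  using chain_group unfolding chain_group_def by blast

lemma chain_add: "c \<in> C \<Longrightarrow> d \<in> C \<Longrightarrow> (\<lambda>e\<in>sum_ground. c e \<oplus> d e) \<in> C"
  using chain_group unfolding chain_group_def by blast

lemma chain_mult: "r \<in> carrier F \<Longrightarrow> c \<in> C \<Longrightarrow> (\<lambda>e\<in>sum_ground. r \<otimes> c e) \<in> C"
  using chain_group unfolding chain_group_def by blast

text \<open>On a finite ground set some nonzero chain has a minimal support inside that of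
  \<open>c\<close>, and such a chain is elementary.\<close>

lemma nonzero_chain_contains_cocircuit:
  assumes c: "c \<in> C" "support c \<noteq> {}"
  obtains D where "D \<in> cocircuits (R9 \<oplus>\<^sub>M Q3_quaternion)" "D \<subseteq> support c"
proof -
  have iff: "d = zero_chain F sum_ground \<longleftrightarrow> support d = {}" if "d \<in> C" for d
    using chain_group that unfolding chain_group_def by (intro zero_chain_iff_support_empty) blast
  let ?S = "support ` {d \<in> C. support d \<noteq> {}}"
  have "?S \<subseteq> Pow sum_ground" by (auto simp: chain_support_def)
  then have "finite ?S" using finite_sum_ground by (meson finite_Pow_iff finite_subset)
  moreover have "support c \<in> ?S" using c by blast
  ultimately have "\<exists>D\<in>?S. D \<subseteq> support c \<and> (\<forall>X\<in>?S. X \<subseteq> D \<longrightarrow> D = X)"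
    by (rule finite_has_minimal2)
  then obtain D where D: "D \<in> ?S" "D \<subseteq> support c" and min: "\<forall>X\<in>?S. X \<subseteq> D \<longrightarrow> D = X"
    by (elim bexE conjE) (rule that)
  from D(1) obtain d where d: "d \<in> C" "D = support d" "support d \<noteq> {}" by blast
  have "\<not> support d' \<subset> support d" if d': "d' \<in> C" "d' \<noteq> zero_chain F sum_ground" for d'
  proof -
    have "support d' \<in> ?S" using d' iff[OF d'(1)] by blast
    then show ?thesis using min d(2) by auto
  qed
  then have "elementary F sum_ground C d" unfolding elementary_def using d(1,3) iff[OF d(1)] by blast
  then have "D \<in> cocircuits (R9 \<oplus>\<^sub>M Q3_quaternion)" unfolding cocircuits_C d(2) by blast
  then show ?thesis using that D(2) by blast
qed

lemma cocircuit_chain: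
  assumes D: "D \<in> cocircuits (R9 \<oplus>\<^sub>M Q3_quaternion)"
  obtains c where "c \<in> C" "support c = D"
  using D unfolding cocircuits_C elementary_def by blast

text \<open>Chains may be multiplied from the left, so one of their nonzero values can be
  prescribed. This is the freedom by which a representation gets normalised.\<close>

lemma normalized_chain:
  assumes D: "D \<in> cocircuits (R9 \<oplus>\<^sub>M Q3_quaternion)" and p: "p \<in> D" "r \<in> carrier F" "r \<noteq> \<zero>"
  obtains c where "c \<in> C" "support c = D" "c p = r"
proof -
  obtain c where c: "c \<in> C" "support c = D"
    by (rule cocircuit_chain[OF D])
  have pE: "p \<in> sum_ground" and cp: "c p \<noteq> \<zero>" using p(1) c(2) by (auto simp: chain_support_def)
  note i = nonzero_inv[OF chain_closed[OF c(1) pE] cp]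
  define s where "s = r \<otimes> inv (c p)"
  have s: "s \<in> carrier F" "s \<otimes> c p = r" using i p chain_closed[OF c(1) pE] by (simp_all add: s_def m_assoc)
  then have s0: "s \<noteq> \<zero>" using p(3) chain_closed[OF c(1) pE] by auto
  show ?thesis
  proof
    show "(\<lambda>e\<in>sum_ground. s \<otimes> c e) \<in> C" by (rule chain_mult[OF s(1) c(1)])
    show "(\<lambda>e\<in>sum_ground. s \<otimes> c e) p = r" using pE s by simp
    show "support (\<lambda>e\<in>sum_ground. s \<otimes> c e) = D"
      unfolding c(2)[symmetric] chain_support_def
      using mult_eq_zero_iff[OF s(1) chain_closed[OF c(1)]] s0 by (intro Collect_cong conj_cong refl) simp
  qed
qed

text \<open>
  A chain supported on one summand is determined by its values on three elements meeting every
  cocircuit of that summand.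
\<close>
lemma chain_expansion:
  assumes u: "\<forall>t\<in>{1..3}. u t \<in> C \<and> support (u t) \<subseteq> E\<^sub>1"
    and p: "\<forall>t\<in>{1..3}. p t \<in> sum_ground"
    and up: "\<forall>s\<in>{1..3}. \<forall>t\<in>{1..3}. u s (p t) = \<zero> \<longleftrightarrow> s \<noteq> t"
    and meets: "\<forall>D\<in>cocircuits (R9 \<oplus>\<^sub>M Q3_quaternion). D \<subseteq> E\<^sub>1 \<longrightarrow> (\<exists>t\<in>{1..3::nat}. p t \<in> D)"
    and c: "c \<in> C" "support c \<subseteq> E\<^sub>1"
  shows "\<exists>l. (\<forall>t\<in>{1..3}. l t \<in> carrier F \<and> (l t = \<zero> \<longleftrightarrow> c (p t) = \<zero>)) \<and>
    (\<forall>e\<in>sum_ground. c e = l 1 \<otimes> u 1 e \<oplus> (l 2 \<otimes> u 2 e \<oplus> l 3 \<otimes> u 3 e))"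
proof -
  \<comment> \<open>At \<open>p t\<close> every \<open>u s\<close> with another index vanishes, so
    the coefficient of \<open>u t\<close> is read off from the value of \<open>c\<close>
    there.\<close>
  define l where "l t = c (p t) \<otimes> inv (u t (p t))" for t :: nat
  note u = u[rule_format] and p = p[rule_format] and up = up[rule_format] and meets = meets[rule_format]
  have up': "u t (p t) \<in> carrier F" "u t (p t) \<noteq> \<zero>" if "t \<in> {1..3}" for t
    using that u p up chain_closed by auto
  note i = nonzero_inv[OF up']
  have cp: "c (p t) \<in> carrier F" if "t \<in> {1..3}" for t using chain_closed[OF c(1) p[OF that]] .
  have l: "l t \<in> carrier F" "l t \<otimes> u t (p t) = c (p t)" if "t \<in> {1..3}" for t
    using i[OF that that] cp[OF that] up'[OF that] by (simp_all add: l_def m_assoc)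
  have l_zero: "l t = \<zero> \<longleftrightarrow> c (p t) = \<zero>" if "t \<in> {1..3}" for t
    using l[OF that] up'[OF that] cp[OF that] mult_eq_zero_iff[of "l t" "u t (p t)"] by auto
  define w where "w e = l 1 \<otimes> u 1 e \<oplus> (l 2 \<otimes> u 2 e \<oplus> l 3 \<otimes> u 3 e)" for e
  have uc: "u t e \<in> carrier F" if "t \<in> {1..3}" "e \<in> sum_ground" for t e
    using chain_closed u that by blast
  have wc: "w e \<in> carrier F" if "e \<in> sum_ground" for e
    using l(1) uc that by (simp add: w_def)
  have "(\<lambda>e\<in>sum_ground. (\<lambda>e\<in>sum_ground. l 1 \<otimes> u 1 e) e \<oplus>
      (\<lambda>e\<in>sum_ground. (\<lambda>e\<in>sum_ground. l 2 \<otimes> u 2 e) e \<oplus> (\<lambda>e\<in>sum_ground. l 3 \<otimes> u 3 e) e) e) \<in> C" (is "?w \<in> C")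
    using l(1) u by (intro chain_add chain_mult) auto
  moreover have "?w = (\<lambda>e\<in>sum_ground. w e)" by (intro restrict_ext) (simp add: w_def)
  ultimately have wC: "(\<lambda>e\<in>sum_ground. w e) \<in> C" by simp
  \<comment> \<open>The difference of \<open>c\<close> and the combination. It vanishes at every
    \<open>p t\<close>, so its support contains no cocircuit and must be empty.\<close>
  define c' where "c' = (\<lambda>e\<in>sum_ground. c e \<oplus> (\<lambda>e\<in>sum_ground. (\<ominus> \<one>) \<otimes> (\<lambda>e\<in>sum_ground. w e) e) e)"
  have c'C: "c' \<in> C" unfolding c'_def by (intro chain_add chain_mult c(1) wC a_inv_closed one_closed)
  have c'_eq: "c' e = c e \<ominus> w e" if "e \<in> sum_ground" for e
    using that wc[OF that] by (simp add: c'_def l_minus minus_eq)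
  have "c' (p t) = \<zero>" if t: "t \<in> {1..3}" for t
  proof -
    have "w (p t) = l t \<otimes> u t (p t)"
    proof -
      have z: "u s (p t) = \<zero>" if "s \<in> {1..3}" "s \<noteq> t" for s using up[OF that(1) t] that(2) by simp
      have "t = 1 \<or> t = 2 \<or> t = 3" using t unfolding atLeastAtMost_1_3 by simp
      then show ?thesis
        using z[of 1] z[of 2] z[of 3] l(1)[of 1] l(1)[of 2] l(1)[of 3] up'[OF t]
        by (elim disjE) (simp_all add: w_def)
    qed
    then show ?thesis using c'_eq[OF p[OF t]] l[OF t] cp[OF t] by (simp add: minus_eq r_neg)
  qed
  then have notp: "p t \<notin> support c'" if "t \<in> {1..3}" for t using that by (simp add: chain_support_def)
  have "support c' \<subseteq> E\<^sub>1"
  proof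
    fix e assume e: "e \<in> support c'"
    show "e \<in> E\<^sub>1"
    proof (rule ccontr)
      assume nE: "e \<notin> E\<^sub>1"
      have eE: "e \<in> sum_ground" "c' e \<noteq> \<zero>" using e by (auto simp: chain_support_def)
      have "u t e = \<zero>" if "t \<in> {1..3}" for t using u[OF that] nE eE(1) unfolding chain_support_def by blast
      moreover have "c e = \<zero>" using c(2) nE eE(1) unfolding chain_support_def by blast
      ultimately have "c' e = \<zero>" using c'_eq[OF eE(1)] l(1) by (simp add: w_def minus_eq)
      then show False using eE(2) by simp
    qed
  qed
  then have "support c' = {}"
    using nonzero_chain_contains_cocircuit[OF c'C] meets notp by (metis subset_eq)
  then have "c' e = \<zero>" if "e \<in> sum_ground" for e using that unfolding chain_support_def by blast
  then have diff: "c e \<ominus> w e = \<zero>" if "e \<in> sum_ground" for e using c'_eq[OF that] that by simp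
  have "c e = w e" if "e \<in> sum_ground" for e
    using diff[OF that] chain_closed[OF c(1) that] wc[OF that] by simp
  then show ?thesis using l(1) l_zero unfolding w_def by (intro exI[of _ l]) blast
qed

end

section \<open>Cancellation from either side in a skew field\<close>

context skew_field_ring
begin

lemma minus_eq_of_sum_zero:
  "a \<in> carrier F \<Longrightarrow> b \<in> carrier F \<Longrightarrow> a \<oplus> b = \<zero> \<Longrightarrow> b = \<ominus> a"
  by (metis a_comm minus_equality)

lemma eq_of_sums_zero:
  "a \<in> carrier F \<Longrightarrow> b \<in> carrier F \<Longrightarrow> c \<in> carrier F \<Longrightarrow> a \<oplus> c = \<zero> \<Longrightarrow> b \<oplus> c = \<zero> \<Longrightarrow> a = b"
  by (metis minus_equality minus_minus)

lemma sum_zero_cancel_right: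
  assumes "a \<in> carrier F" "b \<in> carrier F" "p \<in> carrier F" "p \<noteq> \<zero>" "a \<otimes> p \<oplus> b \<otimes> p = \<zero>"
  shows "a \<oplus> b = \<zero>"
  using assms mult_eq_zero_iff[of "a \<oplus> b" p] by (simp add: l_distr)

lemma sum_zero_cancel_left:
  assumes "a \<in> carrier F" "p \<in> carrier F" "q \<in> carrier F" "a \<noteq> \<zero>" "a \<otimes> p \<oplus> a \<otimes> q = \<zero>"
  shows "p \<oplus> q = \<zero>"
  using assms mult_eq_zero_iff[of a "p \<oplus> q"] by (simp add: r_distr)

text \<open>The first sum says \<open>b\<close> is \<open>-a\<close>, so the second is
  \<open>a\<close> times the difference of \<open>p\<close> and \<open>q\<close>. The next lemma is
  its mirror image.\<close>

lemma sums_zero_imp_eq_right: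
  assumes c: "a \<in> carrier F" "b \<in> carrier F" "p \<in> carrier F" "q \<in> carrier F"
    and "a \<noteq> \<zero>" "a \<oplus> b = \<zero>" "a \<otimes> p \<oplus> b \<otimes> q = \<zero>"
  shows "p = q"
proof -
  have b: "b = \<ominus> a" using minus_eq_of_sum_zero[OF c(1,2)] assms(6) .
  have "a \<otimes> p \<oplus> a \<otimes> (\<ominus> q) = \<zero>" using assms(7) c unfolding b by (simp add: l_minus r_minus)
  then have "p \<oplus> \<ominus> q = \<zero>" using sum_zero_cancel_left[of a p "\<ominus> q"] assms by simp
  then show ?thesis using c by (simp add: minus_eq[symmetric])
qed

lemma sums_zero_imp_eq_left:
  assumes c: "a \<in> carrier F" "b \<in> carrier F" "p \<in> carrier F" "q \<in> carrier F"
    and "p \<noteq> \<zero>" "p \<oplus> q = \<zero>" "a \<otimes> p \<oplus> b \<otimes> q = \<zero>"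
  shows "a = b"
proof -
  have q: "q = \<ominus> p" using minus_eq_of_sum_zero[OF c(3,4)] assms(6) .
  have "a \<otimes> p \<oplus> (\<ominus> b) \<otimes> p = \<zero>" using assms(7) c unfolding q by (simp add: l_minus r_minus)
  then have "a \<oplus> \<ominus> b = \<zero>" using sum_zero_cancel_right[of a "\<ominus> b" p] assms by simp
  then show ?thesis using c by (simp add: minus_eq[symmetric])
qed

end

context skew_field_representation
begin

text \<open>
  The columns of \<open>R\<^sub>9\<close> at 5, 7, 9 are forced by the lines 345, 147, 249, and those at 6, 8 by the
  lines 679, 589; the remaining line 468 then exists only in characteristic 3.
\<close>
lemma three_eq_zero: "\<one> \<oplus> (\<one> \<oplus> \<one>) = \<zero>"
proof -
  define ev :: "nat \<Rightarrow> nat \<Rightarrow> int" where "ev t = vec3 (of_bool (t = 1)) (of_bool (t = 2)) (of_bool (t = 3))" for t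
  have ev_simps: "ev (Suc 0) = vec3 1 0 0" "ev 1 = vec3 1 0 0" "ev 2 = vec3 0 1 0" "ev 3 = vec3 0 0 1"
    by (simp_all add: ev_def)
  have three: "t = 1 \<or> t = 2 \<or> t = 3" if "t \<in> {1..3}" for t :: nat using that by auto
  have ev_line: "(of_bool (t = 1), of_bool (t = 2), of_bool (t = 3)) \<in> R9_lines" if "t \<in> {1..3}" for t :: nat
    using three[OF that] by (elim disjE) (simp_all add: R9_lines_def)
  have coc: "Inl ` R9_support (vec3 a b c) \<in> cocircuits (R9 \<oplus>\<^sub>M Q3_quaternion)" if "(a, b, c) \<in> R9_lines" for a b c
    unfolding cocircuits_sum using R9_line_cocircuit[OF that] by blast
  have zero_iff: "c (Inl i) = \<zero> \<longleftrightarrow> R9_row GF3 y i = 0"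
    if "support c = Inl ` R9_support y" "i \<in> {1..9}" for c y i
  proof -
    have "c (Inl i) \<noteq> \<zero> \<longleftrightarrow> Inl i \<in> support c" using that(2) by (auto simp: chain_support_def)
    also have "\<dots> \<longleftrightarrow> R9_row GF3 y i \<noteq> 0" unfolding that(1) using that(2) by (auto simp: R9_support_def)
    finally show ?thesis by blast
  qed
  \<comment> \<open>Coordinate chains, each scaled to take the value 1 at element 4. Their values
    form a coordinate matrix whose column 4 is (1, 1, 1); no other column is normalised, so those
    are known only up to right factors.\<close>
  have "\<exists>c. c \<in> C \<and> support c = Inl ` R9_support (ev t) \<and> c (Inl 4) = \<one>" if t: "t \<in> {1..3}" for t
  proof -
    have "R9_row GF3 (ev t) 4 \<noteq> 0" using three[OF t] by (auto simp: ev_simps R9_row_simps GF3_add)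
    then have "(Inl 4 :: nat + dowling_elt) \<in> Inl ` R9_support (ev t)" by (simp add: R9_support_def)
    moreover have "Inl ` R9_support (ev t) \<in> cocircuits (R9 \<oplus>\<^sub>M Q3_quaternion)"
      unfolding ev_def by (rule coc[OF ev_line[OF t]])
    ultimately show ?thesis using one_neq_zero by (metis normalized_chain one_closed)
  qed
  then obtain u where u: "\<And>t. t \<in> {1..3} \<Longrightarrow> u t \<in> C \<and> support (u t) = Inl ` R9_support (ev t) \<and> u t (Inl 4) = \<one>"
    by metis
  define U where "U t i = u t (Inl i)" for t i
  have U: "U t i \<in> carrier F" if "t \<in> {1..3}" "i \<in> {1..9}" for t i
    unfolding U_def using u that chain_closed by blast
  have U4: "U t 4 = \<one>" if "t \<in> {1..3}" for t using u[OF that] by (simp add: U_def)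
  have Uz: "U t i = \<zero> \<longleftrightarrow> R9_row GF3 (ev t) i = 0" if "t \<in> {1..3}" "i \<in> {1..9}" for t i
    unfolding U_def using u[OF that(1)] that(2) by (intro zero_iff) auto
  have chain: "\<exists>l. (\<forall>t\<in>{1..3}. l t \<in> carrier F \<and> (l t = \<zero> \<longleftrightarrow> vec3 a b c t = 0)) \<and>
      (\<forall>i\<in>{1..9}. l 1 \<otimes> U 1 i \<oplus> (l 2 \<otimes> U 2 i \<oplus> l 3 \<otimes> U 3 i) = \<zero> \<longleftrightarrow> R9_row GF3 (vec3 a b c) i = 0)"
    if line: "(a, b, c) \<in> R9_lines" for a b c
  proof -
    have E1: "Inl ` R9_support y \<subseteq> Inl ` {1..9}" for y by (auto simp: R9_support_def)
    have u': "u t \<in> C \<and> support (u t) \<subseteq> Inl ` {1..9}" if "t \<in> {1..3}" for t using u[OF that] E1 by simp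
    have p: "(Inl t :: nat + dowling_elt) \<in> sum_ground" if "t \<in> {1..3}" for t using that by auto
    have up: "u s (Inl t) = \<zero> \<longleftrightarrow> s \<noteq> t" if st: "s \<in> {1..3}" "t \<in> {1..3}" for s t
      using Uz[OF st(1), of t] three[OF st(1)] three[OF st(2)]
      by (elim disjE) (simp_all add: U_def ev_simps R9_row_simps)
    have meets: "\<exists>t\<in>{1..3}. Inl t \<in> D"
      if D: "D \<in> cocircuits (R9 \<oplus>\<^sub>M Q3_quaternion)" "D \<subseteq> Inl ` {1..9}" for D
    proof -
      consider D' where "D' \<in> cocircuits R9" "D = Inl ` D'" | D' where "D' \<in> cocircuits Q3_quaternion" "D = Inr ` D'"
        using D(1) unfolding cocircuits_sum by blast
      then show ?thesis
      proof cases
        case (1 D')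
        then obtain y t where y: "D' = R9_support y" "t \<in> {1..3}" "y t \<noteq> 0"
          unfolding cocircuits_R9 R9_supports_def by blast
        then have "t \<in> D'" using three[OF y(2)] by (auto simp: R9_support_def R9_row_simps)
        then show ?thesis using 1 y(2) by blast
      next
        case (2 D')
        then obtain y t where y: "D' = Q3_support y" "t \<in> {1..3}" "y t \<noteq> 0"
          unfolding cocircuits_Q3 by blast
        then have "Elt_e t \<in> D'" by (simp add: Q3_support_def)
        then show ?thesis using 2 D(2) by blast
      qed
    qed
    obtain d where d: "d \<in> C" "support d = Inl ` R9_support (vec3 a b c)"
      by (rule cocircuit_chain[OF coc[OF line]])
    then have d': "support d \<subseteq> Inl ` {1..9}" using E1 by simp
      have "\<exists>l. (\<forall>t\<in>{1..3}. l t \<in> carrier F \<and> (l t = \<zero> \<longleftrightarrow> d (Inl t) = \<zero>)) \<and>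
      (\<forall>e\<in>sum_ground. d e = l 1 \<otimes> u 1 e \<oplus> (l 2 \<otimes> u 2 e \<oplus> l 3 \<otimes> u 3 e))"
      by (rule chain_expansion[of u "Inl ` {1..9}" Inl d]) (use u' p up meets d(1) d' in blast)+
    then obtain l where l: "\<And>t. t \<in> {1..3} \<Longrightarrow> l t \<in> carrier F \<and> (l t = \<zero> \<longleftrightarrow> d (Inl t) = \<zero>)"
      and de: "\<And>e. e \<in> sum_ground \<Longrightarrow> d e = l 1 \<otimes> u 1 e \<oplus> (l 2 \<otimes> u 2 e \<oplus> l 3 \<otimes> u 3 e)"
      by blast
    show ?thesis
    proof (intro exI[of _ l] conjI ballI)
      fix t :: nat assume t: "t \<in> {1..3}"
      show "l t \<in> carrier F" using l[OF t] by simp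
      have "R9_row GF3 (vec3 a b c) t = vec3 a b c t" using three[OF t] by (auto simp: R9_row_simps)
      then have "d (Inl t) = \<zero> \<longleftrightarrow> vec3 a b c t = 0" using zero_iff[OF d(2), of t] t by simp
      then show "l t = \<zero> \<longleftrightarrow> vec3 a b c t = 0" using l[OF t] by simp
    next
      fix i :: nat assume i: "i \<in> {1..9}"
      then have "(Inl i :: nat + dowling_elt) \<in> sum_ground" by auto
      from de[OF this] zero_iff[OF d(2) i]
      show "l 1 \<otimes> U 1 i \<oplus> (l 2 \<otimes> U 2 i \<oplus> l 3 \<otimes> U 3 i) = \<zero> \<longleftrightarrow> R9_row GF3 (vec3 a b c) i = 0"
        unfolding U_def by simp
    qed
  qed
  have chain': "\<exists>l1 l2 l3. l1 \<in> carrier F \<and> l2 \<in> carrier F \<and> l3 \<in> carrier F \<and>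
      (l1 = \<zero> \<longleftrightarrow> a = 0) \<and> (l2 = \<zero> \<longleftrightarrow> b = 0) \<and> (l3 = \<zero> \<longleftrightarrow> c = 0) \<and>
      (\<forall>i\<in>{1..9}. R9_row GF3 (vec3 a b c) i = 0 \<longrightarrow> l1 \<otimes> U 1 i \<oplus> (l2 \<otimes> U 2 i \<oplus> l3 \<otimes> U 3 i) = \<zero>)"
    if line: "(a, b, c) \<in> R9_lines" for a b c
  proof -
    obtain l where "\<forall>t\<in>{1..3}. l t \<in> carrier F \<and> (l t = \<zero> \<longleftrightarrow> vec3 a b c t = 0)"
      "\<forall>i\<in>{1..9}. l 1 \<otimes> U 1 i \<oplus> (l 2 \<otimes> U 2 i \<oplus> l 3 \<otimes> U 3 i) = \<zero> \<longleftrightarrow> R9_row GF3 (vec3 a b c) i = 0"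
      using chain[OF line] by blast
    then show ?thesis
      by (intro exI[of _ "l 1"] exI[of _ "l 2"] exI[of _ "l 3"]) (simp add: atLeastAtMost_1_3)
  qed
  have Uc: "U 1 5 \<in> carrier F" "U 2 5 \<in> carrier F" "U 3 5 \<in> carrier F"
    "U 1 6 \<in> carrier F" "U 2 6 \<in> carrier F" "U 3 6 \<in> carrier F"
    "U 1 7 \<in> carrier F" "U 2 7 \<in> carrier F" "U 3 7 \<in> carrier F"
    "U 1 8 \<in> carrier F" "U 2 8 \<in> carrier F" "U 3 8 \<in> carrier F"
    "U 1 9 \<in> carrier F" "U 2 9 \<in> carrier F" "U 3 9 \<in> carrier F"
    by (simp_all add: U)
  note rows = R9_row_simps GF3_add GF3_minus GF3_carrier ev_simps
  have U5: "U 1 5 = U 2 5"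
  proof -
    obtain a b c where l: "a \<in> carrier F" "b \<in> carrier F" "c = \<zero>" "a \<noteq> \<zero>"
      and r: "\<forall>i\<in>{1..9}. R9_row GF3 (vec3 1 2 0) i = 0 \<longrightarrow> a \<otimes> U 1 i \<oplus> (b \<otimes> U 2 i \<oplus> c \<otimes> U 3 i) = \<zero>"
      using chain'[of 1 2 0] by (auto simp: R9_lines_def)
    have "a \<oplus> b = \<zero>" using r[rule_format, of 4] l U4 by (simp add: rows)
    moreover have "a \<otimes> U 1 5 \<oplus> b \<otimes> U 2 5 = \<zero>" using r[rule_format, of 5] l Uc by (simp add: rows)
    ultimately show ?thesis by (rule sums_zero_imp_eq_right[OF l(1,2) Uc(1) Uc(2) l(4)])
  qed
  have U7: "U 2 7 = U 3 7"
  proof -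
    obtain a b c where l: "a = \<zero>" "b \<in> carrier F" "c \<in> carrier F" "b \<noteq> \<zero>"
      and r: "\<forall>i\<in>{1..9}. R9_row GF3 (vec3 0 1 2) i = 0 \<longrightarrow> a \<otimes> U 1 i \<oplus> (b \<otimes> U 2 i \<oplus> c \<otimes> U 3 i) = \<zero>"
      using chain'[of 0 1 2] by (auto simp: R9_lines_def)
    have "b \<oplus> c = \<zero>" using r[rule_format, of 4] l U4 by (simp add: rows)
    moreover have "b \<otimes> U 2 7 \<oplus> c \<otimes> U 3 7 = \<zero>" using r[rule_format, of 7] l Uc by (simp add: rows)
    ultimately show ?thesis by (rule sums_zero_imp_eq_right[OF l(2,3) Uc(8) Uc(9) l(4)])
  qed
  have U9: "U 1 9 = U 3 9"
  proof -
    obtain a b c where l: "a \<in> carrier F" "b = \<zero>" "c \<in> carrier F" "a \<noteq> \<zero>"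
      and r: "\<forall>i\<in>{1..9}. R9_row GF3 (vec3 1 0 2) i = 0 \<longrightarrow> a \<otimes> U 1 i \<oplus> (b \<otimes> U 2 i \<oplus> c \<otimes> U 3 i) = \<zero>"
      using chain'[of 1 0 2] by (auto simp: R9_lines_def)
    have "a \<oplus> c = \<zero>" using r[rule_format, of 4] l U4 by (simp add: rows)
    moreover have "a \<otimes> U 1 9 \<oplus> c \<otimes> U 3 9 = \<zero>" using r[rule_format, of 9] l Uc by (simp add: rows)
    ultimately show ?thesis by (rule sums_zero_imp_eq_right[OF l(1,3) Uc(13) Uc(15) l(4)])
  qed
  have z: "U 3 5 = \<zero>" "U 3 6 = \<zero>" "U 1 7 = \<zero>" "U 1 8 = \<zero>" "U 2 9 = \<zero>"
    and nz: "U 1 5 \<noteq> \<zero>" "U 2 5 \<noteq> \<zero>" "U 2 7 \<noteq> \<zero>" "U 3 7 \<noteq> \<zero>" "U 3 9 \<noteq> \<zero>" "U 1 6 \<noteq> \<zero>" "U 2 8 \<noteq> \<zero>"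
    using Uz by (simp_all add: rows)
  have U6: "U 1 6 \<oplus> U 2 6 = \<zero>"
  proof -
    obtain a b c where l: "a \<in> carrier F" "b \<in> carrier F" "c \<in> carrier F" "a \<noteq> \<zero>"
      and r: "\<forall>i\<in>{1..9}. R9_row GF3 (vec3 1 1 2) i = 0 \<longrightarrow> a \<otimes> U 1 i \<oplus> (b \<otimes> U 2 i \<oplus> c \<otimes> U 3 i) = \<zero>"
      using chain'[of 1 1 2] by (auto simp: R9_lines_def)
    have "b \<otimes> U 2 7 \<oplus> c \<otimes> U 2 7 = \<zero>" using r[rule_format, of 7] l Uc z U7 by (simp add: rows)
    then have bc: "b \<oplus> c = \<zero>" by (rule sum_zero_cancel_right[OF l(2,3) Uc(8) nz(3)])
    have "a \<otimes> U 3 9 \<oplus> c \<otimes> U 3 9 = \<zero>" using r[rule_format, of 9] l Uc z U9 by (simp add: rows)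
    then have "a \<oplus> c = \<zero>" by (rule sum_zero_cancel_right[OF l(1,3) Uc(15) nz(5)])
    from eq_of_sums_zero[OF l(1-3) this bc] have "a = b" .
    then have "a \<otimes> U 1 6 \<oplus> a \<otimes> U 2 6 = \<zero>" using r[rule_format, of 6] l Uc z by (simp add: rows)
    then show ?thesis by (rule sum_zero_cancel_left[OF l(1) Uc(4) Uc(5) l(4)])
  qed
  have U8: "U 2 8 \<oplus> U 3 8 = \<zero>"
  proof -
    obtain a b c where l: "a \<in> carrier F" "b \<in> carrier F" "c \<in> carrier F" "b \<noteq> \<zero>"
      and r: "\<forall>i\<in>{1..9}. R9_row GF3 (vec3 1 2 2) i = 0 \<longrightarrow> a \<otimes> U 1 i \<oplus> (b \<otimes> U 2 i \<oplus> c \<otimes> U 3 i) = \<zero>"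
      using chain'[of 1 2 2] by (auto simp: R9_lines_def)
    have "a \<otimes> U 2 5 \<oplus> b \<otimes> U 2 5 = \<zero>" using r[rule_format, of 5] l Uc z U5 by (simp add: rows)
    then have "a \<oplus> b = \<zero>" by (rule sum_zero_cancel_right[OF l(1,2) Uc(2) nz(2)])
    then have ba: "b \<oplus> a = \<zero>" using l by (simp add: a_comm)
    have "a \<otimes> U 3 9 \<oplus> c \<otimes> U 3 9 = \<zero>" using r[rule_format, of 9] l Uc z U9 by (simp add: rows)
    then have "a \<oplus> c = \<zero>" by (rule sum_zero_cancel_right[OF l(1,3) Uc(15) nz(5)])
    then have "c \<oplus> a = \<zero>" using l by (simp add: a_comm)
    from eq_of_sums_zero[OF l(2,3,1) ba this] have "b = c" .
    then have "b \<otimes> U 2 8 \<oplus> b \<otimes> U 3 8 = \<zero>" using r[rule_format, of 8] l Uc z by (simp add: rows)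
    then show ?thesis by (rule sum_zero_cancel_left[OF l(2) Uc(11) Uc(12) l(4)])
  qed
  obtain a b c where l: "a \<in> carrier F" "b \<in> carrier F" "c \<in> carrier F" "a \<noteq> \<zero>"
    and r: "\<forall>i\<in>{1..9}. R9_row GF3 (vec3 1 1 1) i = 0 \<longrightarrow> a \<otimes> U 1 i \<oplus> (b \<otimes> U 2 i \<oplus> c \<otimes> U 3 i) = \<zero>"
    using chain'[of 1 1 1] by (auto simp: R9_lines_def)
  have "a \<otimes> U 1 6 \<oplus> b \<otimes> U 2 6 = \<zero>" using r[rule_format, of 6] l Uc z by (simp add: rows)
  then have ab: "a = b" by (rule sums_zero_imp_eq_left[OF l(1,2) Uc(4) Uc(5) nz(6) U6])
  have "b \<otimes> U 2 8 \<oplus> c \<otimes> U 3 8 = \<zero>" using r[rule_format, of 8] l Uc z by (simp add: rows)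
  then have bc: "b = c" by (rule sums_zero_imp_eq_left[OF l(2,3) Uc(11) Uc(12) nz(7) U8])
  have "a \<otimes> \<one> \<oplus> (a \<otimes> \<one> \<oplus> a \<otimes> \<one>) = \<zero>" using r[rule_format, of 4] U4 ab bc by (simp add: rows)
  then have "a \<otimes> (\<one> \<oplus> (\<one> \<oplus> \<one>)) = \<zero>" using l by (simp only: r_distr one_closed add.m_closed)
  then show ?thesis using l mult_eq_zero_iff[of a "\<one> \<oplus> (\<one> \<oplus> \<one>)"] by simp
qed

end

section \<open>Recovering the group from a representation of \<open>Q\<^sub>3(G)\<close>\<close>

lemma (in skew_field_ring) sum_zero_iff_ratio:
  assumes "p \<in> carrier F" "p \<noteq> \<zero>" "q \<in> carrier F" "l \<in> carrier F" "k \<in> carrier F"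
  shows "l \<otimes> p \<oplus> k \<otimes> q = \<zero> \<longleftrightarrow> l = k \<otimes> (\<ominus> (q \<otimes> inv p))"
proof -
  note i = nonzero_inv[OF assms(1,2)]
  have "l \<otimes> p \<oplus> k \<otimes> q = (l \<ominus> k \<otimes> (\<ominus> (q \<otimes> inv p))) \<otimes> p"
    using assms i by (simp add: minus_eq l_distr r_minus l_minus m_assoc)
  also have "\<dots> = \<zero> \<longleftrightarrow> l \<ominus> k \<otimes> (\<ominus> (q \<otimes> inv p)) = \<zero>"
    using assms i mult_eq_zero_iff[of "l \<ominus> k \<otimes> (\<ominus> (q \<otimes> inv p))" p] by simp
  also have "\<dots> \<longleftrightarrow> l = k \<otimes> (\<ominus> (q \<otimes> inv p))"
    using assms i by auto
  finally show ?thesis .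
qed

lemma (in skew_field_ring) left_cancel_one:
  assumes "x \<in> carrier F" "a \<in> carrier F" "x \<noteq> \<zero>" "x = x \<otimes> a"
  shows "a = \<one>"
proof -
  note i = nonzero_inv[OF assms(1,3)]
  have "a = inv x \<otimes> (x \<otimes> a)" using i assms(1,2) by (simp flip: m_assoc)
  also have "\<dots> = \<one>" using i by (simp only: assms(4)[symmetric])
  finally show ?thesis .
qed

context skew_field_representation
begin

text \<open>The values at \<open>g\<close> are the negated ratios of the two nonzero entries in the
  columns a, b and c labelled by \<open>g\<close>. A chain vanishes at such a column exactly when
  two of its coefficients are related by that ratio, so the chain of a cocircuit given by
  \<open>y\<close> has coefficients \<open>l\<close> that satisfy the same relations as
  \<open>y\<close>.\<close>

lemma quaternion_coefficients:
  obtains \<alpha> \<beta> \<gamma> :: "quat \<Rightarrow> 'r" where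
    "\<forall>g\<in>quats. \<alpha> g \<in> carrier F \<and> \<beta> g \<in> carrier F \<and> \<gamma> g \<in> carrier F"
    "\<alpha> quat_1 = \<one>" "\<beta> quat_1 = \<one>" "\<gamma> quat_1 = \<one>"
    "\<forall>y\<in>{1..3::nat} \<rightarrow> quats0. (\<exists>t\<in>{1..3}. y t \<noteq> 0) \<longrightarrow>
      (\<exists>l. (\<forall>t\<in>{1..3}. l t \<in> carrier F \<and> (l t = \<zero> \<longleftrightarrow> y t = 0)) \<and>
        (\<forall>g\<in>quats. (l 1 = l 2 \<otimes> \<alpha> g \<longleftrightarrow> y 1 = quat_mult (y 2) g) \<and>
          (l 2 = l 3 \<otimes> \<beta> g \<longleftrightarrow> y 2 = quat_mult (y 3) g) \<and>
          (l 3 = l 1 \<otimes> \<gamma> g \<longleftrightarrow> y 3 = quat_mult (y 1) g)))"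
proof -
  define ev :: "nat \<Rightarrow> nat \<Rightarrow> quat" where "ev t s = (if s = t then quat_1 else 0)" for t s
  have three: "t = 1 \<or> t = 2 \<or> t = 3" if "t \<in> {1..3}" for t :: nat using that by auto
  have q1: "quat_1 \<noteq> 0" by (rule H.one_neq_zero[simplified])
  have one0: "quat_1 \<in> quats0" "0 \<in> quats0" using quat_1_in_quats by (simp_all add: quats0_def)
  have coc: "Inr ` Q3_support y \<in> cocircuits (R9 \<oplus>\<^sub>M Q3_quaternion)"
    if "y \<in> {1..3} \<rightarrow> quats0" "t \<in> {1..3}" "y t \<noteq> 0" for y t
  proof -
    have "Q3_support y \<in> cocircuits Q3_quaternion" unfolding cocircuits_Q3 using that by blast
    then show ?thesis unfolding cocircuits_sum by blast
  qed
  have zero_iff: "c (Inr e) = \<zero> \<longleftrightarrow> Q3_row quaternions id y e = 0"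
    if "support c = Inr ` Q3_support y" "e \<in> Q3_ground" for c y e
  proof -
    have "c (Inr e) \<noteq> \<zero> \<longleftrightarrow> Inr e \<in> support c" using that(2) by (auto simp: chain_support_def)
    also have "\<dots> \<longleftrightarrow> Q3_row quaternions id y e \<noteq> 0" unfolding that(1) using that(2) by (auto simp: Q3_support_def)
    finally show ?thesis by blast
  qed
  have inQ: "Elt_e t \<in> Q3_ground" if "t \<in> {1..3}" for t using that by simp
  \<comment> \<open>The line of (1, 1, 1) passes through the three columns labelled 1. Scaling the
    unit chains to agree with its chain \<open>v\<close> at the unit columns makes all coefficients
    of \<open>v\<close> equal to 1, so the three maps take the value 1 at 1.\<close>
  define w :: "nat \<Rightarrow> quat" where "w t = quat_1" for t
  have "Inr ` Q3_support w \<in> cocircuits (R9 \<oplus>\<^sub>M Q3_quaternion)"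
    using coc[of w 1] one0 q1 by (simp add: w_def)
  then obtain v where v: "v \<in> C" "support v = Inr ` Q3_support w" by (rule cocircuit_chain)
  have vc: "v (Inr e) \<in> carrier F" if "e \<in> Q3_ground" for e using chain_closed[OF v(1), OF InrI[OF that]] .
  have vz: "v (Inr (Elt_e t)) \<noteq> \<zero>" if "t \<in> {1..3}" for t
    using zero_iff[OF v(2) inQ[OF that]] q1 by (simp add: w_def)
  have "\<exists>c. c \<in> C \<and> support c = Inr ` Q3_support (ev t) \<and> c (Inr (Elt_e t)) = v (Inr (Elt_e t))"
    if t: "t \<in> {1..3}" for t
  proof -
    have "ev t \<in> {1..3} \<rightarrow> quats0" "ev t t \<noteq> 0" using one0 q1 by (simp_all add: ev_def)
    then have "Inr ` Q3_support (ev t) \<in> cocircuits (R9 \<oplus>\<^sub>M Q3_quaternion)" using coc t by blast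
    moreover have "(Inr (Elt_e t) :: nat + dowling_elt) \<in> Inr ` Q3_support (ev t)"
      using inQ[OF t] q1 by (simp add: Q3_support_def ev_def)
    ultimately show ?thesis using vc[OF inQ[OF t]] vz[OF t] by (metis normalized_chain)
  qed
  then obtain u where u: "\<And>t. t \<in> {1..3} \<Longrightarrow> u t \<in> C \<and> support (u t) = Inr ` Q3_support (ev t) \<and>
      u t (Inr (Elt_e t)) = v (Inr (Elt_e t))"
    by metis
  define U where "U t e = u t (Inr e)" for t e
  have U: "U t e \<in> carrier F" if "t \<in> {1..3}" "e \<in> Q3_ground" for t e
    unfolding U_def using u that chain_closed by blast
  have Uz: "U t e = \<zero> \<longleftrightarrow> Q3_row quaternions id (ev t) e = 0" if "t \<in> {1..3}" "e \<in> Q3_ground" for t e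
    unfolding U_def using u[OF that(1)] that(2) by (intro zero_iff) auto
  have expansion: "\<exists>l. (\<forall>t\<in>{1..3}. l t \<in> carrier F \<and> (l t = \<zero> \<longleftrightarrow> d (Inr (Elt_e t)) = \<zero>)) \<and>
      (\<forall>e\<in>Q3_ground. d (Inr e) = l 1 \<otimes> U 1 e \<oplus> (l 2 \<otimes> U 2 e \<oplus> l 3 \<otimes> U 3 e))"
    if d: "d \<in> C" "support d = Inr ` Q3_support y" for d y
  proof -
    have E1: "Inr ` Q3_support y \<subseteq> Inr ` Q3_ground" for y by (auto simp: Q3_support_def)
    have u': "u t \<in> C \<and> support (u t) \<subseteq> Inr ` Q3_ground" if "t \<in> {1..3}" for t using u[OF that] E1 by simp
    have p: "(Inr (Elt_e t) :: nat + dowling_elt) \<in> sum_ground" if "t \<in> {1..3}" for t using that by auto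
    have up: "u s (Inr (Elt_e t)) = \<zero> \<longleftrightarrow> s \<noteq> t" if st: "s \<in> {1..3}" "t \<in> {1..3}" for s t
      using Uz[OF st(1) inQ[OF st(2)]] q1 by (simp add: U_def ev_def)
    have meets: "\<exists>t\<in>{1..3}. Inr (Elt_e t) \<in> D"
      if D: "D \<in> cocircuits (R9 \<oplus>\<^sub>M Q3_quaternion)" "D \<subseteq> Inr ` Q3_ground" for D
    proof -
      consider D' where "D' \<in> cocircuits R9" "D = Inl ` D'" | D' where "D' \<in> cocircuits Q3_quaternion" "D = Inr ` D'"
        using D(1) unfolding cocircuits_sum by blast
      then show ?thesis
      proof cases
        case (1 D')
        then obtain y t where y: "D' = R9_support y" "t \<in> {1..3}" "y t \<noteq> 0"
          unfolding cocircuits_R9 R9_supports_def by blast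
        then have "t \<in> D'" using three[OF y(2)] by (auto simp: R9_support_def R9_row_simps)
        then show ?thesis using 1 D(2) by blast
      next
        case (2 D')
        then obtain y t where y: "D' = Q3_support y" "t \<in> {1..3}" "y t \<noteq> 0"
          unfolding cocircuits_Q3 by blast
        then have "Elt_e t \<in> D'" by (simp add: Q3_support_def)
        then show ?thesis using 2 y(2) by blast
      qed
    qed
    have d': "support d \<subseteq> Inr ` Q3_ground" using E1 d(2) by simp
    have "\<exists>l. (\<forall>t\<in>{1..3}. l t \<in> carrier F \<and> (l t = \<zero> \<longleftrightarrow> d (Inr (Elt_e t)) = \<zero>)) \<and>
      (\<forall>e\<in>sum_ground. d e = l 1 \<otimes> u 1 e \<oplus> (l 2 \<otimes> u 2 e \<oplus> l 3 \<otimes> u 3 e))"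
      by (rule chain_expansion[of u "Inr ` Q3_ground" "\<lambda>t. Inr (Elt_e t)" d]) (use u' p up meets d(1) d' in blast)+
    then obtain l where l: "\<forall>t\<in>{1..3::nat}. l t \<in> carrier F \<and> (l t = \<zero> \<longleftrightarrow> d (Inr (Elt_e t)) = \<zero>)"
      and de: "\<forall>e\<in>sum_ground. d e = l 1 \<otimes> u 1 e \<oplus> (l 2 \<otimes> u 2 e \<oplus> l 3 \<otimes> u 3 e)"
      by blast
    have "d (Inr e) = l 1 \<otimes> U 1 e \<oplus> (l 2 \<otimes> U 2 e \<oplus> l 3 \<otimes> U 3 e)" if "e \<in> Q3_ground" for e
      unfolding U_def by (rule bspec[OF de InrI[OF that]])
    then show ?thesis using l by (intro exI[of _ l] conjI) simp_all
  qed
  have "\<exists>idx. \<forall>g\<in>quats. idx g \<in> {1..8} \<and> quat_g (idx g) = g"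
    by (intro bchoice ballI) (metis quats_eq_quat_g)
  then obtain idx where idx: "\<And>g. g \<in> quats \<Longrightarrow> idx g \<in> {1..8}" "\<And>g. g \<in> quats \<Longrightarrow> quat_g (idx g) = g"
    by blast
  have g0: "g \<noteq> 0" if "g \<in> quats" for g using that zero_notin_quats by blast
  define a b c where "a g = Elt_a (idx g)" and "b g = Elt_b (idx g)" and "c g = Elt_c (idx g)" for g
  have abc: "a g \<in> Q3_ground" "b g \<in> Q3_ground" "c g \<in> Q3_ground" if "g \<in> quats" for g
    using idx(1)[OF that] by (simp_all add: a_def b_def c_def)
  have row: "Q3_row quaternions id y (a g) = 0 \<longleftrightarrow> y 1 = quat_mult (y 2) g"
    "Q3_row quaternions id y (b g) = 0 \<longleftrightarrow> y 2 = quat_mult (y 3) g"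
    "Q3_row quaternions id y (c g) = 0 \<longleftrightarrow> y 3 = quat_mult (y 1) g" if "g \<in> quats" for y g
    using HG.Q3_row_zero_iff[OF _ idx(1)[OF that], of y] by (simp_all add: a_def b_def c_def idx(2)[OF that])
  have Uabc: "U 1 (a g) \<noteq> \<zero>" "U 2 (a g) \<noteq> \<zero>" "U 3 (a g) = \<zero>"
    "U 1 (b g) = \<zero>" "U 2 (b g) \<noteq> \<zero>" "U 3 (b g) \<noteq> \<zero>"
    "U 1 (c g) \<noteq> \<zero>" "U 2 (c g) = \<zero>" "U 3 (c g) \<noteq> \<zero>" if g: "g \<in> quats" for g
    using g0[OF g] q1 by (simp_all add: Uz abc[OF g] row[OF g] ev_def)
  define \<alpha> where "\<alpha> g = \<ominus> (U 2 (a g) \<otimes> inv (U 1 (a g)))" for g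
  define \<beta> where "\<beta> g = \<ominus> (U 3 (b g) \<otimes> inv (U 2 (b g)))" for g
  define \<gamma> where "\<gamma> g = \<ominus> (U 1 (c g) \<otimes> inv (U 3 (c g)))" for g
  have closed: "\<alpha> g \<in> carrier F" "\<beta> g \<in> carrier F" "\<gamma> g \<in> carrier F" if g: "g \<in> quats" for g
    using U[of _ "a g"] U[of _ "b g"] U[of _ "c g"] abc[OF g] Uabc[OF g] nonzero_inv(1)
    by (simp_all add: \<alpha>_def \<beta>_def \<gamma>_def)
  have ratios: "d (Inr (a g)) = \<zero> \<longleftrightarrow> l 1 = l 2 \<otimes> \<alpha> g" "d (Inr (b g)) = \<zero> \<longleftrightarrow> l 2 = l 3 \<otimes> \<beta> g"
    "d (Inr (c g)) = \<zero> \<longleftrightarrow> l 3 = l 1 \<otimes> \<gamma> g"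
    if l: "\<forall>t\<in>{1..3::nat}. l t \<in> carrier F" and d: "\<forall>e\<in>Q3_ground. d (Inr e) = l 1 \<otimes> U 1 e \<oplus> (l 2 \<otimes> U 2 e \<oplus> l 3 \<otimes> U 3 e)"
      and g: "g \<in> quats" for d :: "nat + dowling_elt \<Rightarrow> 'r" and l g
  proof -
    have lc: "l 1 \<in> carrier F" "l 2 \<in> carrier F" "l 3 \<in> carrier F" using l by auto
    have Uc: "U t (a g) \<in> carrier F" "U t (b g) \<in> carrier F" "U t (c g) \<in> carrier F" if "t \<in> {1..3}" for t
      using U[OF that] abc[OF g] by simp_all
    have "d (Inr (a g)) = l 1 \<otimes> U 1 (a g) \<oplus> l 2 \<otimes> U 2 (a g)"
      using d abc(1)[OF g] Uabc(3)[OF g] lc Uc by simp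
    then show "d (Inr (a g)) = \<zero> \<longleftrightarrow> l 1 = l 2 \<otimes> \<alpha> g"
      unfolding \<alpha>_def using sum_zero_iff_ratio[of "U 1 (a g)" "U 2 (a g)" "l 1" "l 2"] lc Uc Uabc(1)[OF g] by simp
    have "d (Inr (b g)) = l 2 \<otimes> U 2 (b g) \<oplus> l 3 \<otimes> U 3 (b g)"
      using d abc(2)[OF g] Uabc(4)[OF g] lc Uc by simp
    then show "d (Inr (b g)) = \<zero> \<longleftrightarrow> l 2 = l 3 \<otimes> \<beta> g"
      unfolding \<beta>_def using sum_zero_iff_ratio[of "U 2 (b g)" "U 3 (b g)" "l 2" "l 3"] lc Uc Uabc(5)[OF g] by simp
    have "d (Inr (c g)) = l 3 \<otimes> U 3 (c g) \<oplus> l 1 \<otimes> U 1 (c g)"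
      using d abc(3)[OF g] Uabc(8)[OF g] lc Uc by (simp add: a_comm)
    then show "d (Inr (c g)) = \<zero> \<longleftrightarrow> l 3 = l 1 \<otimes> \<gamma> g"
      unfolding \<gamma>_def using sum_zero_iff_ratio[of "U 3 (c g)" "U 1 (c g)" "l 3" "l 1"] lc Uc Uabc(9)[OF g] by simp
  qed
  have one: "\<alpha> quat_1 = \<one>" "\<beta> quat_1 = \<one>" "\<gamma> quat_1 = \<one>"
  proof -
    obtain l where l: "\<forall>t\<in>{1..3::nat}. l t \<in> carrier F"
      and ve: "\<forall>e\<in>Q3_ground. v (Inr e) = l 1 \<otimes> U 1 e \<oplus> (l 2 \<otimes> U 2 e \<oplus> l 3 \<otimes> U 3 e)"
      using expansion[OF v] by blast
    have lc: "l 1 \<in> carrier F" "l 2 \<in> carrier F" "l 3 \<in> carrier F" using l by auto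
    have l1: "l t = \<one>" if t: "t \<in> {1..3}" for t
    proof -
      have z: "U s (Elt_e t) = \<zero>" if "s \<in> {1..3}" "s \<noteq> t" for s
        using Uz[OF that(1) inQ[OF t]] that(2) by (simp add: ev_def)
      have vt: "U t (Elt_e t) = v (Inr (Elt_e t))" "v (Inr (Elt_e t)) \<in> carrier F"
        using u[OF t] vc[OF inQ[OF t]] by (simp_all add: U_def)
      have "v (Inr (Elt_e t)) = l t \<otimes> v (Inr (Elt_e t))"
        using three[OF t] ve[rule_format, OF inQ[OF t]] z[of 1] z[of 2] z[of 3] lc vt
        by (elim disjE) simp_all
      then have "\<one> \<otimes> v (Inr (Elt_e t)) \<oplus> (\<ominus> l t) \<otimes> v (Inr (Elt_e t)) = \<zero>"
        using vt l t by (simp add: l_minus r_neg)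
      then have "\<one> \<oplus> \<ominus> l t = \<zero>"
        using sum_zero_cancel_right[of \<one> "\<ominus> l t" "v (Inr (Elt_e t))"] vt vz[OF t] l t by simp
      then show ?thesis using l t by (simp add: minus_eq[symmetric])
    qed
    have z: "v (Inr (a quat_1)) = \<zero>" "v (Inr (b quat_1)) = \<zero>" "v (Inr (c quat_1)) = \<zero>"
      using zero_iff[OF v(2)] abc[OF quat_1_in_quats] row[OF quat_1_in_quats, of w] by (simp_all add: w_def)
    have L: "l 1 = \<one>" "l 2 = \<one>" "l 3 = \<one>" by (simp_all add: l1)
    have r: "\<one> = \<one> \<otimes> \<alpha> quat_1" "\<one> = \<one> \<otimes> \<beta> quat_1" "\<one> = \<one> \<otimes> \<gamma> quat_1"
      using ratios[OF l ve quat_1_in_quats] z unfolding L by blast+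
    show "\<alpha> quat_1 = \<one>" "\<beta> quat_1 = \<one>" "\<gamma> quat_1 = \<one>"
      using left_cancel_one[OF one_closed _ one_neq_zero] r closed[OF quat_1_in_quats] by blast+
  qed
  have main: "\<forall>y\<in>{1..3::nat} \<rightarrow> quats0. (\<exists>t\<in>{1..3}. y t \<noteq> 0) \<longrightarrow>
      (\<exists>l. (\<forall>t\<in>{1..3}. l t \<in> carrier F \<and> (l t = \<zero> \<longleftrightarrow> y t = 0)) \<and>
        (\<forall>g\<in>quats. (l 1 = l 2 \<otimes> \<alpha> g \<longleftrightarrow> y 1 = quat_mult (y 2) g) \<and>
          (l 2 = l 3 \<otimes> \<beta> g \<longleftrightarrow> y 2 = quat_mult (y 3) g) \<and>
          (l 3 = l 1 \<otimes> \<gamma> g \<longleftrightarrow> y 3 = quat_mult (y 1) g)))"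
  proof (intro ballI impI)
    fix y :: "nat \<Rightarrow> quat" assume y: "y \<in> {1..3} \<rightarrow> quats0" "\<exists>t\<in>{1..3}. y t \<noteq> 0"
    obtain t where t: "t \<in> {1..3}" "y t \<noteq> 0" using y(2) by blast
    obtain d where d: "d \<in> C" "support d = Inr ` Q3_support y"
      by (rule cocircuit_chain[OF coc[OF y(1) t]])
    obtain l where l: "\<forall>t\<in>{1..3::nat}. l t \<in> carrier F \<and> (l t = \<zero> \<longleftrightarrow> d (Inr (Elt_e t)) = \<zero>)"
      and de: "\<forall>e\<in>Q3_ground. d (Inr e) = l 1 \<otimes> U 1 e \<oplus> (l 2 \<otimes> U 2 e \<oplus> l 3 \<otimes> U 3 e)"
      using expansion[OF d] by blast
    have lc: "\<forall>t\<in>{1..3::nat}. l t \<in> carrier F" using l by blast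
    have "l t = \<zero> \<longleftrightarrow> y t = 0" if "t \<in> {1..3}" for t
      using l that zero_iff[OF d(2) inQ[OF that]] by simp
    moreover have "(l 1 = l 2 \<otimes> \<alpha> g \<longleftrightarrow> y 1 = quat_mult (y 2) g) \<and>
          (l 2 = l 3 \<otimes> \<beta> g \<longleftrightarrow> y 2 = quat_mult (y 3) g) \<and>
          (l 3 = l 1 \<otimes> \<gamma> g \<longleftrightarrow> y 3 = quat_mult (y 1) g)" if g: "g \<in> quats" for g
      using ratios[OF lc de g] zero_iff[OF d(2)] abc[OF g] row[OF g, of y] by blast
    ultimately show "\<exists>l. (\<forall>t\<in>{1..3}. l t \<in> carrier F \<and> (l t = \<zero> \<longleftrightarrow> y t = 0)) \<and>
        (\<forall>g\<in>quats. (l 1 = l 2 \<otimes> \<alpha> g \<longleftrightarrow> y 1 = quat_mult (y 2) g) \<and>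
          (l 2 = l 3 \<otimes> \<beta> g \<longleftrightarrow> y 2 = quat_mult (y 3) g) \<and>
          (l 3 = l 1 \<otimes> \<gamma> g \<longleftrightarrow> y 3 = quat_mult (y 1) g))"
      using lc by blast
  qed
  show ?thesis using that[of \<alpha> \<beta> \<gamma>] closed one main by blast
qed

text \<open>The line of (h g, h, 1) passes through column a labelled g, column b labelled h and
  column c labelled k, the inverse of h g. Going round this triangle gives
  \<open>\<beta> h \<otimes> \<alpha> g \<otimes> \<gamma> k = \<one>\<close>. The cases h = 1 and g
  = 1 identify \<open>\<alpha>\<close> with \<open>\<beta>\<close>, and the general case is then
  multiplicativity.\<close>

lemma quaternion_homomorphism:
  obtains \<alpha> :: "quat \<Rightarrow> 'r" where "\<forall>g\<in>quats. \<alpha> g \<in> carrier F"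
    "\<alpha> quat_1 = \<one>" "\<alpha> (- quat_1) \<noteq> \<one>"
    "\<forall>g\<in>quats. \<forall>h\<in>quats. \<alpha> (quat_mult h g) = \<alpha> h \<otimes> \<alpha> g"
proof -
  obtain \<alpha> \<beta> \<gamma> :: "quat \<Rightarrow> 'r" where
    closed: "\<forall>g\<in>quats. \<alpha> g \<in> carrier F \<and> \<beta> g \<in> carrier F \<and> \<gamma> g \<in> carrier F"
    and one: "\<alpha> quat_1 = \<one>" "\<beta> quat_1 = \<one>" "\<gamma> quat_1 = \<one>"
    and main: "\<forall>y\<in>{1..3::nat} \<rightarrow> quats0. (\<exists>t\<in>{1..3}. y t \<noteq> 0) \<longrightarrow>
      (\<exists>l. (\<forall>t\<in>{1..3}. l t \<in> carrier F \<and> (l t = \<zero> \<longleftrightarrow> y t = 0)) \<and>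
        (\<forall>g\<in>quats. (l 1 = l 2 \<otimes> \<alpha> g \<longleftrightarrow> y 1 = quat_mult (y 2) g) \<and>
          (l 2 = l 3 \<otimes> \<beta> g \<longleftrightarrow> y 2 = quat_mult (y 3) g) \<and>
          (l 3 = l 1 \<otimes> \<gamma> g \<longleftrightarrow> y 3 = quat_mult (y 1) g)))"
    by (rule quaternion_coefficients)
  have q0: "g \<in> quats0" "g \<noteq> 0" if "g \<in> quats" for g
    using that zero_notin_quats by (auto simp: quats0_def)
  have l_ex: "\<exists>l1 l2 l3. l1 \<in> carrier F \<and> l2 \<in> carrier F \<and> l3 \<in> carrier F \<and> l2 \<noteq> \<zero> \<and>
      (l3 = \<zero> \<longleftrightarrow> z = 0) \<and> (\<forall>g\<in>quats. (l1 = l2 \<otimes> \<alpha> g \<longleftrightarrow> x = quat_mult y g) \<and>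
        (l2 = l3 \<otimes> \<beta> g \<longleftrightarrow> y = quat_mult z g) \<and> (l3 = l1 \<otimes> \<gamma> g \<longleftrightarrow> z = quat_mult x g))"
    if "x \<in> quats" "y \<in> quats" "z \<in> quats0" for x y z
  proof -
    have "vec3 x y z \<in> {1..3} \<rightarrow> quats0" using that q0 by (simp only: vec3_in)
    moreover have "\<exists>t\<in>{1..3}. vec3 x y z t \<noteq> 0"
      using q0(2)[OF that(1)] by (intro bexI[of _ 1]) simp_all
    ultimately obtain l where l: "\<forall>t\<in>{1..3}. l t \<in> carrier F \<and> (l t = \<zero> \<longleftrightarrow> vec3 x y z t = 0)"
      and r: "\<forall>g\<in>quats. (l 1 = l 2 \<otimes> \<alpha> g \<longleftrightarrow> vec3 x y z 1 = quat_mult (vec3 x y z 2) g) \<and>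
          (l 2 = l 3 \<otimes> \<beta> g \<longleftrightarrow> vec3 x y z 2 = quat_mult (vec3 x y z 3) g) \<and>
          (l 3 = l 1 \<otimes> \<gamma> g \<longleftrightarrow> vec3 x y z 3 = quat_mult (vec3 x y z 1) g)"
      using main by blast
    have "l 1 \<in> carrier F" "l 2 \<in> carrier F" "l 3 \<in> carrier F" "l 2 \<noteq> \<zero>" "l 3 = \<zero> \<longleftrightarrow> z = 0"
      using l q0(2)[OF that(2)] by (simp_all add: atLeastAtMost_1_3)
    then show ?thesis using r[unfolded vec3_simps] by blast
  qed
  have product: "\<beta> h \<otimes> \<alpha> g \<otimes> \<gamma> k = \<one>"
    if g: "g \<in> quats" and h: "h \<in> quats" and k: "k \<in> quats" "quat_mult (quat_mult h g) k = quat_1" for g h k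
  proof -
    have "quat_1 \<in> quats0" using q0(1)[OF quat_1_in_quats] .
    then obtain l1 l2 l3 where l: "l1 \<in> carrier F" "l2 \<in> carrier F" "l3 \<in> carrier F"
      and "l3 = \<zero> \<longleftrightarrow> quat_1 = 0"
      and r: "\<forall>g'\<in>quats. (l1 = l2 \<otimes> \<alpha> g' \<longleftrightarrow> quat_mult h g = quat_mult h g') \<and>
        (l2 = l3 \<otimes> \<beta> g' \<longleftrightarrow> h = quat_mult quat_1 g') \<and> (l3 = l1 \<otimes> \<gamma> g' \<longleftrightarrow> quat_1 = quat_mult (quat_mult h g) g')"
      using l_ex[OF quats_mult[OF h g] h, of quat_1] by blast
    then have l3: "l3 \<noteq> \<zero>" using q0(2)[OF quat_1_in_quats] by simp
    have e: "l1 = l2 \<otimes> \<alpha> g" "l2 = l3 \<otimes> \<beta> h" "l3 = l1 \<otimes> \<gamma> k"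
      using r g h k by simp_all
    have c: "\<alpha> g \<in> carrier F" "\<beta> h \<in> carrier F" "\<gamma> k \<in> carrier F" using closed g h k by simp_all
    have "l3 = l3 \<otimes> \<beta> h \<otimes> \<alpha> g \<otimes> \<gamma> k" using e by metis
    then have "l3 = l3 \<otimes> (\<beta> h \<otimes> \<alpha> g \<otimes> \<gamma> k)" using c l(3) by (simp add: m_assoc)
    then show ?thesis by (intro left_cancel_one[OF l(3) _ l3]) (use c in simp_all)
  qed
  have unique: "x = y" if "x \<in> carrier F" "y \<in> carrier F" "z \<in> carrier F" "x \<otimes> z = \<one>" "y \<otimes> z = \<one>" for x y z
  proof -
    have z: "z \<noteq> \<zero>" using that one_neq_zero by auto
    note i = nonzero_inv[OF that(3) z]
    have "x = x \<otimes> z \<otimes> inv z" "y = y \<otimes> z \<otimes> inv z" using i that(1-3) by (simp_all add: m_assoc)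
    then show ?thesis using that(4,5) by simp
  qed
  have \<alpha>\<beta>: "\<alpha> g = \<beta> g" if g: "g \<in> quats" for g
  proof -
    obtain k where k: "k \<in> quats" "quat_mult g k = quat_1" by (rule quats_inverse[OF g])
    have "\<beta> g \<otimes> \<gamma> k = \<one>" "\<alpha> g \<otimes> \<gamma> k = \<one>"
      using product[OF quat_1_in_quats g k(1)] product[OF g quat_1_in_quats k(1)] k(2) one closed g k(1) by simp_all
    then show ?thesis using unique closed g k(1) by blast
  qed
  have "\<alpha> (quat_mult h g) = \<alpha> h \<otimes> \<alpha> g" if g: "g \<in> quats" and h: "h \<in> quats" for g h
  proof -
    note hg = quats_mult[OF h g]
    obtain k where k: "k \<in> quats" "quat_mult (quat_mult h g) k = quat_1" by (rule quats_inverse[OF hg])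
    have "\<alpha> h \<otimes> \<alpha> g \<otimes> \<gamma> k = \<one>" using product[OF g h k] \<alpha>\<beta>[OF h] by simp
    moreover have "\<alpha> (quat_mult h g) \<otimes> \<gamma> k = \<one>"
      using product[OF hg quat_1_in_quats k(1)] k(2) one closed hg by simp
    ultimately show ?thesis using unique[of "\<alpha> (quat_mult h g)" "\<alpha> h \<otimes> \<alpha> g" "\<gamma> k"] closed g h hg k(1) by simp
  qed
  \<comment> \<open>The line of (-1, 1, 0) passes through the column a labelled -1 but not through
    the one labelled 1, so \<open>\<alpha>\<close> separates the two.\<close>
  moreover have "\<alpha> (- quat_1) \<noteq> \<one>"
  proof
    have m: "- quat_1 \<in> quats" by (simp add: quaternion_group_def)
    assume a: "\<alpha> (- quat_1) = \<one>"
    have "0 \<in> quats0" by (simp add: quats0_def)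
    then obtain l1 l2 l3 where l: "l1 \<in> carrier F" "l2 \<in> carrier F"
      and r: "\<forall>g\<in>quats. l1 = l2 \<otimes> \<alpha> g \<longleftrightarrow> - quat_1 = quat_mult quat_1 g"
      using l_ex[OF m quat_1_in_quats, of 0] by blast
    have "l1 = l2 \<otimes> \<alpha> (- quat_1)" using r m by simp
    moreover have "l1 \<noteq> l2 \<otimes> \<alpha> quat_1" using r quat_1_in_quats by (simp add: quat_1_def)
    ultimately show False using a one(1) by simp
  qed
  ultimately show ?thesis using that[of \<alpha>] closed one(1) by blast
qed

text \<open>In characteristic 3, \<open>(1 + i + j) (1 - i - j) = 1 - (i + j)\<^sup>2 = 1 + 2 = 0\<close>.\<close>
lemma inconsistent: False
proof -
  obtain \<alpha> :: "quat \<Rightarrow> 'r" where closed: "\<forall>g\<in>quats. \<alpha> g \<in> carrier F"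
    and one: "\<alpha> quat_1 = \<one>" "\<alpha> (- quat_1) \<noteq> \<one>"
    and mult: "\<forall>g\<in>quats. \<forall>h\<in>quats. \<alpha> (quat_mult h g) = \<alpha> h \<otimes> \<alpha> g"
    by (rule quaternion_homomorphism)
  have G: "quat_i \<in> quats" "quat_j \<in> quats" "quat_k \<in> quats" "- quat_1 \<in> quats" "- quat_k \<in> quats"
    by (simp_all add: quaternion_group_def)
  define z p q where "z = \<alpha> (- quat_1)" and "p = \<alpha> quat_i" and "q = \<alpha> quat_j"
  have c: "z \<in> carrier F" "p \<in> carrier F" "q \<in> carrier F"
    using closed G by (simp_all add: z_def p_def q_def)
  have rel: "quat_mult (- quat_1) (- quat_1) = quat_1" "quat_mult quat_i quat_i = - quat_1"
    "quat_mult quat_j quat_j = - quat_1" "quat_mult quat_i quat_j = quat_k"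
    "quat_mult quat_j quat_i = quat_mult (- quat_1) quat_k"
    by (simp_all add: quat_unit_defs)
  have zz: "z \<otimes> z = \<one>" using mult G(4) rel(1) one(1) by (metis z_def)
  have pp: "p \<otimes> p = z" using mult G(1) rel(2) by (metis z_def p_def)
  have qq: "q \<otimes> q = z" using mult G(2) rel(3) by (metis z_def q_def)
  have qp: "q \<otimes> p = z \<otimes> (p \<otimes> q)"
    using mult G rel(4,5) by (metis z_def p_def q_def)
  \<comment> \<open>The image of -1 is a square root of 1 other than 1; without zero divisors it
    must be -1.\<close>
  have "(z \<ominus> \<one>) \<otimes> (z \<oplus> \<one>) = \<zero>"
    using c zz by (simp add: minus_eq l_distr r_distr l_minus a_ac r_neg r_neg1 r_neg2)
  then have "z \<ominus> \<one> = \<zero> \<or> z \<oplus> \<one> = \<zero>" using c mult_eq_zero_iff by simp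
  then have "z \<oplus> \<one> = \<zero>" using one(2) c by (auto simp: z_def)
  then have z: "z = \<ominus> \<one>" using minus_eq_of_sum_zero[of \<one> z] c by (simp add: a_comm)
  have two: "\<ominus> \<one> \<oplus> \<ominus> \<one> = \<one>"
    using three_eq_zero minus_equality[of \<one> "\<one> \<oplus> \<one>"] by (simp add: minus_add)
  define s where "s = p \<oplus> q"
  have s: "s \<in> carrier F" using c by (simp add: s_def)
  have anti: "q \<otimes> p = \<ominus> (p \<otimes> q)" using qp c z by (simp add: l_minus)
  have "s \<otimes> s = p \<otimes> p \<oplus> (q \<otimes> p \<oplus> (p \<otimes> q \<oplus> q \<otimes> q))"
    using c by (simp add: s_def l_distr r_distr a_ac)
  also have "\<dots> = \<one>" using pp qq anti z two c by (simp add: r_neg2 r_neg1)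
  finally have ss: "s \<otimes> s = \<one>" .
  have "(s \<ominus> \<one>) \<otimes> (s \<oplus> \<one>) = \<zero>"
    using s ss by (simp add: minus_eq l_distr r_distr l_minus a_ac r_neg r_neg1 r_neg2)
  then have "s \<ominus> \<one> = \<zero> \<or> s \<oplus> \<one> = \<zero>" using s mult_eq_zero_iff by simp
  then have "s = \<one> \<or> s = \<ominus> \<one>"
    using s minus_eq_of_sum_zero[of \<one> s] by (auto simp: a_comm)
  \<comment> \<open>Being 1 or -1, \<open>s\<close> commutes with \<open>p\<close>, and therefore so
    does \<open>q\<close>. But \<open>p\<close> and \<open>q\<close> also anticommute, so their
    product equals its own negative, which in characteristic 3 makes it zero.\<close>
  then have "s \<otimes> p = p \<otimes> s" using c by (auto simp: l_minus r_minus)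
  then have "p \<otimes> p \<oplus> q \<otimes> p = p \<otimes> p \<oplus> p \<otimes> q" using c by (simp add: s_def l_distr r_distr)
  then have "q \<otimes> p = p \<otimes> q" using c by simp
  then have e: "\<ominus> (p \<otimes> q) = p \<otimes> q" using anti by simp
  have "p \<otimes> q = (\<ominus> \<one> \<oplus> \<ominus> \<one>) \<otimes> (p \<otimes> q)" using two c by simp
  also have "\<dots> = \<ominus> (p \<otimes> q) \<oplus> \<ominus> (p \<otimes> q)" using c by (simp add: l_distr l_minus)
  also have "\<dots> = \<ominus> (p \<otimes> q) \<oplus> p \<otimes> q" using e by simp
  also have "\<dots> = \<zero>" using c by (simp add: l_neg)
  finally have "p = \<zero> \<or> q = \<zero>" using c mult_eq_zero_iff by simp
  then have "z = \<zero>" using pp qq c by auto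
  then show False using zz c one_neq_zero by auto
qed

end

theorem theorem3p37:
  shows "(\<exists>(R :: nat ring) G. skew_partial_field R G \<and>
            representable_over_partial_field (R9 \<oplus>\<^sub>M Q3_quaternion) R G) \<and>
         (\<forall>F :: 'f ring. skew_field F \<longrightarrow>
            \<not> representable_over_skew_field (R9 \<oplus>\<^sub>M Q3_quaternion) F)"
proof (intro conjI allI impI notI)
  show "\<exists>(R :: nat ring) G. skew_partial_field R G \<and>
      representable_over_partial_field (R9 \<oplus>\<^sub>M Q3_quaternion) R G"
    by (rule ex_nat_ring_representation)
next
  fix F :: "'f ring"
  assume F: "skew_field F" and "representable_over_skew_field (R9 \<oplus>\<^sub>M Q3_quaternion) F"
  then obtain C where C: "partial_field_chain_group F (carrier F - {\<zero>\<^bsub>F\<^esub>}) (ground (R9 \<oplus>\<^sub>M Q3_quaternion)) C"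
    "is_matroid_of_chain_group F (ground (R9 \<oplus>\<^sub>M Q3_quaternion)) C (R9 \<oplus>\<^sub>M Q3_quaternion)"
    unfolding representable_over_skew_field_def representable_over_partial_field_def by blast
  have ground: "ground (R9 \<oplus>\<^sub>M Q3_quaternion) = sum_ground"
    by (simp add: direct_sum_def ground_R9 ground_Q3)
  interpret skew_field_ring F by (rule skew_field_ringI[OF F])
  interpret skew_field_representation F C
    using C unfolding ground
    by unfold_locales (simp_all add: partial_field_chain_group_def is_matroid_of_chain_group_def)
  show False by (rule inconsistent)
qed

end
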